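(* Let $\ell\in\frac12\mathbb{N}$, $n\ge0$ and $k,j\in\{0,\dots,2\ell\}$. With $R_n$ and $M$ as in the context, the polynomials $\mathcal{R}_n(u)=R_n(u)M(u)$ satisfy $$\mathcal{R}_n(u)_{kj}=c_{k,0}(n)\,(-1)^j\,\frac{(-2\ell)_j\,(-k-n)_j}{j!\,(2\ell+2)_j}\;{}_4F_3\!\left({-j,\;j+1,\;-k,\;-2\ell-n-1\atop 1,\;-k-n,\;-2\ell};1\right)\;{}_2F_1\!\left({j-k-n,\;n+k+j+2\atop j+\frac32};u\right)$$ when $j-k-n\le0$, and $\mathcal{R}_n(u)_{kj}=0$ for $j-k-n>0$, where $$c_{k,0}(n)=(-1)^n4^{-n}\,\frac{n!\,(2\ell+2)_n}{(k+1)_n\,(2\ell-k+1)_n}.$$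
   Context: $\mathbb{N}=\{0,1,2,\dots\}$; matrices are $(2\ell+1)\times(2\ell+1)$, indexed by $0,\dots,2\ell$; $(a)_k$ is the Pochhammer symbol; $U_r$ is the Chebyshev polynomial of the second kind; $C^{(\alpha)}_n(x)=\frac{(2\alpha)_n}{n!}{}_2F_1(-n,n+2\alpha;\alpha+\frac12;\frac{1-x}2)$ is the Gegenbauer polynomial. The ${}_4F_3$ is the terminating sum over summation index $0\le r\le j$ (on which all denominators are nonzero). For $0\le m\le n\le2\ell$, $x\in[-1,1]$, $$W(x)_{n,m}=\sqrt{1-x^2}\sum_{t=0}^m\alpha_t(m,n)U_{n+m-2t}(x),\quad \alpha_t(m,n)=\frac{2\ell+1}{n+1}\frac{(2\ell-m)!\,m!}{(2\ell)!}(-1)^{m-t}\frac{(n-2\ell)_{m-t}}{(n+2)_{m-t}}\frac{(2\ell+2-t)_t}{t!},$$ and $W(x)_{n,m}=W(x)_{m,n}$ for $n<m$. $P_n$ is the unique monic (leading coefficient $I$) matrix-valued polynomial of degree $n$ with $\int_{-1}^1P_n(x)W(x)P_m(x)^*dx=0$ for $n\ne m$, and $R_n(u)=(-1)^n2^{-n}P_n(1-2u)$. The matrix $M(u)=L(1-2u)$, where $L(x)$ is unipotent lower triangular with $L(x)_{mk}=\frac{m!\,(2k+1)!}{(m+k+1)!\,k!}C^{(k+1)}_{m-k}(x)$ for $k\le m$ and $L(x)_{mk}=0$ for $k>m$. *)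

theory Defs
  imports
    "HOL-Analysis.Analysis"
    "HOL-Computational_Algebra.Computational_Algebra"
    "Jordan_Normal_Form.Schur_Decomposition"
begin

text \<open>
  Throughout, the natural number \<open>N\<close> stands for \<open>2\<ell>\<close>, so that \<open>\<ell>\<close> ranges over the
  nonnegative half-integers as \<open>N\<close> ranges over the naturals; matrices have size
  \<open>(N+1) \<times> (N+1)\<close> and are indexed from \<open>0\<close> to \<open>N\<close>.
\<close>

section \<open>Special functions\<close>

text \<open>
  The hypergeometric sum with upper parameters \<open>as\<close> and lower parameters \<open>bs\<close> at \<open>z\<close>, with
  summation index running over \<open>0 \<le> r \<le> K\<close>. It is only used for terminating series, with \<open>K\<close>
  such that some upper parameter is \<open>-K\<close>; no Pochhammer symbol of a lower parameter
  then vanishes on the summation range, even if a lower parameter is a nonpositive integer.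
\<close>

definition hypergeo_sum :: "nat \<Rightarrow> 'a::field_char_0 list \<Rightarrow> 'a list \<Rightarrow> 'a \<Rightarrow> 'a" where
  "hypergeo_sum K as bs z = (\<Sum>r\<le>K. fps_nth (fps_hypergeo as bs z) r)"

fun cheb_U :: "nat \<Rightarrow> 'a::comm_ring_1 \<Rightarrow> 'a" where
  "cheb_U 0 x = 1"
| "cheb_U (Suc 0) x = 2 * x"
| "cheb_U (Suc (Suc r)) x = 2 * x * cheb_U (Suc r) x - cheb_U r x"

definition gegenbauer :: "'a::field_char_0 \<Rightarrow> nat \<Rightarrow> 'a \<Rightarrow> 'a" where
  "gegenbauer \<alpha> n x =
     pochhammer (2 * \<alpha>) n / fact n *
     hypergeo_sum n [- of_nat n, of_nat n + 2 * \<alpha>] [\<alpha> + 1 / 2] ((1 - x) / 2)"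

section \<open>The matrix weight\<close>

definition weight_coeff :: "nat \<Rightarrow> nat \<Rightarrow> nat \<Rightarrow> nat \<Rightarrow> real" where
  "weight_coeff N t m n =
     (real N + 1) / (real n + 1) * (fact (N - m) * fact m / fact N) * (- 1) ^ (m - t) *
     (pochhammer (real n - real N) (m - t) / pochhammer (real n + 2) (m - t)) *
     (pochhammer (real N + 2 - real t) t / fact t)"

definition weight_lower :: "nat \<Rightarrow> real \<Rightarrow> nat \<Rightarrow> nat \<Rightarrow> real" where
  "weight_lower N x n m =
     sqrt (1 - x\<^sup>2) * (\<Sum>t\<le>m. weight_coeff N t m n * cheb_U (n + m - 2 * t) x)"

definition weight :: "nat \<Rightarrow> real \<Rightarrow> complex mat" where
  "weight N x = mat (N + 1) (N + 1)
     (\<lambda>(n, m). of_real (if m \<le> n then weight_lower N x n m else weight_lower N x m n))"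

section \<open>Monic matrix-valued orthogonal polynomials\<close>

text \<open>
  A matrix-valued polynomial is represented by the matrix of its scalar polynomial entries.
\<close>

definition eval_mat :: "complex poly mat \<Rightarrow> complex \<Rightarrow> complex mat" where
  "eval_mat P z = map_mat (\<lambda>p. poly p z) P"

definition monic_mat_poly :: "nat \<Rightarrow> nat \<Rightarrow> complex poly mat \<Rightarrow> bool" where
  "monic_mat_poly d n P \<longleftrightarrow>
     P \<in> carrier_mat d d \<and>
     (\<forall>i<d. \<forall>j<d. degree (P $$ (i, j)) \<le> n) \<and>
     map_mat (\<lambda>p. coeff p n) P = 1\<^sub>m d"

text \<open>The matrix-valued pairing \<open>\<integral> P(x) W(x) Q(x)\<^sup>* dx\<close> over \<open>[-1,1]\<close>, taken entrywise.\<close>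

definition weight_pairing :: "nat \<Rightarrow> complex poly mat \<Rightarrow> complex poly mat \<Rightarrow> complex mat" where
  "weight_pairing N P Q = mat (N + 1) (N + 1)
     (\<lambda>(i, j). integral {-1..1} (\<lambda>x::real.
        (eval_mat P (of_real x) * weight N x * mat_adjoint (eval_mat Q (of_real x))) $$ (i, j)))"

definition monic_orthogonal :: "nat \<Rightarrow> (nat \<Rightarrow> complex poly mat) \<Rightarrow> bool" where
  "monic_orthogonal N P \<longleftrightarrow>
     (\<forall>n. monic_mat_poly (N + 1) n (P n)) \<and>
     (\<forall>n m. n \<noteq> m \<longrightarrow> weight_pairing N (P n) (P m) = 0\<^sub>m (N + 1) (N + 1))"

section \<open>The matrices \<open>L\<close> and \<open>M\<close> and the rescaled polynomials\<close>

definition L_mat :: "nat \<Rightarrow> complex \<Rightarrow> complex mat" where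
  "L_mat N x = mat (N + 1) (N + 1)
     (\<lambda>(m, k). if k \<le> m
        then fact m * fact (2 * k + 1) / (fact (m + k + 1) * fact k) *
             gegenbauer (of_nat k + 1) (m - k) x
        else 0)"

definition M_mat :: "nat \<Rightarrow> complex \<Rightarrow> complex mat" where
  "M_mat N u = L_mat N (1 - 2 * u)"

definition R_mat :: "(nat \<Rightarrow> complex poly mat) \<Rightarrow> nat \<Rightarrow> complex \<Rightarrow> complex mat" where
  "R_mat P n u = ((- 1) ^ n / 2 ^ n) \<cdot>\<^sub>m eval_mat (P n) (1 - 2 * u)"

definition calR_mat :: "nat \<Rightarrow> (nat \<Rightarrow> complex poly mat) \<Rightarrow> nat \<Rightarrow> complex \<Rightarrow> complex mat" where
  "calR_mat N P n u = R_mat P n u * M_mat N u"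

definition c_coeff :: "nat \<Rightarrow> nat \<Rightarrow> nat \<Rightarrow> complex" where
  "c_coeff N n k =
     (- 1) ^ n / 4 ^ n * (fact n * pochhammer (of_nat N + 2) n) /
     (pochhammer (of_nat k + 1) n * pochhammer (of_nat N - of_nat k + 1) n)"

end

theory Submission
  imports Defs
begin

text \<open>
Write \<open>N = 2\<ell>\<close> and \<open>A = n + k\<close>. The proof does not transform the given polynomials \<open>P\<^sub>n\<close>
but builds a candidate for them and then uses uniqueness.

Let \<open>F\<^sub>n\<close> be the matrix of the right-hand sides, written in \<open>x = 1 - 2u\<close> and scaled by
\<open>(-2)\<^sup>n\<close>, so that \<open>P\<^sub>n L = F\<^sub>n\<close> is to be shown. Its entry \<open>(k, j)\<close> is a constant times the
Gegenbauer polynomial \<open>C\<^sup>(\<^sup>j\<^sup>+\<^sup>1\<^sup>)\<close> of degree \<open>A - j\<close>, and as a function of \<open>j\<close> the constant is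
a Racah polynomial times an explicit factor. Multiplying a Gegenbauer polynomial by \<open>x\<close> gives the two neighbouring degrees.
At degree \<open>A + 1\<close> and at degree \<open>A - 1\<close> the resulting coefficients are re-expanded by a contiguous
relation of the Racah polynomials (\<open>racah_raise\<close>, \<open>racah_lower\<close>). Both relations hold
term by term in the right basis, and together they say that row \<open>k\<close> of \<open>x F\<^sub>n\<close> is the sum of row \<open>k\<close> of
\<open>F\<^sub>n\<^sub>+\<^sub>1\<close> and of multiples of the rows \<open>k + 1\<close> and \<open>k - 1\<close> of \<open>F\<^sub>n\<close> and of row \<open>k\<close> of \<open>F\<^sub>n\<^sub>-\<^sub>1\<close>, with
scalars that do not depend on the column (\<open>row_poly_recurrence\<close>). Since \<open>F\<^sub>n\<^sub>+\<^sub>1\<close> occurs with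
coefficient \<open>1\<close>, running the same recurrence from the identity matrix produces
monic matrix polynomials \<open>Q\<^sub>n\<close> (\<open>recpoly\<close>), and \<open>Q\<^sub>n L = F\<^sub>n\<close> follows from
\<open>F\<^sub>0 = L\<close>, which is a Saalschuetz summation.

Orthogonality of the \<open>Q\<^sub>n\<close> also comes from the recurrence: \<open>x\<^sup>m Q\<^sub>n\<close> is a combination of rows of
\<open>Q\<^sub>i\<close> with \<open>i \<ge> n - m\<close>, so it is enough that \<open>\<integral> Q\<^sub>n W = 0\<close> for all \<open>n \<ge> 1\<close>. Here the
decomposition \<open>W = \<surd>(1 - x\<^sup>2) L T L\<^sup>t\<close> with diagonal \<open>T\<close> (\<open>wpoly_eq_cheb_sum\<close>) reduces the integral to scalar
Gegenbauer orthogonality. What survives is the sum of a polynomial of degree below \<open>A\<close> in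
\<open>j (j + 1)\<close> against the weights \<open>(2j + 1) (-A)\<^sub>j / (A + 2)\<^sub>j\<close>, and that sum telescopes to zero
(\<open>racah_moment_zero\<close>).

Finally \<open>D = P\<^sub>n - Q\<^sub>n\<close> has degree less than \<open>n\<close>, so it is orthogonal to both \<open>P\<^sub>n\<close> and \<open>Q\<^sub>n\<close>, hence
to itself. The decomposition shows that the pairing is positive definite, so \<open>D = 0\<close>
(\<open>monic_orthogonal_eq_recpoly\<close>).
\<close>

(* smult is the scaling of polynomials throughout *)
hide_const (open) Module.smult

section \<open>Normalised Gegenbauer polynomials\<close>

text \<open>
The Gegenbauer polynomial \<open>C\<^sup>(\<^sup>j\<^sup>+\<^sup>1\<^sup>)\<close> of degree \<open>a - j\<close>, normalised to take the value \<open>1\<close> at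
\<open>x = 1\<close>. The index \<open>a\<close> is the degree plus \<open>j\<close>: differentiation then changes \<open>j\<close> only, and
multiplication by \<open>x\<close> changes \<open>a\<close> only. The coefficients are those of powers of
\<open>u = (1 - x) / 2\<close>, where a structural relation involves at most two consecutive coefficients.
\<close>

definition geg_coeff :: "nat \<Rightarrow> nat \<Rightarrow> nat \<Rightarrow> 'a::field_char_0" where
  "geg_coeff a j r = pochhammer (of_nat j - of_nat a) r * pochhammer (of_nat a + of_nat j + 2) r /
     (pochhammer (of_nat j + 3 / 2) r * fact r)"

definition geg_u :: "nat \<Rightarrow> nat \<Rightarrow> 'a::field_char_0 poly" where
  "geg_u a j = (\<Sum>r\<le>a. monom (geg_coeff a j r) r)"

definition geg :: "nat \<Rightarrow> nat \<Rightarrow> 'a::field_char_0 poly" where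
  "geg a j = pcompose (geg_u a j) [:1 / 2, - 1 / 2:]"

abbreviation xpoly :: "'a::field_char_0 poly" where "xpoly \<equiv> [:0, 1:]"
abbreviation one_minus_sq :: "'a::field_char_0 poly" where "one_minus_sq \<equiv> [:1, 0, - 1:]"

lemma half_odd_nonzero: "pochhammer (of_nat j + 3 / 2 :: 'a::field_char_0) r \<noteq> 0"
proof
  assume "pochhammer (of_nat j + 3 / 2 :: 'a) r = 0"
  then obtain k where "of_nat j + 3 / 2 = - (of_nat k :: 'a)"
    by (auto simp: pochhammer_eq_0_iff)
  moreover have "(of_nat (2 * j + 3 + 2 * k) :: 'a) = 2 * (of_nat j + 3 / 2) + 2 * of_nat k"
    by (simp add: algebra_simps)
  ultimately have "(of_nat (2 * j + 3 + 2 * k) :: 'a) = 0" by simp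
  then show False unfolding of_nat_eq_0_iff by simp
qed

lemma geg_coeff_eq_0: "j \<le> a \<Longrightarrow> a - j < r \<Longrightarrow> geg_coeff a j r = 0"
  using pochhammer_of_nat_eq_0_lemma[of "a - j" r, where ?'a = 'a]
  by (simp add: geg_coeff_def of_nat_diff)

lemma coeff_geg_u: "j \<le> a \<Longrightarrow> coeff (geg_u a j) r = geg_coeff a j r"
  by (cases "r \<le> a") (auto simp: geg_u_def coeff_sum geg_coeff_eq_0 intro!: geg_coeff_eq_0[symmetric])

lemma geg_u_same: "geg_u j j = 1"
  by (rule poly_eqI) (auto simp: coeff_geg_u geg_coeff_def pochhammer_0_left)

lemma geg_same [simp]: "geg j j = 1"
  by (simp add: geg_def geg_u_same pcompose_1)

text \<open>
The last summand is the coefficient for \<open>a - 1\<close> written out, because truncated subtraction would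
give a wrong value when \<open>a = 0\<close>.
\<close>

lemma geg_coeff_recurrence:
  "(2 * of_nat a + 2) * (geg_coeff a j (Suc s) - 2 * geg_coeff a j s) =
   (of_nat a + of_nat j + 2) * geg_coeff (Suc a) j (Suc s) +
   (of_nat a - of_nat j) * (pochhammer (of_nat j + 1 - of_nat a) (Suc s) *
      pochhammer (of_nat a + of_nat j + 1) (Suc s) /
      (pochhammer (of_nat j + 3 / 2) (Suc s) * fact (Suc s))) "
    (is "?l = (?d :: 'a::field_char_0)")
proof -
  define A J S :: 'a where "A = of_nat a" and "J = of_nat j" and "S = of_nat s"
  define X Y Z where "X = pochhammer (J - A) s" and "Y = pochhammer (A + J + 2) s"
    and "Z = pochhammer (J + 3 / 2) s"
  have Z: "Z \<noteq> 0" "J + 3 / 2 + S \<noteq> 0" "S + 1 \<noteq> 0"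
    using half_odd_nonzero[of j s, where ?'a = 'a] half_odd_nonzero[of j "Suc s", where ?'a = 'a]
      of_nat_neq_0[of s, where ?'a = 'a]
    by (auto simp: Z_def J_def S_def pochhammer_Suc add_ac)
  have e0: "geg_coeff a j s = X * Y / (Z * fact s)"
    by (simp add: geg_coeff_def X_def Y_def Z_def A_def J_def)
  have e1: "geg_coeff a j (Suc s) = X * (J - A + S) * (Y * (A + J + 2 + S)) / (Z * (J + 3 / 2 + S) * ((S + 1) * fact s))"
    by (simp add: geg_coeff_def X_def Y_def Z_def A_def J_def S_def pochhammer_Suc algebra_simps)
  have p: "pochhammer (J - (A + 1)) (Suc s) = (J - A - 1) * X"
    "(A - J) * pochhammer (J + 1 - A) (Suc s) = - (X * (J - A + S) * (J - A + S + 1))"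
    "(A + J + 2) * pochhammer (A + 1 + J + 2) (Suc s) = Y * (A + J + 2 + S) * (A + J + 2 + S + 1)"
    "pochhammer (A + J + 1) (Suc s) = (A + J + 1) * Y"
    "pochhammer (J + 3 / 2) (Suc s) = Z * (J + 3 / 2 + S)"
  proof -
    show "pochhammer (J - (A + 1)) (Suc s) = (J - A - 1) * X"
      by (simp add: pochhammer_rec X_def algebra_simps)
    have "pochhammer (J - A) (Suc (Suc s)) = (J - A) * pochhammer (J + 1 - A) (Suc s)"
      by (simp add: pochhammer_rec[of _ "Suc s"] algebra_simps)
    then show "(A - J) * pochhammer (J + 1 - A) (Suc s) = - (X * (J - A + S) * (J - A + S + 1))"
      by (simp add: pochhammer_Suc X_def S_def algebra_simps)
    have "pochhammer (A + J + 2) (Suc (Suc s)) = (A + J + 2) * pochhammer (A + 1 + J + 2) (Suc s)"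
      by (simp add: pochhammer_rec[of _ "Suc s"] algebra_simps)
    then show "(A + J + 2) * pochhammer (A + 1 + J + 2) (Suc s) = Y * (A + J + 2 + S) * (A + J + 2 + S + 1)"
      by (simp add: pochhammer_Suc Y_def S_def algebra_simps)
    show "pochhammer (A + J + 1) (Suc s) = (A + J + 1) * Y"
      by (simp add: pochhammer_rec Y_def algebra_simps)
    show "pochhammer (J + 3 / 2) (Suc s) = Z * (J + 3 / 2 + S)"
      by (simp add: Z_def S_def pochhammer_Suc)
  qed
  have F: "fact (Suc s) = (S + 1) * fact s" by (simp add: S_def algebra_simps)
  have e2: "(A + J + 2) * geg_coeff (Suc a) j (Suc s) =
     (J - A - 1) * X * (Y * (A + J + 2 + S) * (A + J + 2 + S + 1)) / (Z * (J + 3 / 2 + S) * ((S + 1) * fact s))"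
  proof -
    have "geg_coeff (Suc a) j (Suc s) = pochhammer (J - (A + 1)) (Suc s) * pochhammer (A + 1 + J + 2) (Suc s) /
        (pochhammer (J + 3 / 2) (Suc s) * fact (Suc s))"
      by (simp add: geg_coeff_def A_def J_def add_ac del: fact_Suc)
    then show ?thesis
      unfolding F p(1,5) p(3)[symmetric] by (simp add: mult_ac)
  qed
  have e3: "(A - J) * (pochhammer (J + 1 - A) (Suc s) * pochhammer (A + J + 1) (Suc s) /
      (pochhammer (J + 3 / 2) (Suc s) * fact (Suc s))) =
      - (X * (J - A + S) * (J - A + S + 1)) * ((A + J + 1) * Y) / (Z * (J + 3 / 2 + S) * ((S + 1) * fact s))"
    unfolding F p(4,5) p(2)[symmetric] by simp
  have "?d = (J - A - 1) * X * (Y * (A + J + 2 + S) * (A + J + 2 + S + 1)) / (Z * (J + 3 / 2 + S) * ((S + 1) * fact s))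
      - (X * (J - A + S) * (J - A + S + 1)) * ((A + J + 1) * Y) / (Z * (J + 3 / 2 + S) * ((S + 1) * fact s))"
    using e2 e3 by (simp add: A_def J_def)
  moreover have "?l = (2 * A + 2) * (X * (J - A + S) * (Y * (A + J + 2 + S)) / (Z * (J + 3 / 2 + S) * ((S + 1) * fact s)) - 2 * (X * Y / (Z * fact s)))"
    unfolding e0 e1 A_def[symmetric] ..
  moreover have "X * Y / (Z * fact s) = X * Y * (J + 3 / 2 + S) * (S + 1) / (Z * (J + 3 / 2 + S) * ((S + 1) * fact s))"
    using Z by (simp add: divide_simps)
  moreover have "(2 * A + 2) * (X * (J - A + S) * (Y * (A + J + 2 + S)) - 2 * (X * Y * (J + 3 / 2 + S) * (S + 1))) =
     (J - A - 1) * X * (Y * (A + J + 2 + S) * (A + J + 2 + S + 1)) - (X * (J - A + S) * (J - A + S + 1)) * ((A + J + 1) * Y)"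
  proof -
    have "2 * (X * Y * (J + 3 / 2 + S) * (S + 1)) = X * Y * (2 * J + 3 + 2 * S) * (S + 1)"
      by (simp add: algebra_simps)
    then show ?thesis by (simp add: algebra_simps del: mult_cancel_left mult_cancel_right)
  qed
  ultimately show ?thesis
    by (simp only: times_divide_eq_right diff_divide_distrib[symmetric])
qed

lemma geg_u_recurrence:
  assumes "j \<le> a"
  shows "smult (2 * of_nat a + 2) ([:1, - 2:] * geg_u a j) =
    smult (of_nat a + of_nat j + 2) (geg_u (Suc a) j) +
    smult (of_nat a - of_nat j) (geg_u (a - 1) j :: 'a::field_char_0 poly)"
proof (rule poly_eqI)
  fix r
  have l: "coeff (smult (of_nat a - of_nat j) (geg_u (a - 1) j)) r =
    (of_nat a - of_nat j) * (pochhammer (of_nat j + 1 - of_nat a) r *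
      pochhammer (of_nat a + of_nat j + 1) r /
      (pochhammer (of_nat j + 3 / 2) r * fact r) :: 'a)"
  proof (cases "j = a")
    case False
    then have "coeff (geg_u (a - 1) j) r = (geg_coeff (a - 1) j r :: 'a)"
      using assms by (intro coeff_geg_u) auto
    then show ?thesis using False assms by (cases a) (simp_all add: geg_coeff_def algebra_simps)
  qed auto
  show "coeff (smult (2 * of_nat a + 2) ([:1, - 2:] * geg_u a j)) r =
    coeff (smult (of_nat a + of_nat j + 2) (geg_u (Suc a) j) +
    smult (of_nat a - of_nat j) (geg_u (a - 1) j :: 'a poly)) r"
  proof (cases r)
    case 0
    show ?thesis unfolding coeff_add l using assms 0
      by (simp add: coeff_geg_u geg_coeff_def)
  next
    case (Suc s)
    have "coeff (smult (2 * of_nat a + 2) ([:1, - 2:] * geg_u a j)) (Suc s) =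
      (2 * of_nat a + 2) * (geg_coeff a j (Suc s) - 2 * geg_coeff a j s :: 'a)"
      using assms by (simp add: coeff_geg_u)
    then show ?thesis unfolding coeff_add l unfolding Suc geg_coeff_recurrence
      using assms by (simp add: coeff_geg_u)
  qed
qed

lemma geg_coeff_shift:
  "(of_nat j + 3 / 2) * (of_nat r + 1) * geg_coeff a j (Suc r) =
     (of_nat j - of_nat a) * (of_nat a + of_nat j + 2) * (geg_coeff a (Suc j) r :: 'a::field_char_0)"
proof -
  define X Y Z where "X = pochhammer (of_nat (Suc j) - of_nat a :: 'a) r"
    and "Y = pochhammer (of_nat a + of_nat (Suc j) + 2 :: 'a) r"
    and "Z = pochhammer (of_nat (Suc j) + 3 / 2 :: 'a) r"
  have n: "Z \<noteq> 0" "of_nat j + 3 / 2 \<noteq> (0::'a)" "of_nat r + 1 \<noteq> (0::'a)"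
    using half_odd_nonzero[of "Suc j" r, where ?'a = 'a] half_odd_nonzero[of j 1, where ?'a = 'a]
      of_nat_neq_0[of r, where ?'a = 'a]
    by (auto simp: Z_def add_ac)
  have p: "pochhammer (of_nat j - of_nat a) (Suc r) = (of_nat j - of_nat a) * X"
    "pochhammer (of_nat a + of_nat j + 2) (Suc r) = (of_nat a + of_nat j + 2) * Y"
    "pochhammer (of_nat j + 3 / 2) (Suc r) = (of_nat j + 3 / 2) * Z"
    by (simp_all add: pochhammer_rec X_def Y_def Z_def algebra_simps)
  have F: "fact (Suc r) = (of_nat r + 1) * (fact r :: 'a)" by (simp add: algebra_simps)
  have "geg_coeff a (Suc j) r = X * Y / (Z * fact r)"
    by (simp add: geg_coeff_def X_def Y_def Z_def)
  moreover have "geg_coeff a j (Suc r) = (of_nat j - of_nat a) * X * ((of_nat a + of_nat j + 2) * Y) /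
      ((of_nat j + 3 / 2) * Z * ((of_nat r + 1) * fact r))"
    unfolding geg_coeff_def p F ..
  ultimately show ?thesis using n by (simp only: times_divide_eq_right times_divide_eq_left mult.assoc)
    (simp add: divide_simps)
qed

lemma pderiv_geg_u:
  assumes "j \<le> a"
  shows "pderiv (geg_u a j) =
    smult (2 * (of_nat j - of_nat a) * (of_nat a + of_nat j + 2) / (2 * of_nat j + 3)) (geg_u a (Suc j) :: 'a::field_char_0 poly)"
proof (cases "j = a")
  case True
  then show ?thesis by (simp add: geg_u_same)
next
  case False
  then have j: "Suc j \<le> a" using assms by simp
  have n: "2 * of_nat j + 3 \<noteq> (0::'a)"
    using half_odd_nonzero[of j 1, where ?'a = 'a] by (auto simp: field_simps)
  show ?thesis
  proof (rule poly_eqI)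
    fix r
    have "(2 * of_nat j + 3) * ((of_nat r + 1) * geg_coeff a j (Suc r)) =
       2 * (of_nat j - of_nat a) * (of_nat a + of_nat j + 2) * (geg_coeff a (Suc j) r :: 'a)"
      using geg_coeff_shift[of j r a, where ?'a = 'a] by (simp add: field_simps)
    then show "coeff (pderiv (geg_u a j)) r = coeff (smult (2 * (of_nat j - of_nat a) * (of_nat a + of_nat j + 2) / (2 * of_nat j + 3)) (geg_u a (Suc j) :: 'a poly)) r"
      using n assms j by (simp add: coeff_pderiv coeff_geg_u field_simps del: of_nat_Suc) (simp add: field_simps)
  qed
qed

lemma geg_u_lowering:
  assumes "Suc j \<le> a"
  shows "[:0, 2, - 2:] * pderiv (geg_u a (Suc j)) + smult (2 * of_nat j + 3) ([:1, - 2:] * geg_u a (Suc j)) =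
    smult (2 * of_nat j + 3) (geg_u a j :: 'a::field_char_0 poly)"
proof (rule poly_eqI)
  fix r
  define J A :: 'a where "J = of_nat j" and "A = of_nat a"
  let ?e = "\<lambda>r. geg_coeff a (Suc j) r :: 'a"
  have up: "geg_coeff a (Suc j) (Suc s) * ((2 * J + 5 + 2 * of_nat s) * (of_nat s + 1)) =
     2 * (J + 1 - A + of_nat s) * (A + J + 3 + of_nat s) * ?e s" for s
  proof -
    have z: "of_nat j + 5 / 2 + of_nat s \<noteq> (0::'a)" "of_nat s + 1 \<noteq> (0::'a)" "pochhammer (of_nat j + 5 / 2 :: 'a) s \<noteq> 0"
      using half_odd_nonzero[of "Suc j" "Suc s", where ?'a = 'a] of_nat_neq_0[of s, where ?'a = 'a]
      by (auto simp: pochhammer_Suc add_ac)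
    have "2 * J + 5 + 2 * of_nat s = 2 * (of_nat j + 5 / 2 + of_nat s)" by (simp add: J_def algebra_simps)
    moreover have "geg_coeff a (Suc j) (Suc s) = ?e s * ((J + 1 - A + of_nat s) * (A + J + 3 + of_nat s)) / ((of_nat j + 5 / 2 + of_nat s) * (of_nat s + 1))"
    proof -
      define X Y Z where "X = pochhammer (of_nat (Suc j) - of_nat a :: 'a) s"
        and "Y = pochhammer (of_nat a + of_nat (Suc j) + 2 :: 'a) s"
        and "Z = pochhammer (of_nat (Suc j) + 3 / 2 :: 'a) s"
      have F: "fact (Suc s) = (of_nat s + 1) * (fact s :: 'a)" by (simp add: algebra_simps)
      have "of_nat (Suc j) - of_nat a + of_nat s = J + 1 - A + of_nat s"
        "of_nat a + of_nat (Suc j) + 2 + of_nat s = A + J + 3 + of_nat s"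
        "of_nat (Suc j) + 3 / 2 + of_nat s = (of_nat j + 5 / 2 + of_nat s :: 'a)"
        by (simp_all add: J_def A_def)
      note eqs = this
      show ?thesis
        unfolding geg_coeff_def pochhammer_Suc eqs X_def[symmetric] Y_def[symmetric] Z_def[symmetric] F
        by (simp only: mult_ac times_divide_eq_right times_divide_eq_left divide_divide_eq_left)
    qed
    ultimately show ?thesis using z by (simp add: divide_simps) (simp add: J_def algebra_simps)
  qed
  have dn: "(2 * J + 3) * ((of_nat s + 1) * geg_coeff a j (Suc s)) =
       2 * (J - A) * (A + J + 2) * ?e s" for s
    using geg_coeff_shift[of j s a, where ?'a = 'a] by (simp add: field_simps J_def A_def)
  show "coeff ([:0, 2, - 2:] * pderiv (geg_u a (Suc j)) + smult (2 * of_nat j + 3) ([:1, - 2:] * geg_u a (Suc j))) r =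
    coeff (smult (2 * of_nat j + 3) (geg_u a j :: 'a poly)) r"
  proof (cases r)
    case 0
    then show ?thesis using assms by (simp add: coeff_geg_u geg_coeff_def)
  next
    case (Suc s)
    have c: "coeff ([:0, 2, - 2:] * pderiv (geg_u a (Suc j))) (Suc s) = 2 * (of_nat s + 1) * ?e (Suc s) - 2 * of_nat s * ?e s"
      using assms by (cases s) (simp_all add: coeff_pderiv coeff_geg_u algebra_simps)
    have s1: "of_nat s + 1 \<noteq> (0::'a)" using of_nat_neq_0[of s, where ?'a = 'a] by (simp add: algebra_simps)
    have "(of_nat s + 1) * ((2 * (of_nat s + 1) + (2 * J + 3)) * ?e (Suc s) - 2 * of_nat s * ?e s - 2 * (2 * J + 3) * ?e s)
       = ?e (Suc s) * ((2 * J + 5 + 2 * of_nat s) * (of_nat s + 1)) - 2 * of_nat s * (of_nat s + 1) * ?e s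
         - 2 * (2 * J + 3) * (of_nat s + 1) * ?e s"
      by (simp add: algebra_simps)
    also have "\<dots> = 2 * (J - A) * (A + J + 2) * ?e s"
      unfolding up by (simp add: algebra_simps)
    also have "\<dots> = (of_nat s + 1) * ((2 * J + 3) * geg_coeff a j (Suc s))"
      unfolding dn[symmetric] by (simp add: mult_ac)
    finally have "(of_nat s + 1) * ((2 * (of_nat s + 1) + (2 * J + 3)) * ?e (Suc s) - 2 * of_nat s * ?e s - 2 * (2 * J + 3) * ?e s)
       = (of_nat s + 1) * ((2 * J + 3) * geg_coeff a j (Suc s))" .
    then have "(2 * (of_nat s + 1) + (2 * J + 3)) * ?e (Suc s) - 2 * of_nat s * ?e s - 2 * (2 * J + 3) * ?e s
       = (2 * J + 3) * geg_coeff a j (Suc s)" using s1 by simp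
    then show ?thesis unfolding Suc coeff_add c using assms
      by (simp add: coeff_geg_u J_def algebra_simps)
  qed
qed

lemma pcompose_one_minus_two_u: "pcompose [:1, - 2:] [:1 / 2, - 1 / 2:] = (xpoly :: 'a::field_char_0 poly)"
  by (simp add: pcompose_pCons)

lemma geg_recurrence:
  assumes "j \<le> a"
  shows "smult (2 * of_nat a + 2) (xpoly * geg a j) =
    smult (of_nat a + of_nat j + 2) (geg (Suc a) j) +
    smult (of_nat a - of_nat j) (geg (a - 1) j :: 'a::field_char_0 poly)"
  using arg_cong[OF geg_u_recurrence[OF assms, where ?'a = 'a], of "\<lambda>p. pcompose p [:1 / 2, - 1 / 2:]"]
  unfolding geg_def pcompose_add pcompose_smult pcompose_mult pcompose_one_minus_two_u .

lemma pderiv_geg: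
  assumes "j \<le> a"
  shows "pderiv (geg a j) =
    smult ((of_nat a - of_nat j) * (of_nat a + of_nat j + 2) / (2 * of_nat j + 3)) (geg a (Suc j) :: 'a::field_char_0 poly)"
proof -
  define C :: 'a where "C = 2 * (of_nat j - of_nat a) * (of_nat a + of_nat j + 2) / (2 * of_nat j + 3)"
  have C: "C * (- 1 / 2) = (of_nat a - of_nat j) * (of_nat a + of_nat j + 2) / (2 * of_nat j + 3)"
  proof -
    have "2 * X * Y / Z * (- 1 / 2) = - X * Y / Z" for X Y Z :: 'a by simp
    then show ?thesis unfolding C_def by (simp only: minus_diff_eq)
  qed
  have d: "pderiv [:1 / 2, - 1 / 2:] = ([:- 1 / 2:] :: 'a poly)" by (simp add: pderiv_pCons)
  have "pderiv (geg a j) = smult C (geg a (Suc j)) * [:- 1 / 2:]"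
    unfolding geg_def pderiv_pcompose pderiv_geg_u[OF assms] pcompose_smult C_def d ..
  also have "\<dots> = smult (C * (- 1 / 2)) (geg a (Suc j))"
    by (simp only: mult_pCons_right mult_zero_right mult_zero_left pCons_0_0 add_0_right smult_smult mult.commute)
  finally show ?thesis unfolding C .
qed

text \<open>
This is \<open>d/dx ((1 - x\<^sup>2)\<^sup>j\<^sup>+\<^sup>3\<^sup>/\<^sup>2 geg a (j+1)) = - (2j + 3) (1 - x\<^sup>2)\<^sup>j\<^sup>+\<^sup>1\<^sup>/\<^sup>2 geg a j\<close>, freed of the
square root. It is the adjoint of \<open>pderiv_geg\<close>, and the two ladder relations
give both scalar orthogonality and the constancy of the last diagonal entry of the weight.
\<close>

lemma geg_lowering:
  assumes "Suc j \<le> a"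
  shows "one_minus_sq * pderiv (geg a (Suc j)) - smult (2 * of_nat j + 3) (xpoly * geg a (Suc j)) =
    smult (- (2 * of_nat j + 3)) (geg a j :: 'a::field_char_0 poly)"
proof -
  have d: "pderiv [:1 / 2, - 1 / 2:] = ([:- 1 / 2:] :: 'a poly)" by (simp add: pderiv_pCons)
  have c: "pcompose [:0, 2, - 2:] [:1 / 2, - 1 / 2:] = smult (1 / 2) (one_minus_sq :: 'a poly)"
    by (simp add: pcompose_pCons)
  have "one_minus_sq * pderiv (geg a (Suc j)) = - pcompose ([:0, 2, - 2:] * pderiv (geg_u a (Suc j)) :: 'a poly) [:1 / 2, - 1 / 2:]"
    unfolding geg_def pderiv_pcompose pcompose_mult d c
    by (simp only: mult_pCons_right mult_zero_right pCons_0_0 add_0_right smult_0_right mult_smult_right mult_smult_left)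
       simp
  moreover have "pcompose ([:0, 2, - 2:] * pderiv (geg_u a (Suc j))) [:1 / 2, - 1 / 2:] + smult (2 * of_nat j + 3) (xpoly * geg a (Suc j)) =
     (smult (2 * of_nat j + 3) (geg a j) :: 'a poly)"
    using arg_cong[OF geg_u_lowering[OF assms, where ?'a = 'a], of "\<lambda>p. pcompose p [:1 / 2, - 1 / 2:]"]
    unfolding geg_def pcompose_add pcompose_smult pcompose_mult[of "[:1, - 2:]"] pcompose_one_minus_two_u .
  moreover have "X - Z = - W" if "X = - Y" "Y + Z = W" for X Y Z W :: "'a poly"
    using that by (simp add: algebra_simps)
  ultimately show ?thesis unfolding smult_minus_left by blast
qed

lemma poly_geg_1:
  assumes "j \<le> a"
  shows "poly (geg a j) 1 = 1"
  using assms by (simp add: geg_def poly_pcompose poly_0_coeff_0 coeff_geg_u geg_coeff_def)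

lemma poly_geg:
  assumes "j \<le> a"
  shows "poly (geg a j) (1 - 2 * u) =
    hypergeo_sum (a - j) [of_nat j - of_nat a, of_nat a + of_nat j + 2] [of_nat j + 3 / 2] (u :: 'a::field_char_0)"
proof -
  have "poly (geg a j) (1 - 2 * u) = (\<Sum>r\<le>a. geg_coeff a j r * u ^ r)"
    by (simp add: geg_def poly_pcompose geg_u_def poly_sum poly_monom field_simps)
  also have "\<dots> = (\<Sum>r\<le>a - j. geg_coeff a j r * u ^ r)"
    using assms by (intro sum.mono_neutral_right) (auto simp: geg_coeff_eq_0)
  finally show ?thesis by (simp add: hypergeo_sum_def geg_coeff_def)
qed

lemma gegenbauer_eq_geg:
  assumes "k \<le> m"
  shows "fact m * fact (2 * k + 1) / (fact (m + k + 1) * fact k) * gegenbauer (of_nat k + 1) (m - k) x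
     = of_nat (m choose k) * poly (geg m k) (x :: 'a::field_char_0)"
proof -
  have x: "1 - 2 * ((1 - x) / 2) = x" by (simp add: field_simps)
  have e: "of_nat k - of_nat m = - (of_nat (m - k) :: 'a)"
    "of_nat m + of_nat k + 2 = of_nat (m - k) + 2 * (of_nat k + 1 :: 'a)"
    "of_nat k + 3 / 2 = of_nat k + 1 + 1 / (2 :: 'a)"
    using assms by (simp_all add: of_nat_diff)
  have g: "hypergeo_sum (m - k) [- of_nat (m - k), of_nat (m - k) + 2 * (of_nat k + 1)]
      [of_nat k + 1 + 1 / 2] ((1 - x) / 2) = poly (geg m k) x"
    using poly_geg[OF assms, of "(1 - x) / 2"] unfolding x e by (rule sym)
  have "pochhammer (2 * (of_nat k + 1)) (m - k) * fact (2 * k + 1) = (fact (m + k + 1) :: 'a)"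
  proof -
    have "m + k + 1 = (2 * k + 1) + (m - k)" using assms by simp
    then have "(fact (m + k + 1) :: 'a) = pochhammer 1 ((2 * k + 1) + (m - k))"
      by (simp only: pochhammer_fact)
    also have "\<dots> = fact (2 * k + 1) * pochhammer (1 + of_nat (2 * k + 1)) (m - k)"
      by (simp only: pochhammer_product' pochhammer_fact)
    also have "1 + of_nat (2 * k + 1) = (2 * (of_nat k + 1) :: 'a)" by simp
    finally show ?thesis by (simp only: mult.commute)
  qed
  then have p: "pochhammer (2 * (of_nat k + 1)) (m - k) = (fact (m + k + 1) / fact (2 * k + 1) :: 'a)"
    by (simp add: eq_divide_eq del: fact_Suc)
  have b: "of_nat (m choose k) = (fact m / (fact k * fact (m - k)) :: 'a)"
    using assms by (simp add: binomial_fact)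
  have c: "M * F2 / (F * K) * (F / F2 / D * G) = M / (K * D) * G" if "F \<noteq> 0" "F2 \<noteq> 0" for M F2 F K D G :: 'a
    using that by simp
  show ?thesis unfolding gegenbauer_def g p b by (rule c[OF fact_nonzero fact_nonzero])
qed

lemma cheb_U_eq_geg: "cheb_U r xpoly = smult (of_nat r + 1) (geg r 0 :: 'a::field_char_0 poly)"
proof (induction r "xpoly :: 'a poly" rule: cheb_U.induct)
  case 1
  then show ?case by simp
next
  case 2
  show ?case using geg_recurrence[of 0 0, where ?'a = 'a] by (simp add: numeral_poly)
next
  case (3 r)
  have r: "of_nat r + 2 \<noteq> (0::'a)" using of_nat_neq_0[of "Suc r", where ?'a = 'a] by (simp add: algebra_simps)
  have "smult (of_nat r + 2) (cheb_U (Suc (Suc r)) xpoly) = smult (of_nat r + 2)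
     (smult (of_nat (Suc (Suc r)) + 1) (geg (Suc (Suc r)) 0 :: 'a poly))"
    using geg_recurrence[of 0 "Suc r", where ?'a = 'a] 3
    by (simp add: algebra_simps numeral_poly smult_add_left smult_add_right)
  then show ?case using r by (metis smult_eq_iff)
qed

section \<open>The LDU decomposition of the weight\<close>

definition Lpoly :: "nat \<Rightarrow> nat \<Rightarrow> 'a::field_char_0 poly" where
  "Lpoly m j = smult (of_nat (m choose j)) (geg m j)"

text \<open>
The constants of the diagonal factor: \<open>T\<^sub>j\<^sub>j = Tcoeff N j \<cdot> (1 - x\<^sup>2)\<^sup>j\<close>.
\<close>

definition Tcoeff :: "nat \<Rightarrow> nat \<Rightarrow> 'a::field_char_0" where
  "Tcoeff N j = fact (N + 1 + j) * fact (N - j) * 4 ^ j * fact j ^ 4 /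
     (fact N ^ 2 * fact (2 * j) * fact (2 * j + 1))"

text \<open>
The polynomial matrix \<open>L T L\<^sup>t\<close>. It is shown below to be the weight without its square root.
\<close>

definition wpoly :: "nat \<Rightarrow> nat \<Rightarrow> nat \<Rightarrow> 'a::field_char_0 poly" where
  "wpoly N m n = (\<Sum>j\<le>N. smult (Tcoeff N j) (one_minus_sq ^ j * Lpoly m j * Lpoly n j))"

lemma wpoly_commute: "wpoly N m n = wpoly N n m"
  by (simp add: wpoly_def mult_ac)

lemma Lpoly_eq_0: "m < j \<Longrightarrow> Lpoly m j = 0"
  by (simp add: Lpoly_def)

lemma Lpoly_same [simp]: "Lpoly m m = 1"
  by (simp add: Lpoly_def)

text \<open>
The recurrence of the Gegenbauer polynomials turns, after multiplication by the binomial
coefficients, into one whose only dependence on the column is through the eigenvalue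
\<open>j (j + 1)\<close>. The same eigenvalue occurs in \<open>Tcoeff_recurrence\<close>, so it can be eliminated.
\<close>

lemma Lpoly_recurrence:
  "smult (2 * (of_nat m + 1) ^ 2) (xpoly * Lpoly m j) =
   smult ((of_nat m + 1) * (of_nat m + 2) - of_nat j * (of_nat j + 1)) (Lpoly (Suc m) j) +
   smult (of_nat m * (of_nat m + 1)) (Lpoly (m - 1) j :: 'a::field_char_0 poly)"
proof -
  consider "j \<le> m" | "j = Suc m" | "j > Suc m" by linarith
  then show ?thesis
  proof cases
    case 1
    have "Suc m * (m choose j) = (Suc m - j) * (Suc m choose j)"
      by (metis binomial_absorb_comp diff_Suc_1)
    then have "(of_nat (Suc m * (m choose j)) :: 'a) = of_nat ((Suc m - j) * (Suc m choose j))"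
      by (rule arg_cong)
    then have b1: "(of_nat m + 1) * of_nat (m choose j) = (of_nat m + 1 - of_nat j) * (of_nat (Suc m choose j) :: 'a)"
      unfolding of_nat_mult using 1 by (simp add: of_nat_diff add.commute del: binomial_Suc_Suc)
    have "(m - j) * (m choose j) = m * (m - 1 choose j)"
      by (rule binomial_absorb_comp)
    then have "(of_nat ((m - j) * (m choose j)) :: 'a) = of_nat (m * (m - 1 choose j))"
      by (rule arg_cong)
    then have b2: "(of_nat m - of_nat j) * of_nat (m choose j) = of_nat m * (of_nat (m - 1 choose j) :: 'a)"
      unfolding of_nat_mult using 1 by (simp add: of_nat_diff)
    have "smult (2 * (of_nat m + 1) ^ 2) (xpoly * Lpoly m j) =
      smult ((of_nat m + 1) * of_nat (m choose j)) (smult (2 * of_nat m + 2) (xpoly * geg m j :: 'a poly))"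
      by (simp add: Lpoly_def power2_eq_square algebra_simps)
    also have "\<dots> = smult ((of_nat m + 1) * of_nat (m choose j) * (of_nat m + of_nat j + 2)) (geg (Suc m) j)
       + smult ((of_nat m + 1) * ((of_nat m - of_nat j) * of_nat (m choose j))) (geg (m - 1) j)"
      unfolding geg_recurrence[OF 1] smult_add_right smult_smult by (simp add: mult_ac)
    also have "\<dots> = smult (((of_nat m + 1) * (of_nat m + 2) - of_nat j * (of_nat j + 1)) * of_nat (Suc m choose j)) (geg (Suc m) j)
       + smult (of_nat m * (of_nat m + 1) * of_nat (m - 1 choose j)) (geg (m - 1) j)"
      unfolding b1 b2 by (simp add: algebra_simps del: binomial_Suc_Suc)
    finally show ?thesis by (simp add: Lpoly_def del: binomial_Suc_Suc)
  next
    case 2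
    then show ?thesis by (simp add: Lpoly_eq_0 algebra_simps)
  next
    case 3
    then show ?thesis by (simp add: Lpoly_eq_0)
  qed
qed

text \<open>
The factor on the right is \<open>(M + 1 - j) (M + 2 + j)\<close>, a linear function of \<open>j (j + 1)\<close>.
\<close>

lemma Tcoeff_recurrence:
  assumes "j \<le> M"
  shows "(of_nat M + 1) ^ 2 * Tcoeff (Suc M) j =
    ((of_nat M + 1) * (of_nat M + 2) - of_nat j * (of_nat j + 1)) * (Tcoeff M j :: 'a::field_char_0)"
proof -
  have "fact (Suc M + 1 + j) = (of_nat M + 2 + of_nat j) * (fact (M + 1 + j) :: 'a)"
    by (simp add: algebra_simps)
  moreover have "fact (Suc M - j) = (of_nat M + 1 - of_nat j) * (fact (M - j) :: 'a)"
    using assms by (simp add: Suc_diff_le of_nat_diff algebra_simps)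
  moreover have "fact (Suc M) = (of_nat M + 1) * (fact M :: 'a)" by (simp add: algebra_simps)
  moreover have "of_nat M + 1 \<noteq> (0::'a)" using of_nat_neq_0[of M, where ?'a = 'a] by (simp add: add_ac)
  moreover have "((of_nat M + 1) * (of_nat M + 2) - of_nat j * (of_nat j + 1)) =
     (of_nat M + 2 + of_nat j) * (of_nat M + 1 - of_nat j :: 'a)" by (simp add: algebra_simps)
  moreover have "m ^ 2 * (a * A * (b * B) * c * d / ((m * C) ^ 2 * e * f)) =
     a * b * (A * B * c * d / (C ^ 2 * e * f))" if "m \<noteq> 0" for m a A b B c d e f C :: 'a
    using that by (simp add: power_mult_distrib mult_ac)
  ultimately show ?thesis unfolding Tcoeff_def by presburger
qed

text \<open>
Eliminating \<open>j (j + 1)\<close> between \<open>Tcoeff_recurrence\<close> and \<open>Lpoly_recurrence\<close>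
expresses the matrix of size \<open>M + 2\<close> by that of size \<open>M + 1\<close>. The side condition makes the new
summand \<open>j = M + 1\<close> vanish, and it excludes only the last diagonal entry.
\<close>

lemma wpoly_recurrence:
  assumes "Suc m \<le> M \<or> n \<le> M"
  shows "smult ((of_nat M + 1) ^ 2) (wpoly (Suc M) (Suc m) n) =
    smult ((of_nat M + 1) * (of_nat M + 2) - (of_nat m + 1) * (of_nat m + 2)) (wpoly M (Suc m) n)
    - smult (of_nat m * (of_nat m + 1)) (wpoly M (m - 1) n)
    + smult (2 * (of_nat m + 1) ^ 2) (xpoly * (wpoly M m n :: 'a::field_char_0 poly))"
proof -
  let ?L = "\<lambda>m j. Lpoly m j :: 'a poly"
  define lam :: "nat \<Rightarrow> 'a" where "lam j = of_nat j * (of_nat j + 1)" for j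
  define c :: 'a where "c = (of_nat M + 1) * (of_nat M + 2)"
  define d :: 'a where "d = (of_nat m + 1) * (of_nat m + 2)"
  define e :: 'a where "e = of_nat m * (of_nat m + 1)"
  define f :: 'a where "f = 2 * (of_nat m + 1) ^ 2"
  have "smult ((of_nat M + 1) ^ 2) (wpoly (Suc M) (Suc m) n) =
     smult ((of_nat M + 1) ^ 2) (\<Sum>j\<le>M. smult (Tcoeff (Suc M) j) (one_minus_sq ^ j * ?L (Suc m) j * ?L n j))"
  proof -
    have "?L (Suc m) (Suc M) * ?L n (Suc M) = 0"
      using assms by (auto simp: Lpoly_eq_0)
    then have "one_minus_sq ^ Suc M * ?L (Suc m) (Suc M) * ?L n (Suc M) = 0"
      by (simp only: mult.assoc mult_zero_right)
    then show ?thesis by (simp only: wpoly_def sum.atMost_Suc smult_0_right add_0_right)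
  qed
  also have "\<dots> = (\<Sum>j\<le>M. smult ((c - lam j) * Tcoeff M j) (one_minus_sq ^ j * ?L (Suc m) j * ?L n j))"
    unfolding smult_sum2 smult_smult c_def lam_def by (intro sum.cong refl) (simp add: Tcoeff_recurrence)
  also have "\<dots> = (\<Sum>j\<le>M. smult (c - d) (smult (Tcoeff M j) (one_minus_sq ^ j * ?L (Suc m) j * ?L n j))
      - smult e (smult (Tcoeff M j) (one_minus_sq ^ j * ?L (m - 1) j * ?L n j))
      + smult f (xpoly * smult (Tcoeff M j) (one_minus_sq ^ j * ?L m j * ?L n j)))"
  proof (intro sum.cong refl)
    have rearrange: "A = B - E + F" if "X = Y" "Y = F - E" "X = A - B" for X Y A B E F :: "'a poly"
      using that by (simp add: algebra_simps)
    fix j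
    have "smult f (xpoly * ?L m j) = smult (d - lam j) (?L (Suc m) j) + smult e (?L (m - 1) j)"
      unfolding f_def d_def lam_def e_def by (rule Lpoly_recurrence)
    then have "smult (d - lam j) (?L (Suc m) j) = smult f (xpoly * ?L m j) - smult e (?L (m - 1) j)"
      by (simp add: algebra_simps)
    then have "smult (Tcoeff M j) (one_minus_sq ^ j * smult (d - lam j) (?L (Suc m) j) * ?L n j) =
       smult (Tcoeff M j) (one_minus_sq ^ j * (smult f (xpoly * ?L m j) - smult e (?L (m - 1) j)) * ?L n j)"
      by (rule arg_cong)
    moreover have "smult (Tcoeff M j) (one_minus_sq ^ j * (smult f (xpoly * ?L m j) - smult e (?L (m - 1) j)) * ?L n j)
       = smult f (xpoly * smult (Tcoeff M j) (one_minus_sq ^ j * ?L m j * ?L n j)) - smult e (smult (Tcoeff M j) (one_minus_sq ^ j * ?L (m - 1) j * ?L n j))"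
      by (simp only: right_diff_distrib left_diff_distrib smult_diff_right mult_smult_left mult_smult_right smult_smult mult_ac)
    moreover have "smult (Tcoeff M j) (one_minus_sq ^ j * smult (d - lam j) (?L (Suc m) j) * ?L n j) =
       smult ((c - lam j) * Tcoeff M j) (one_minus_sq ^ j * ?L (Suc m) j * ?L n j) - smult (c - d) (smult (Tcoeff M j) (one_minus_sq ^ j * ?L (Suc m) j * ?L n j))"
    proof -
      have "(d - lam j) * Tcoeff M j = (c - lam j) * Tcoeff M j - (c - d) * Tcoeff M j" by (simp add: algebra_simps)
      moreover have "smult t (X * smult v Y * Z) = smult (v * t) (X * Y * Z)" for t v and X Y Z :: "'a poly"
        by (simp add: mult_ac)
      ultimately show ?thesis
        by (simp only: smult_diff_left[of "(c - lam j) * Tcoeff M j" "(c - d) * Tcoeff M j"] smult_smult)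
    qed
    ultimately show "smult ((c - lam j) * Tcoeff M j) (one_minus_sq ^ j * ?L (Suc m) j * ?L n j) =
      smult (c - d) (smult (Tcoeff M j) (one_minus_sq ^ j * ?L (Suc m) j * ?L n j))
      - smult e (smult (Tcoeff M j) (one_minus_sq ^ j * ?L (m - 1) j * ?L n j))
      + smult f (xpoly * smult (Tcoeff M j) (one_minus_sq ^ j * ?L m j * ?L n j))"
      by (rule rearrange)
  qed
  also have "\<dots> = smult (c - d) (wpoly M (Suc m) n) - smult e (wpoly M (m - 1) n)
    + smult f (xpoly * (wpoly M m n))"
    by (simp only: sum.distrib sum_subtractf smult_sum2 wpoly_def sum_distrib_left)
  finally show ?thesis unfolding c_def d_def e_def f_def .
qed

lemma wpoly_0_left: "wpoly N 0 n = smult (of_nat N + 1) (geg n 0 :: 'a::field_char_0 poly)"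
proof -
  have "wpoly N 0 n = (\<Sum>j\<in>{0}. smult (Tcoeff N j) (one_minus_sq ^ j * Lpoly 0 j * Lpoly n j) :: 'a poly)"
    unfolding wpoly_def by (intro sum.mono_neutral_right) (auto simp: Lpoly_eq_0)
  also have "\<dots> = smult (of_nat N + 1) (geg n 0)"
    by (simp add: Tcoeff_def Lpoly_def power2_eq_square add.commute)
  finally show ?thesis .
qed

text \<open>
A suitable average of the two ladder relations expresses the derivative of
\<open>(1 - x\<^sup>2)\<^sup>j geg\<^sup>2\<close> by the products of neighbours, \<open>(j, j + 1)\<close> and \<open>(j - 1, j)\<close>.
\<close>

lemma pderiv_one_minus_sq_power_geg_square:
  assumes "j \<le> a"
  defines "k \<equiv> (of_nat a - of_nat j) * (of_nat a + of_nat j + 2) / (2 * of_nat j + 3)"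
  shows "smult (2 * of_nat j + 1) (pderiv (one_minus_sq ^ j * geg a j ^ 2)) =
     smult (2 * (of_nat j + 1) * k) (one_minus_sq ^ j * geg a j * geg a (Suc j)) -
     smult ((2 * of_nat j + 1) * (2 * of_nat j)) (one_minus_sq ^ (j - 1) * geg a (j - 1) * (geg a j :: 'a::field_char_0 poly))"
proof (cases j)
  case 0
  then show ?thesis using pderiv_geg[OF assms(1), where ?'a = 'a]
    by (simp add: k_def pderiv_mult power2_eq_square numeral_poly mult_ac)
next
  case (Suc i)
  have low: "one_minus_sq * pderiv (geg a (Suc i)) - smult (2 * of_nat i + 3) (xpoly * geg a (Suc i)) =
    smult (- (2 * of_nat i + 3)) (geg a i :: 'a poly)"
    using assms Suc by (intro geg_lowering) simp
  have der: "pderiv (geg a (Suc i)) = smult k (geg a (Suc (Suc i)) :: 'a poly)"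
    unfolding k_def Suc using assms Suc by (intro pderiv_geg) simp
  have po: "pderiv (one_minus_sq ^ Suc i) = smult (- 2 * (of_nat i + 1)) (xpoly * one_minus_sq ^ i :: 'a poly)"
  proof -
    have "pderiv one_minus_sq = smult (- 2) (xpoly :: 'a poly)" by (simp add: pderiv_pCons)
    moreover have "smult u p * smult v q = smult (v * u) (q * p)" for u v and p q :: "'a poly"
      by (simp add: mult_ac)
    ultimately show ?thesis by (simp only: pderiv_power_Suc of_nat_Suc add.commute)
  qed
  define g d h p :: "'a poly" where "g = geg a (Suc i)" and "d = pderiv (geg a (Suc i))"
    and "h = geg a i" and "p = one_minus_sq ^ i"
  define s :: 'a where "s = of_nat i"
  have "poly (smult (2 * s + 3) (pderiv (one_minus_sq * p * g ^ 2))) y =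
     poly (smult (2 * (s + 2)) (one_minus_sq * p * g * d) - smult ((2 * s + 3) * (2 * (s + 1))) (p * h * g)) y" for y
  proof -
    have pd: "pderiv (one_minus_sq * p * g ^ 2) = smult (- 2 * (s + 1)) (xpoly * p) * g ^ 2 + one_minus_sq * p * (2 * g * d)"
      using po unfolding p_def g_def d_def s_def power_Suc
      by (simp add: pderiv_mult[of "one_minus_sq * one_minus_sq ^ i"] pderiv_power_Suc power2_eq_square pderiv_mult[of "geg a (Suc i)"] algebra_simps del: mult_pCons_left)
    define Y G D H P where "Y = poly one_minus_sq y" and "G = poly g y" and "D = poly d y" and "H = poly h y" and "P = poly p y"
    have "poly (one_minus_sq * pderiv (geg a (Suc i)) - smult (2 * of_nat i + 3) (xpoly * geg a (Suc i))) y =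
      poly (smult (- (2 * of_nat i + 3)) (geg a i :: 'a poly)) y" unfolding low ..
    then have l: "Y * D - (2 * s + 3) * (y * G) = - (2 * s + 3) * H"
      unfolding Y_def D_def G_def H_def g_def d_def h_def s_def poly_diff poly_mult poly_smult by simp
    have "poly (smult (2 * s + 3) (pderiv (one_minus_sq * p * g ^ 2))) y =
       (2 * s + 3) * (- 2 * (s + 1) * (y * P) * G ^ 2 + Y * P * (2 * G * D))"
      unfolding pd Y_def G_def D_def P_def poly_mult poly_smult poly_add poly_power by (simp add: numeral_poly)
    also have "\<dots> = 2 * (s + 2) * (Y * P * G * D) - (2 * s + 3) * (2 * (s + 1)) * (P * H * G)
      + 2 * (s + 1) * P * G * (Y * D - (2 * s + 3) * (y * G) + (2 * s + 3) * H)"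
      by (simp add: algebra_simps power2_eq_square)
    also have "Y * D - (2 * s + 3) * (y * G) + (2 * s + 3) * H = 0" unfolding l by (simp only: mult_minus_left left_minus)
    finally show ?thesis
      unfolding Y_def G_def D_def H_def P_def poly_mult poly_smult poly_diff by simp
  qed
  then have "smult (2 * s + 3) (pderiv (one_minus_sq * p * g ^ 2)) =
     smult (2 * (s + 2)) (one_minus_sq * p * g * d) - smult ((2 * s + 3) * (2 * (s + 1))) (p * h * g)"
    by (intro poly_ext)
  moreover have "2 * of_nat j + 1 = 2 * s + 3" "of_nat j + 1 = s + 2" "of_nat j = s + 1" by (simp_all add: Suc s_def)
  ultimately show ?thesis unfolding p_def g_def d_def h_def Suc diff_Suc_1 der power_Suc
    by (simp only: mult_smult_right mult_smult_left smult_smult mult_ac)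
qed

lemma Tcoeff_Suc:
  assumes "j < N"
  shows "Tcoeff N (Suc j) * ((of_nat N - of_nat j) * ((2 * of_nat j + 1) * (2 * of_nat j + 3))) =
    Tcoeff N j * ((of_nat N + of_nat j + 2) * (of_nat j + 1 :: 'a::field_char_0) ^ 2)"
proof -
  define s t where "s = (of_nat j :: 'a)" and "t = (of_nat N :: 'a)"
  have f: "fact (N + 1 + Suc j) = (t + s + 2) * (fact (N + 1 + j) :: 'a)"
    "fact (Suc j) = (s + 1) * (fact j :: 'a)"
    "fact (2 * Suc j) = 2 * (s + 1) * (2 * s + 1) * (fact (2 * j) :: 'a)"
    "fact (2 * Suc j + 1) = (2 * s + 3) * (2 * (s + 1)) * (fact (2 * j + 1) :: 'a)"
    by (simp_all add: s_def t_def algebra_simps)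
  have f2: "fact (N - j) = (t - s) * (fact (N - Suc j) :: 'a)"
    using assms by (simp add: fact_num_eq_if[of "N - j"] of_nat_diff algebra_simps s_def t_def)
  have n: "s + 1 \<noteq> 0" "2 * s + 1 \<noteq> 0" "2 * s + 3 \<noteq> 0"
    using of_nat_neq_0[of j, where ?'a = 'a] of_nat_neq_0[of "2 * j", where ?'a = 'a]
      of_nat_neq_0[of "2 * j + 2", where ?'a = 'a]
    by (simp_all add: s_def algebra_simps)
  have "q * A * B * (4 * P) * (u * F) ^ 4 / (C * (2 * u * o1 * G) * (o3 * (2 * u) * H)) * (m * (o1 * o3))
      = A * (m * B) * P * F ^ 4 / (C * G * H) * (q * u ^ 2)" if "u \<noteq> 0" "o1 \<noteq> 0" "o3 \<noteq> 0"
    for q A B P u F C o1 G o3 H m :: 'a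
    using that by (simp add: power4_eq_xxxx power2_eq_square mult_ac)
  from this[OF n] show ?thesis
    unfolding Tcoeff_def f f2 power_Suc s_def[symmetric] t_def[symmetric] .
qed

text \<open>
The last diagonal entry is the sum of squares of a row of a unitary representation matrix, hence
constant. Concretely, its derivative telescopes, and the value at \<open>x = 1\<close> is the summand
\<open>j = 0\<close>.
\<close>

lemma wpoly_corner: "wpoly N N N = ([:of_nat N + 1:] :: 'a::field_char_0 poly)"
proof -
  define d :: "nat \<Rightarrow> 'a" where "d j = Tcoeff N j * of_nat (N choose j) ^ 2" for j
  define E :: "nat \<Rightarrow> 'a poly" where "E j = one_minus_sq ^ j * geg N j * geg N (Suc j)" for j
  have w: "wpoly N N N = (\<Sum>j\<le>N. smult (d j) (one_minus_sq ^ j * geg N j ^ 2))"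
    unfolding wpoly_def d_def Lpoly_def by (intro sum.cong refl) (simp add: power2_eq_square mult_ac)
  have odd: "2 * of_nat j + 1 \<noteq> (0::'a)" for j
    using of_nat_neq_0[of "2 * j", where ?'a = 'a] by (simp add: add_ac)
  have odd3: "2 * of_nat j + 3 \<noteq> (0::'a)" for j
    using odd[of "Suc j"] by (simp add: add_ac)
  (* this quotient makes the derivatives of consecutive summands cancel *)
  have dr: "d (Suc j) * ((2 * of_nat j + 1) * (2 * of_nat j + 3)) = d j * ((of_nat N - of_nat j) * (of_nat N + of_nat j + 2))" if "j < N" for j
  proof -
    have "Suc j * (N choose Suc j) = (N - j) * (N choose j)"
      by (metis binomial_absorption binomial_absorb_comp mult.commute)
    then have "(of_nat (Suc j * (N choose Suc j)) :: 'a) = of_nat ((N - j) * (N choose j))" by (rule arg_cong)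
    then have b: "(of_nat j + 1) * of_nat (N choose Suc j) = (of_nat N - of_nat j) * (of_nat (N choose j) :: 'a)"
      unfolding of_nat_mult of_nat_Suc using that by (simp only: of_nat_diff add.commute less_imp_le)
    have n: "of_nat j + 1 \<noteq> (0::'a)"
      using of_nat_neq_0[of j, where ?'a = 'a] by (auto simp: add_ac)
    have b': "of_nat (N choose Suc j) = (of_nat N - of_nat j) * of_nat (N choose j) / (of_nat j + 1 :: 'a)"
      using b n by (simp add: eq_divide_eq mult.commute)
    have "T' * (m * K / s) ^ 2 * q = T * K ^ 2 * (m * p)" if "T' * (m * q) = T * (p * s ^ 2)" "s \<noteq> 0"
      for T' m K s q T p :: 'a
    proof -
      have "T' * (m * K / s) ^ 2 * q = T' * (m * q) * (m * K ^ 2) / s ^ 2"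
        by (simp add: power_divide power_mult_distrib power2_eq_square mult_ac)
      then show ?thesis unfolding that(1) using that(2) by (simp add: mult_ac)
    qed
    from this[OF Tcoeff_Suc[OF that] n] show ?thesis unfolding d_def b' .
  qed
  have pd: "pderiv (\<Sum>j\<le>J. smult (d j) (one_minus_sq ^ j * geg N j ^ 2)) =
     smult (2 * (of_nat J + 1) * d J * ((of_nat N - of_nat J) * (of_nat N + of_nat J + 2)) / ((2 * of_nat J + 1) * (2 * of_nat J + 3))) (E J)" if "J \<le> N" for J
    using that
  proof (induction J)
    case 0
    have "pderiv (smult (d 0) (one_minus_sq ^ 0 * geg N 0 ^ 2)) = smult (d 0) (smult 1 (pderiv (one_minus_sq ^ 0 * geg N 0 ^ 2)))" by (simp add: pderiv_smult)
    then show ?case using pderiv_one_minus_sq_power_geg_square[of 0 N, where ?'a = 'a]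
      by (simp add: pderiv_smult E_def mult_ac)
  next
    case (Suc J)
    define c :: 'a where "c = 2 * of_nat (Suc J) + 1"
    define k :: 'a where "k = (of_nat N - of_nat (Suc J)) * (of_nat N + of_nat (Suc J) + 2) / (2 * of_nat (Suc J) + 3)"
    have c: "c \<noteq> 0" unfolding c_def using odd by blast
    have "smult c (pderiv (one_minus_sq ^ Suc J * geg N (Suc J) ^ 2)) =
      smult (2 * (of_nat (Suc J) + 1) * k) (E (Suc J)) - smult (c * (2 * of_nat (Suc J))) (E J)"
      using pderiv_one_minus_sq_power_geg_square[of "Suc J" N, where ?'a = 'a] Suc.prems
      unfolding c_def k_def E_def by (simp only: diff_Suc_1)
    then have "smult (1 / c) (smult c (pderiv (one_minus_sq ^ Suc J * geg N (Suc J) ^ 2))) =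
      smult (1 / c) (smult (2 * (of_nat (Suc J) + 1) * k) (E (Suc J)) - smult (c * (2 * of_nat (Suc J))) (E J))"
      by (rule arg_cong)
    then have pp: "pderiv (one_minus_sq ^ Suc J * geg N (Suc J) ^ 2) =
      smult (2 * (of_nat (Suc J) + 1) * k / c) (E (Suc J)) - smult (2 * of_nat (Suc J)) (E J)"
      using c by (simp add: smult_diff_right)
    have "d (Suc J) * (2 * of_nat (Suc J)) = 2 * (of_nat J + 1) * d J * ((of_nat N - of_nat J) * (of_nat N + of_nat J + 2)) / ((2 * of_nat J + 1) * (2 * of_nat J + 3))"
    proof -
      have "d (Suc J) = d J * ((of_nat N - of_nat J) * (of_nat N + of_nat J + 2)) / ((2 * of_nat J + 1) * (2 * of_nat J + 3))"
        using dr[of J] Suc.prems odd[of J] odd3[of J] by (simp only: eq_divide_eq) simp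
      then show ?thesis by (simp add: mult_ac add.commute)
    qed
    moreover have "d (Suc J) * (2 * (of_nat (Suc J) + 1) * k / c) = 2 * (of_nat (Suc J) + 1) * d (Suc J) * ((of_nat N - of_nat (Suc J)) * (of_nat N + of_nat (Suc J) + 2)) / ((2 * of_nat (Suc J) + 1) * (2 * of_nat (Suc J) + 3))"
      unfolding c_def k_def by (simp only: times_divide_eq_right times_divide_eq_left divide_divide_eq_left mult_ac)
    ultimately show ?case using Suc
      by (simp only: sum.atMost_Suc pderiv_add pderiv_smult pp smult_diff_right smult_smult) simp
  qed
  have "pderiv (wpoly N N N :: 'a poly) = 0"
    unfolding w pd[OF order_refl] by simp
  then have "degree (wpoly N N N :: 'a poly) = 0" by (simp add: pderiv_eq_0_iff)
  then obtain c where c: "wpoly N N N = [:c :: 'a:]" by (metis degree_eq_zeroE)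
  have "poly (wpoly N N N :: 'a poly) 1 = (\<Sum>j\<le>N. if j = 0 then d 0 else 0)"
    unfolding w poly_sum by (intro sum.cong refl) (auto simp: poly_geg_1 power_0_left)
  also have "\<dots> = d 0" by simp
  also have "d 0 = of_nat N + 1" by (simp add: d_def Tcoeff_def power2_eq_square add.commute)
  finally show ?thesis unfolding c by simp
qed

lemma pochhammer_rec_shift: "b = a + 1 \<Longrightarrow> pochhammer a (Suc s) = a * pochhammer b s"
  by (simp add: pochhammer_rec)

lemma pochhammer_Suc_shift: "c = a + of_nat s \<Longrightarrow> pochhammer a (Suc s) = pochhammer a s * c"
  by (simp add: pochhammer_Suc)

text \<open>
The coefficients \<open>\<alpha>\<^sub>t(m, n)\<close> satisfy what \<open>wpoly_recurrence\<close> demands of Chebyshev coefficients.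
The first and the last coefficient have fewer neighbours than the others, so there are
three cases.
\<close>

lemma weight_coeff_recurrence_0:
  assumes "Suc p \<le> n" "n \<le> M"
  shows "(real M + 1) ^ 2 * weight_coeff (Suc M) 0 (Suc p) n =
    ((real M + 1) * (real M + 2) - (real p + 1) * (real p + 2)) * weight_coeff M 0 (Suc p) n
    + (real p + 1) ^ 2 * weight_coeff M 0 p n"
proof -
  define X Y f where "X = pochhammer (real n - real M) p" and "Y = pochhammer (real n + 2) p"
    and "f = (fact (M - Suc p) :: real)"
  have Y: "Y > 0" "f > 0" unfolding Y_def f_def by (auto intro: pochhammer_pos)
  have p0: "pochhammer (real n - real (Suc M)) (Suc p) = (real n - real (Suc M)) * X"
    unfolding X_def by (rule pochhammer_rec_shift) simp
  have p1: "pochhammer (real n - real M) (Suc p) = X * (real n - real M + real p)"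
    "pochhammer (real n + 2) (Suc p) = Y * (real n + 2 + real p)"
    unfolding X_def Y_def by (rule pochhammer_Suc_shift, simp)+
  have f1: "fact (Suc M - Suc p) = (real M - real p) * f" "fact (M - p) = (real M - real p) * f"
    using assms by (simp_all add: f_def Suc_diff_Suc[of p M, symmetric] of_nat_diff)
  have F: "fact (Suc M) = (real M + 1) * fact M" "fact (Suc p) = (real p + 1) * fact p"
    by (simp_all add: algebra_simps)
  define N P Q g where "N = real M" and "P = real p" and "Q = real n" and "g = (fact M :: real)"
  have pos: "N \<ge> 0" "P \<ge> 0" "Q \<ge> 0" "g > 0" unfolding N_def P_def Q_def g_def by auto
  define B where "B = f * fact p * (- 1) ^ p * X / (g * Y * (Q + 1))"
  have a1: "(N + 1) ^ 2 * weight_coeff (Suc M) 0 (Suc p) n = (N + 1) * (N + 2) * (N - P) * (P + 1) * (N + 1 - Q) * B / (Q + 2 + P)"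
    unfolding weight_coeff_def diff_zero f1 F p0 p1 Y_def[symmetric] pochhammer_0 B_def power_Suc
    unfolding of_nat_Suc N_def[symmetric] P_def[symmetric] Q_def[symmetric] g_def[symmetric]
    using pos Y by (simp add: divide_simps power2_eq_square) (simp add: algebra_simps)
  have a2: "weight_coeff M 0 (Suc p) n = (N + 1) * (P + 1) * (N - Q - P) * B / (Q + 2 + P)"
    unfolding weight_coeff_def diff_zero f_def[symmetric] F p0 p1 Y_def[symmetric] pochhammer_0 B_def power_Suc
    unfolding of_nat_Suc N_def[symmetric] P_def[symmetric] Q_def[symmetric] g_def[symmetric]
    using pos Y by (simp add: divide_simps power2_eq_square) (simp add: algebra_simps)
  have "weight_coeff M 0 p n = (N + 1) * (N - P) * B"
    unfolding weight_coeff_def diff_zero f1 F X_def[symmetric] Y_def[symmetric] pochhammer_0 B_def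
    unfolding of_nat_Suc N_def[symmetric] P_def[symmetric] Q_def[symmetric] g_def[symmetric]
    using pos Y by (simp add: divide_simps)
  then have a3: "weight_coeff M 0 p n = (N + 1) * (N - P) * (Q + 2 + P) * B / (Q + 2 + P)"
    using pos by simp
  show ?thesis
    unfolding N_def[symmetric] P_def[symmetric] a1 a2 a3
      times_divide_eq_right add_divide_distrib[symmetric]
    by (rule arg_cong2[where f = divide]) (simp_all add: algebra_simps power2_eq_square)
qed

lemma weight_coeff_recurrence_last:
  assumes "Suc p \<le> n" "n \<le> M"
  shows "(real M + 1) ^ 2 * weight_coeff (Suc M) (Suc p) (Suc p) n =
    ((real M + 1) * (real M + 2) - (real p + 1) * (real p + 2)) * weight_coeff M (Suc p) (Suc p) n
    + (real p + 1) ^ 2 * weight_coeff M p p n"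
proof -
  define Z f where "Z = pochhammer (real M + 2 - real p) p" and "f = (fact (M - Suc p) :: real)"
  have f1: "fact (Suc M - Suc p) = (real M - real p) * f" "fact (M - p) = (real M - real p) * f"
    using assms by (simp_all add: f_def Suc_diff_Suc[of p M, symmetric] of_nat_diff)
  have F: "fact (Suc M) = (real M + 1) * fact M" "fact (Suc p) = (real p + 1) * fact p"
    by (simp_all add: algebra_simps)
  have p1: "pochhammer (real (Suc M) + 2 - real (Suc p)) (Suc p) = Z * (real M + 2)"
  proof -
    have "real (Suc M) + 2 - real (Suc p) = real M + 2 - real p" by simp
    then show ?thesis unfolding Z_def by (simp only: pochhammer_Suc) simp
  qed
  have p2: "pochhammer (real M + 2 - real (Suc p)) (Suc p) = (real M + 1 - real p) * Z"
    using pochhammer_rec_shift[of "real M + 2 - real p" "real M + 2 - real (Suc p)" p] by (simp add: Z_def add_ac)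
  define N P Q g where "N = real M" and "P = real p" and "Q = real n" and "g = (fact M :: real)"
  have pos: "N \<ge> 0" "P \<ge> 0" "Q \<ge> 0" "g > 0" unfolding N_def P_def Q_def g_def by auto
  define B where "B = f * Z / (g * (Q + 1))"
  have a1: "(N + 1) ^ 2 * weight_coeff (Suc M) (Suc p) (Suc p) n = (N + 1) * (N + 2) ^ 2 * (N - P) * B"
    unfolding weight_coeff_def diff_self_eq_0 f1 F p1 pochhammer_0 B_def
    unfolding of_nat_Suc N_def[symmetric] P_def[symmetric] Q_def[symmetric] g_def[symmetric]
    using pos by (simp add: divide_simps power2_eq_square)
  have a2: "weight_coeff M (Suc p) (Suc p) n = (N + 1) * (N + 1 - P) * B"
    unfolding weight_coeff_def diff_self_eq_0 f_def[symmetric] F p2 pochhammer_0 B_def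
    unfolding of_nat_Suc N_def[symmetric] P_def[symmetric] Q_def[symmetric] g_def[symmetric]
    using pos by (simp add: divide_simps)
  have a3: "weight_coeff M p p n = (N + 1) * (N - P) * B"
    unfolding weight_coeff_def diff_self_eq_0 f1 Z_def[symmetric] pochhammer_0 B_def
    unfolding of_nat_Suc N_def[symmetric] P_def[symmetric] Q_def[symmetric] g_def[symmetric]
    using pos by (simp add: divide_simps)
  show ?thesis
    unfolding N_def[symmetric] P_def[symmetric] a1 a2 a3
    by (simp add: algebra_simps power2_eq_square)
qed

text \<open>
All five coefficients are a common factor \<open>B\<close> times short polynomials; the identity then
reduces to one cubic polynomial identity in \<open>N, s, e, n\<close> with \<open>e = p - s - 1\<close>.
\<close>

lemma weight_coeff_recurrence_mid:
  assumes "Suc p \<le> n" "n \<le> M" "s < p"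
  shows "(real M + 1) ^ 2 * weight_coeff (Suc M) (Suc s) (Suc p) n =
    ((real M + 1) * (real M + 2) - (real p + 1) * (real p + 2)) * weight_coeff M (Suc s) (Suc p) n
    - real p * (real p + 1) * weight_coeff M s (p - 1) n
    + (real p + 1) ^ 2 * (weight_coeff M (Suc s) p n + weight_coeff M s p n)"
proof -
  obtain e where e: "p = Suc (s + e)" using assms(3) less_imp_Suc_add by blast
  define X Y where "X = pochhammer (real n - real M) e" and "Y = pochhammer (real n + 2) e"
  define Z f where "Z = pochhammer (real M + 2 - real s) s" and "f = (fact (M - Suc p) :: real)"
  define r where "r = (fact (p - 1) :: real)"
  have Y: "Y > 0" "f > 0" "r > 0" unfolding Y_def f_def r_def by (auto intro: pochhammer_pos)
  have d: "Suc p - Suc s = Suc e" "p - Suc s = e" "p - 1 - s = e" "p - s = Suc e" using e by auto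
  have p1: "pochhammer (real n - real (Suc M)) (Suc e) = (real n - real M - 1) * X"
    using pochhammer_rec_shift[of "real n - real M" "real n - real (Suc M)" e] by (simp add: X_def diff_diff_eq add.commute)
  have p2: "pochhammer (real n - real M) (Suc e) = X * (real n - real M + real e)"
    "pochhammer (real n + 2) (Suc e) = Y * (real n + 2 + real e)"
    unfolding X_def Y_def by (rule pochhammer_Suc_shift, simp)+
  have p3: "pochhammer (real (Suc M) + 2 - real (Suc s)) (Suc s) = Z * (real M + 2)"
  proof -
    have "real (Suc M) + 2 - real (Suc s) = real M + 2 - real s" by simp
    then show ?thesis unfolding Z_def by (simp only: pochhammer_Suc) simp
  qed
  have p4: "pochhammer (real M + 2 - real (Suc s)) (Suc s) = (real M + 1 - real s) * Z"
    using pochhammer_rec_shift[of "real M + 2 - real s" "real M + 2 - real (Suc s)" s] by (simp add: Z_def add_ac)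
  have f0: "fact (M - p) = (real M - real p) * f"
    using assms by (simp add: f_def Suc_diff_Suc[of p M, symmetric] of_nat_diff)
  have f1: "fact (Suc M - Suc p) = (real M - real p) * f"
    "fact (M - (p - 1)) = (real M - real p + 1) * ((real M - real p) * f)"
  proof -
    show "fact (Suc M - Suc p) = (real M - real p) * f" using f0 by simp
    have "M - (p - 1) = Suc (M - p)" using e assms by simp
    then have "fact (M - (p - 1)) = (1 + real (M - p)) * (fact (M - p) :: real)" by simp
    then show "fact (M - (p - 1)) = (real M - real p + 1) * ((real M - real p) * f)"
      using assms f0 by (simp add: of_nat_diff)
  qed
  have F: "fact (Suc M) = (real M + 1) * fact M" "fact (Suc s) = (real s + 1) * fact s"
    "fact (Suc p) = (real p + 1) * (real p * r)" "fact p = real p * r"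
    using e by (simp_all add: r_def algebra_simps)
  have pe: "real p = real s + real e + 1" using e by simp
  have pw: "(-1) ^ Suc e = - ((-1) ^ e :: real)" by simp
  define N S E Q where "N = real M" and "S = real s" and "E = real e" and "Q = real n"
  have pos: "N \<ge> 0" "S \<ge> 0" "E \<ge> 0" "Q \<ge> 0" unfolding N_def S_def E_def Q_def by auto
  define g where "g = (fact M :: real)"
  define h where "h = (fact s :: real)"
  define w where "w = (- 1 :: real) ^ e"
  define B where "B = f * r * w * X * Z / (g * Y * h * (Q + 1))"
  define D where "D = (S + 1) * (Q + 2 + E)"
  have D: "D > 0" unfolding D_def using pos by simp
  note unf = N_def[symmetric] S_def[symmetric] E_def[symmetric] Q_def[symmetric] g_def[symmetric] h_def[symmetric] w_def[symmetric]
  note fold0 = X_def[symmetric] Y_def[symmetric] Z_def[symmetric] r_def[symmetric]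
  have a1: "(N + 1) ^ 2 * weight_coeff (Suc M) (Suc s) (Suc p) n =
     (N + 1) * (1 + N + 1) * (N - (S + E + 1)) * (S + E + 1 + 1) * (S + E + 1) * (- (Q - N - 1)) * (N + 2) * B / D"
  proof -
    have "n1 ^ 2 * (n2 / q * (c1 * f * (p1 * (p * r)) / (n1 * g)) * (- w) * (c2 * X / (Y * c3)) * (Z * n3 / (s1 * h))) =
      n1 * n2 * c1 * p1 * p * (- c2) * n3 * (f * r * w * X * Z / (g * Y * h * q)) / (s1 * c3)" if "n1 \<noteq> 0"
      for n1 n2 n3 q c1 p1 p c2 c3 s1 f r g w X Y Z h :: real
      using that by (simp add: power2_eq_square mult_ac)
    moreover have "N + 1 \<noteq> 0" using pos by simp
    ultimately show ?thesis
      unfolding weight_coeff_def d f1 F p1 p2 p3 p4 pw B_def D_def fold0 unfolding pe of_nat_Suc unf by blast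
  qed
  have a2: "weight_coeff M (Suc s) (Suc p) n =
     (N + 1) * (S + E + 1 + 1) * (S + E + 1) * (- (Q - N + E)) * (N + 1 - S) * B / D"
  proof -
    have "n1 / q * (f * (p1 * (p * r)) / g) * (- w) * (X * c4 / (Y * c3)) * (c5 * Z / (s1 * h)) =
      n1 * p1 * p * (- c4) * c5 * (f * r * w * X * Z / (g * Y * h * q)) / (s1 * c3)"
      for n1 q p1 p c3 c4 c5 s1 f r g w X Y Z h :: real
      by (simp add: mult_ac)
    then show ?thesis
      unfolding weight_coeff_def d f_def[symmetric] F p1 p2 p3 p4 pw B_def D_def fold0 unfolding pe of_nat_Suc unf by blast
  qed
  have a3: "weight_coeff M s (p - 1) n =
     (N + 1) * (N - (S + E + 1) + 1) * (N - (S + E + 1)) * B"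
  proof -
    have "n1 / q * ((c6 * (c1 * f)) * r / g) * w * (X / Y) * (Z / h) =
      n1 * c6 * c1 * (f * r * w * X * Z / (g * Y * h * q))"
      for n1 q c1 c6 f r g w X Y Z h :: real
      by (simp add: mult_ac)
    then show ?thesis
      unfolding weight_coeff_def d f1 F p1 p2 p3 p4 pw B_def D_def fold0 unfolding pe of_nat_Suc unf by blast
  qed
  have a4: "weight_coeff M (Suc s) p n =
     (N + 1) * (N - (S + E + 1)) * (S + E + 1) * (N + 1 - S) * B / (S + 1)"
  proof -
    have "n1 / q * ((c1 * f) * (p * r) / g) * w * (X / Y) * (c5 * Z / (s1 * h)) =
      n1 * c1 * p * c5 * (f * r * w * X * Z / (g * Y * h * q)) / s1"
      for n1 q p c1 c5 s1 f r g w X Y Z h :: real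
      by (simp add: mult_ac)
    then show ?thesis
      unfolding weight_coeff_def d f0 F p1 p2 p3 p4 pw B_def D_def fold0 unfolding pe of_nat_Suc unf by blast
  qed
  have a5: "weight_coeff M s p n =
     (N + 1) * (N - (S + E + 1)) * (S + E + 1) * (- (Q - N + E)) * B / (Q + 2 + E)"
  proof -
    have "n1 / q * ((c1 * f) * (p * r) / g) * (- w) * (X * c4 / (Y * c3)) * (Z / h) =
      n1 * c1 * p * (- c4) * (f * r * w * X * Z / (g * Y * h * q)) / c3"
      for n1 q p c1 c3 c4 f r g w X Y Z h :: real
      by (simp add: mult_ac)
    then show ?thesis
      unfolding weight_coeff_def d f0 F p1 p2 p3 p4 pw B_def D_def fold0 unfolding pe of_nat_Suc unf by blast
  qed
  have a4': "weight_coeff M (Suc s) p n =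
     (N + 1) * (N - (S + E + 1)) * (S + E + 1) * (N + 1 - S) * (Q + 2 + E) * B / D"
    unfolding a4 D_def using pos by (simp add: divide_simps)
  have a5': "weight_coeff M s p n =
     (N + 1) * (N - (S + E + 1)) * (S + E + 1) * (- (Q - N + E)) * (S + 1) * B / D"
    unfolding a5 D_def using pos by (simp add: divide_simps)
  have a3': "weight_coeff M s (p - 1) n =
     (N + 1) * (N - (S + E + 1) + 1) * (N - (S + E + 1)) * D * B / D"
    unfolding a3 using D by simp
  have pe': "real p = S + E + 1" using pe unfolding S_def E_def .
  define P c where "P = S + E + 1" and "c = N - P"
  (* the identity of the five coefficients after division by C *)
  have core: "(N + 2) ^ 2 * (N + 1 - Q) =
      (N + P + 3) * (N - Q - E) * (N + 1 - S) - (c + 1) * D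
      + (P + 1) * ((N + 1 - S) * (Q + 2 + E) + (N - Q - E) * (S + 1))"
    unfolding P_def c_def D_def by (simp add: algebra_simps power2_eq_square)
  define C where "C = (N + 1) * P * (P + 1) * c * (B / D)"
  have c1: "(N + 1) ^ 2 * weight_coeff (Suc M) (Suc s) (Suc p) n = C * ((N + 2) ^ 2 * (N + 1 - Q))"
  proof -
    have "1 + N + 1 = N + 2" "- (Q - N - 1) = N + 1 - Q" by simp_all
    then show ?thesis unfolding a1 C_def P_def[symmetric] c_def[symmetric]
      by (simp only: times_divide_eq_right power2_eq_square mult_ac)
  qed
  have k: "(N + 1) * (N + 2) - (P + 1) * (P + 2) = c * (N + P + 3)"
    unfolding c_def by (simp add: algebra_simps)
  have c2: "((N + 1) * (N + 2) - (P + 1) * (P + 2)) * weight_coeff M (Suc s) (Suc p) n =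
      C * ((N + P + 3) * (N - Q - E) * (N + 1 - S))"
  proof -
    have "- (Q - N + E) = N - Q - E" by simp
    then show ?thesis unfolding a2 k C_def P_def[symmetric] c_def[symmetric]
      by (simp only: times_divide_eq_right power2_eq_square mult_ac)
  qed
  have c3: "P * (P + 1) * weight_coeff M s (p - 1) n = C * ((c + 1) * D)"
    unfolding a3' C_def P_def[symmetric] c_def[symmetric]
    by (simp only: times_divide_eq_right power2_eq_square mult_ac)
  have c4: "(P + 1) ^ 2 * weight_coeff M (Suc s) p n = C * ((P + 1) * ((N + 1 - S) * (Q + 2 + E)))"
    unfolding a4' C_def P_def[symmetric] c_def[symmetric]
    by (simp only: times_divide_eq_right power2_eq_square mult_ac)
  have c5: "(P + 1) ^ 2 * weight_coeff M s p n = C * ((P + 1) * ((N - Q - E) * (S + 1)))"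
  proof -
    have "- (Q - N + E) = N - Q - E" by simp
    then show ?thesis unfolding a5' C_def P_def[symmetric] c_def[symmetric]
      by (simp only: times_divide_eq_right power2_eq_square mult_ac)
  qed
  show ?thesis
    unfolding pe' P_def[symmetric] N_def[symmetric] c1 c2 c3 distrib_left[of "(P + 1) ^ 2"] c4 c5 core
    by (simp only: distrib_left right_diff_distrib)
qed

lemma poly_cheb_U: "poly (cheb_U r xpoly) x = cheb_U r (x :: 'a::field_char_0)"
  by (induction r x rule: cheb_U.induct) (simp_all add: numeral_poly)

lemma cheb_U_eq_poly_geg: "cheb_U r x = (of_nat r + 1) * poly (geg r 0) (x :: 'a::field_char_0)"
  using poly_cheb_U[of r x] by (simp add: cheb_U_eq_geg)

definition cheb_sum :: "nat \<Rightarrow> nat \<Rightarrow> nat \<Rightarrow> real \<Rightarrow> real" where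
  "cheb_sum N m n x = (\<Sum>t\<le>m. weight_coeff N t m n * cheb_U (n + m - 2 * t) x)"

lemma cheb_U_times_2x: "s \<ge> 1 \<Longrightarrow> 2 * x * cheb_U s x = cheb_U (s + 1) x + cheb_U (s - 1) (x :: 'a::comm_ring_1)"
  by (cases s) simp_all

lemma cheb_sum_recurrence:
  assumes "Suc p \<le> n" "n \<le> M"
  shows "(real M + 1) ^ 2 * cheb_sum (Suc M) (Suc p) n x =
    ((real M + 1) * (real M + 2) - (real p + 1) * (real p + 2)) * cheb_sum M (Suc p) n x
    - real p * (real p + 1) * cheb_sum M (p - 1) n x
    + (real p + 1) ^ 2 * (2 * x * cheb_sum M p n x)"
proof -
  define V where "V t = cheb_U (n + Suc p - 2 * t) x" for t
  define K where "K = (real M + 1) * (real M + 2) - (real p + 1) * (real p + 2)"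
  have A: "cheb_sum N (Suc p) n x = weight_coeff N 0 (Suc p) n * V 0
      + (\<Sum>s<p. weight_coeff N (Suc s) (Suc p) n * V (Suc s)) + weight_coeff N (Suc p) (Suc p) n * V (Suc p)" for N
    unfolding cheb_sum_def V_def sum.atMost_Suc
    by (simp add: sum.atMost_shift del: sum.lessThan_Suc)
  have B: "real p * (real p + 1) * cheb_sum M (p - 1) n x =
      (\<Sum>s<p. real p * (real p + 1) * weight_coeff M s (p - 1) n * V (Suc s))"
  proof (cases p)
    case (Suc q)
    have "n + (p - 1) - 2 * s = n + Suc p - 2 * Suc s" for s using Suc by simp
    moreover have "{..p - 1} = {..<p}" using Suc by (auto simp: less_Suc_eq_le)
    ultimately show ?thesis unfolding cheb_sum_def V_def by (simp only: sum_distrib_left mult.assoc)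
  qed simp
  have "2 * x * cheb_sum M p n x = (\<Sum>t\<le>p. weight_coeff M t p n * (V t + V (Suc t)))"
    unfolding cheb_sum_def sum_distrib_left
  proof (intro sum.cong refl)
    fix t assume "t \<in> {..p}"
    then have t: "n + p - 2 * t \<ge> 1" "n + p - 2 * t + 1 = n + Suc p - 2 * t" "n + p - 2 * t - 1 = n + Suc p - 2 * Suc t"
      using assms by auto
    have "2 * x * (weight_coeff M t p n * cheb_U (n + p - 2 * t) x) =
      weight_coeff M t p n * (2 * x * cheb_U (n + p - 2 * t) x)" by simp
    also have "\<dots> = weight_coeff M t p n * (V t + V (Suc t))"
      unfolding cheb_U_times_2x[OF t(1)] t V_def ..
    finally show "2 * x * (weight_coeff M t p n * cheb_U (n + p - 2 * t) x) = \<dots>" .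
  qed
  also have "\<dots> = (\<Sum>t\<le>p. weight_coeff M t p n * V t) + (\<Sum>t\<le>p. weight_coeff M t p n * V (Suc t))"
    by (simp add: distrib_left sum.distrib)
  also have "(\<Sum>t\<le>p. weight_coeff M t p n * V t) = weight_coeff M 0 p n * V 0 + (\<Sum>s<p. weight_coeff M (Suc s) p n * V (Suc s))"
    by (rule sum.atMost_shift)
  also have "(\<Sum>t\<le>p. weight_coeff M t p n * V (Suc t)) = (\<Sum>s<p. weight_coeff M s p n * V (Suc s)) + weight_coeff M p p n * V (Suc p)"
    by (simp add: lessThan_Suc_atMost[symmetric])
  finally have C: "2 * x * cheb_sum M p n x =
     weight_coeff M 0 p n * V 0 + (\<Sum>s<p. (weight_coeff M (Suc s) p n + weight_coeff M s p n) * V (Suc s)) + weight_coeff M p p n * V (Suc p)"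
    by (simp add: sum.distrib distrib_right)
  have mid: "(real M + 1) ^ 2 * (\<Sum>s<p. weight_coeff (Suc M) (Suc s) (Suc p) n * V (Suc s)) =
     K * (\<Sum>s<p. weight_coeff M (Suc s) (Suc p) n * V (Suc s))
     - (\<Sum>s<p. real p * (real p + 1) * weight_coeff M s (p - 1) n * V (Suc s))
     + (real p + 1) ^ 2 * (\<Sum>s<p. (weight_coeff M (Suc s) p n + weight_coeff M s p n) * V (Suc s))"
    unfolding sum_distrib_left sum_subtractf[symmetric] sum.distrib[symmetric]
  proof (intro sum.cong refl)
    fix s assume "s \<in> {..<p}"
    then have "s < p" by simp
    from weight_coeff_recurrence_mid[OF assms this] show
      "(real M + 1) ^ 2 * (weight_coeff (Suc M) (Suc s) (Suc p) n * V (Suc s)) =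
       K * (weight_coeff M (Suc s) (Suc p) n * V (Suc s))
       - real p * (real p + 1) * weight_coeff M s (p - 1) n * V (Suc s)
       + (real p + 1) ^ 2 * ((weight_coeff M (Suc s) p n + weight_coeff M s p n) * V (Suc s))"
      unfolding K_def[symmetric]
      by (simp only: mult.assoc[symmetric]) (simp only: left_diff_distrib distrib_right)
  qed
  have e0: "(real M + 1) ^ 2 * (weight_coeff (Suc M) 0 (Suc p) n * V 0) =
     K * (weight_coeff M 0 (Suc p) n * V 0) + (real p + 1) ^ 2 * (weight_coeff M 0 p n * V 0)"
    using weight_coeff_recurrence_0[OF assms] unfolding K_def[symmetric]
    by (simp only: mult.assoc[symmetric] distrib_right)
  have e1: "(real M + 1) ^ 2 * (weight_coeff (Suc M) (Suc p) (Suc p) n * V (Suc p)) =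
     K * (weight_coeff M (Suc p) (Suc p) n * V (Suc p)) + (real p + 1) ^ 2 * (weight_coeff M p p n * V (Suc p))"
    using weight_coeff_recurrence_last[OF assms] unfolding K_def[symmetric]
    by (simp only: mult.assoc[symmetric] distrib_right)
  have L: "(real M + 1) ^ 2 * cheb_sum (Suc M) (Suc p) n x =
      (real M + 1) ^ 2 * (weight_coeff (Suc M) 0 (Suc p) n * V 0)
      + (real M + 1) ^ 2 * (\<Sum>s<p. weight_coeff (Suc M) (Suc s) (Suc p) n * V (Suc s))
      + (real M + 1) ^ 2 * (weight_coeff (Suc M) (Suc p) (Suc p) n * V (Suc p))"
    unfolding A by (simp only: distrib_left)
  have R: "K * cheb_sum M (Suc p) n x = K * (weight_coeff M 0 (Suc p) n * V 0)
      + K * (\<Sum>s<p. weight_coeff M (Suc s) (Suc p) n * V (Suc s))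
      + K * (weight_coeff M (Suc p) (Suc p) n * V (Suc p))"
    unfolding A by (simp only: distrib_left)
  have R': "(real p + 1) ^ 2 * (2 * x * cheb_sum M p n x) = (real p + 1) ^ 2 * (weight_coeff M 0 p n * V 0)
      + (real p + 1) ^ 2 * (\<Sum>s<p. (weight_coeff M (Suc s) p n + weight_coeff M s p n) * V (Suc s))
      + (real p + 1) ^ 2 * (weight_coeff M p p n * V (Suc p))"
    unfolding C by (simp only: distrib_left)
  show ?thesis
    unfolding K_def[symmetric] L R R' B mid e0 e1 by simp
qed

text \<open>
For \<open>n = N\<close> the Pochhammer symbol \<open>(0)\<^sub>m\<^sub>-\<^sub>t\<close> leaves only the term \<open>t = m\<close>.
\<close>

lemma cheb_sum_last_row:
  assumes "m \<le> N"
  shows "cheb_sum N m N x = (real N + 1) / (real N + 1 - real m) * cheb_U (N - m) x"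
proof -
  have "cheb_sum N m N x = weight_coeff N m m N * cheb_U (N + m - 2 * m) x
     + (\<Sum>t<m. weight_coeff N t m N * cheb_U (N + m - 2 * t) x)"
    unfolding cheb_sum_def lessThan_Suc_atMost[symmetric] by simp
  also have "(\<Sum>t<m. weight_coeff N t m N * cheb_U (N + m - 2 * t) x) = 0"
    by (intro sum.neutral ballI) (auto simp: weight_coeff_def pochhammer_0_left)
  also have "weight_coeff N m m N = (real N + 1) / (real N + 1 - real m)"
  proof -
    have "pochhammer (real N + 2 - real m) m * fact (N - m) * (real N + 1 - real m) = fact (N + 1)"
    proof -
      have "fact (N + 1) = pochhammer (1 :: real) ((N - m + 1) + m)" using assms by (simp add: pochhammer_fact)
      also have "\<dots> = fact (N - m + 1) * pochhammer (1 + real (N - m + 1)) m"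
        unfolding pochhammer_product' pochhammer_fact ..
      also have "1 + real (N - m + 1) = real N + 2 - real m" using assms by (simp add: of_nat_diff)
      also have "fact (N - m + 1) = (real N + 1 - real m) * fact (N - m)" using assms by (simp add: of_nat_diff algebra_simps)
      finally show ?thesis by simp
    qed
    moreover have "fact (N + 1) = (real N + 1) * (fact N :: real)" by (simp add: algebra_simps)
    moreover have "real N + 1 - real m > 0" using assms by simp
    ultimately show ?thesis unfolding weight_coeff_def by (simp add: field_simps)
  qed
  finally show ?thesis by (simp add: mult_2)
qed

text \<open>
For \<open>n = M - 1\<close> the Pochhammer symbol \<open>(-1)\<^sub>m\<^sub>-\<^sub>t\<close> leaves only the terms \<open>t = m\<close> and
\<open>t = m - 1\<close>.
\<close>

lemma cheb_sum_second_last_row: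
  assumes "m < M"
  shows "cheb_sum M m (M - 1) x = (real M + 1) ^ 2 / (real M * (real M + 1 - real m)) * cheb_U (M - 1 - m) x
    + (real M + 1) * real m / (real M * (real M + 1 - real m) * (real M + 2 - real m)) * cheb_U (M + 1 - m) x"
proof -
  have f: "pochhammer (real M + 2 - real m) m * fact (M - m) * (real M + 1 - real m) = fact (M + 1)"
  proof -
    have "fact (M + 1) = pochhammer (1 :: real) ((M - m + 1) + m)" using assms by (simp add: pochhammer_fact)
    also have "\<dots> = fact (M - m + 1) * pochhammer (1 + real (M - m + 1)) m"
      unfolding pochhammer_product' pochhammer_fact ..
    also have "1 + real (M - m + 1) = real M + 2 - real m" using assms by (simp add: of_nat_diff)
    also have "fact (M - m + 1) = (real M + 1 - real m) * fact (M - m)" using assms by (simp add: of_nat_diff algebra_simps)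
    finally show ?thesis by simp
  qed
  have F: "fact (M + 1) = (real M + 1) * (fact M :: real)" by (simp add: algebra_simps)
  have M: "real M > real m" using assms by simp
  have M1: "real (M - 1) + 1 = real M" using assms by (simp add: of_nat_diff)
  have c0: "weight_coeff M m m (M - 1) = (real M + 1) ^ 2 / (real M * (real M + 1 - real m))"
  proof -
    have "fact (M - m) * pochhammer (real M + 2 - real m) m / fact M = (real M + 1) / (real M + 1 - real m)"
      using f F M by (simp add: frac_eq_eq mult_ac)
    moreover have "weight_coeff M m m (M - 1) =
      (real M + 1) / real M * (fact (M - m) * pochhammer (real M + 2 - real m) m / fact M)"
      unfolding weight_coeff_def M1 by simp
    ultimately show ?thesis by (simp add: power2_eq_square)
  qed
  show ?thesis
  proof (cases m)
    case 0
    then show ?thesis using c0 assms by (simp add: cheb_sum_def)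
  next
    case (Suc q)
    have "cheb_sum M m (M - 1) x = weight_coeff M m m (M - 1) * cheb_U (M - 1 + m - 2 * m) x
      + weight_coeff M q m (M - 1) * cheb_U (M - 1 + m - 2 * q) x
      + (\<Sum>t<q. weight_coeff M t m (M - 1) * cheb_U (M - 1 + m - 2 * t) x)"
      unfolding cheb_sum_def Suc lessThan_Suc_atMost[symmetric] by simp
    also have "(\<Sum>t<q. weight_coeff M t m (M - 1) * cheb_U (M - 1 + m - 2 * t) x) = 0"
    proof (intro sum.neutral ballI)
      fix t assume t: "t \<in> {..<q}"
      have "real (M - 1) - real M = - real 1" using assms by (simp add: of_nat_diff)
      then have "pochhammer (real (M - 1) - real M) (m - t) = 0"
        using t Suc by (simp only: pochhammer_of_nat_eq_0_iff) simp
      then show "weight_coeff M t m (M - 1) * cheb_U (M - 1 + m - 2 * t) x = 0"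
        by (simp add: weight_coeff_def)
    qed
    also have "weight_coeff M q m (M - 1) = (real M + 1) * real m / (real M * (real M + 1 - real m) * (real M + 2 - real m))"
    proof -
      have "pochhammer (real M + 2 - real m) (Suc q) = (real M + 2 - real m) * pochhammer (real M + 2 - real q) q"
        using Suc by (intro pochhammer_rec_shift) simp
      then have f': "(real M + 2 - real m) * pochhammer (real M + 2 - real q) q * fact (M - m) * (real M + 1 - real m) = (real M + 1) * fact M"
        using f F Suc by simp
      have d: "m - q = 1" using Suc by simp
      have e: "real (M - 1) - real M = - 1" "real (M - 1) + 2 = real M + 1" using assms by (simp_all add: of_nat_diff)
      have fm: "fact m = real m * fact q" unfolding Suc by simp
      have "real M + 2 - real m > 0" "real M + 1 - real m > 0" "real M > 0" using M by simp_all
      then have "weight_coeff M q m (M - 1) = (real M + 1) / real M * (fact (M - m) * (real m * fact q) / fact M) *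
        (1 / (real M + 1)) * (pochhammer (real M + 2 - real q) q / fact q)"
        unfolding weight_coeff_def M1 d e fm by simp
      also have "\<dots> = real m / real M * ((real M + 2 - real m) * pochhammer (real M + 2 - real q) q * fact (M - m) * (real M + 1 - real m)) / (fact M * (real M + 1 - real m) * (real M + 2 - real m))"
        using M by simp
      also have "\<dots> = (real M + 1) * real m / (real M * (real M + 1 - real m) * (real M + 2 - real m))"
        unfolding f' by (simp add: mult_ac)
      finally show ?thesis .
    qed
    also have "M - 1 + m - 2 * m = M - 1 - m" by simp
    also have "M - 1 + m - 2 * q = M + 1 - m" using Suc assms by simp
    finally show ?thesis unfolding c0 by simp
  qed
qed

text \<open>
The decomposition \<open>W = \<surd>(1 - x\<^sup>2) L T L\<^sup>t\<close>, by induction on the size. Entries with \<open>m, n\<close> below the new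
size follow by applying the recurrence to the smaller index, which keeps \<open>m \<le> n\<close>. In the new last
row the recurrence is applied to the index \<open>N\<close> itself, so that only entries of the previous size
occur. The corner is \<open>wpoly_corner\<close>.
\<close>

theorem wpoly_eq_cheb_sum:
  assumes "m \<le> n" "n \<le> N"
  shows "poly (wpoly N m n :: real poly) x = cheb_sum N m n x"
  using assms
proof (induction N arbitrary: m n)
  case 0
  then show ?case by (simp add: wpoly_0_left cheb_sum_def weight_coeff_def)
next
  case (Suc M)
  have M0: "real M + 1 \<noteq> 0" by linarith
  let ?w = "\<lambda>N m n. poly (wpoly N m n :: real poly) x"
  have rec: "(real M + 1) ^ 2 * ?w (Suc M) (Suc p) i =
    ((real M + 1) * (real M + 2) - (real p + 1) * (real p + 2)) * ?w M (Suc p) i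
    - real p * (real p + 1) * ?w M (p - 1) i + (real p + 1) ^ 2 * (2 * x * ?w M p i)"
    if "Suc p \<le> M \<or> i \<le> M" for p i
    using arg_cong[OF wpoly_recurrence[OF that, where ?'a = real], of "\<lambda>q. poly q x"]
    unfolding poly_add poly_diff poly_smult poly_mult by simp
  show ?case
  proof (cases "n = Suc M")
    case False
    then have n: "n \<le> M" using Suc.prems by simp
    show ?thesis
    proof (cases m)
      case 0
      have "poly (wpoly (Suc M) 0 n :: real poly) x = (real M + 2) / (real n + 1) * cheb_U n x"
        unfolding wpoly_0_left cheb_U_eq_poly_geg by simp
      then show ?thesis unfolding 0 by (simp add: cheb_sum_def weight_coeff_def)
    next
      case (Suc p)
      have p: "Suc p \<le> n" using Suc.prems Suc by simp
      have "real p * (real p + 1) * ?w M (p - 1) n = real p * (real p + 1) * cheb_sum M (p - 1) n x"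
        using p n by (simp add: Suc.IH)
      moreover have "?w M (Suc p) n = cheb_sum M (Suc p) n x" "?w M p n = cheb_sum M p n x"
        using p n by (simp_all add: Suc.IH)
      ultimately have "(real M + 1) ^ 2 * ?w (Suc M) (Suc p) n = (real M + 1) ^ 2 * cheb_sum (Suc M) (Suc p) n x"
        unfolding cheb_sum_recurrence[OF p n] using rec[of p n] p n by simp
      then show ?thesis using M0 unfolding Suc by simp
    qed
  next
    case True
    show ?thesis
    proof (cases "m = Suc M")
      case m: True
      show ?thesis unfolding True m wpoly_corner by (subst cheb_sum_last_row) simp_all
    next
      case False
      then have m: "m \<le> M" using Suc.prems True by simp
      have "(real M + 1) ^ 2 * ?w (Suc M) (Suc M) m =
         - real M * (real M + 1) * ?w M (M - 1) m + (real M + 1) ^ 2 * (2 * x * ?w M M m)"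
        using rec[of M m] m by simp
      also have "?w M M m = (real M + 1) / (real M + 1 - real m) * cheb_U (M - m) x"
        using Suc.IH[of m M] m cheb_sum_last_row[OF m] by (simp add: wpoly_commute)
      also have "- real M * (real M + 1) * ?w M (M - 1) m + (real M + 1) ^ 2 * (2 * x * ((real M + 1) / (real M + 1 - real m) * cheb_U (M - m) x))
        = (real M + 1) ^ 2 * ((real M + 2) / (real M + 2 - real m) * cheb_U (Suc M - m) x)"
      proof (cases "m = M")
        case mM: True
        show ?thesis
        proof (cases M)
          case 0
          then show ?thesis using mM by simp
        next
          case (Suc K)
          have "?w M (M - 1) M = (real M + 1) / 2 * (2 * x)"
            using Suc.IH[of "M - 1" M] cheb_sum_last_row[of "M - 1" M x] Suc by simp
          then show ?thesis unfolding mM by (simp add: field_simps power2_eq_square)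
        qed
      next
        case False
        then have mM: "m < M" using m by simp
        have 1: "?w M (M - 1) m = cheb_sum M m (M - 1) x"
          using Suc.IH[of m "M - 1"] mM by (simp add: wpoly_commute)
        have 2: "2 * x * cheb_U (M - m) x = cheb_U (Suc M - m) x + cheb_U (M - 1 - m) x"
          using cheb_U_times_2x[of "M - m" x] mM by (simp add: Suc_diff_le)
        define U V where "U = cheb_U (Suc M - m) x" and "V = cheb_U (M - 1 - m) x"
        have pos: "real M > 0" "real M + 1 - real m > 0" "real M + 2 - real m > 0" using mM by simp_all
        have split: "- r * a * (a ^ 2 / (r * b) * v + a * s / (r * b * c) * u) = - (a ^ 2 * (a / b) * v) - a ^ 2 * (s / (b * c)) * u"
          if "r > 0" for r a b c s u v :: real
          using that by (simp add: distrib_left power2_eq_square)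
        have "(real M + 1) ^ 2 * (2 * x * ((real M + 1) / (real M + 1 - real m) * cheb_U (M - m) x)) =
          (real M + 1) ^ 2 * ((real M + 1) / (real M + 1 - real m)) * (U + V)"
          unfolding U_def V_def 2[symmetric] by simp
        moreover have "- real M * (real M + 1) * ?w M (M - 1) m =
          - ((real M + 1) ^ 2 * ((real M + 1) / (real M + 1 - real m)) * V)
          - (real M + 1) ^ 2 * (real m / ((real M + 1 - real m) * (real M + 2 - real m))) * U"
          using split[OF pos(1)] unfolding 1 cheb_sum_second_last_row[OF mM] U_def V_def by simp
        moreover have "(real M + 1) / (real M + 1 - real m) - real m / ((real M + 1 - real m) * (real M + 2 - real m)) = (real M + 2) / (real M + 2 - real m)"
          using pos by (simp add: divide_simps) (simp add: algebra_simps)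
        moreover have "W + T = q * (\<gamma> * u)"
          if "T = q * \<alpha> * (u + v)" "W = - (q * \<alpha> * v) - q * \<beta> * u" "\<alpha> - \<beta> = \<gamma>"
          for T W q \<alpha> \<beta> \<gamma> u v :: real
          unfolding that(3)[symmetric] that(1,2) by (simp add: algebra_simps)
        ultimately show ?thesis unfolding U_def[symmetric] by blast
      qed
      finally have "?w (Suc M) (Suc M) m = (real M + 2) / (real M + 2 - real m) * cheb_U (Suc M - m) x"
        using mult_left_cancel[OF power_not_zero[OF M0, of 2]] by blast
      then show ?thesis unfolding True using cheb_sum_last_row[of m "Suc M" x] m
        by (simp add: wpoly_commute add_ac)
    qed
  qed
qed

section \<open>Racah polynomials: contiguous relations and sums\<close>

text \<open>
Up to the sign \<open>(-1)\<^sup>r\<close> this is the product of \<open>j (j + 1) - i (i + 1)\<close> over \<open>i < r\<close>, hence a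
basis of the polynomials in \<open>j (j + 1)\<close>. The Racah polynomial in question has simple coefficients
in it.
\<close>

definition racah_basis :: "nat \<Rightarrow> nat \<Rightarrow> 'a::field_char_0" where
  "racah_basis r j = pochhammer (- of_nat j) r * pochhammer (of_nat j + 1) r"

definition racah_coeff :: "nat \<Rightarrow> nat \<Rightarrow> nat \<Rightarrow> nat \<Rightarrow> 'a::field_char_0" where
  "racah_coeff N n k r = pochhammer (- of_nat k) r * pochhammer (- of_nat N - of_nat n - 1) r /
     (fact r ^ 2 * pochhammer (- of_nat n - of_nat k) r * pochhammer (- of_nat N) r)"

text \<open>
The terminating \<open>\<^sub>4F\<^sub>3\<close>, summed to \<open>k\<close> instead of \<open>j\<close>: the terms beyond the smaller of \<open>j\<close> and \<open>k\<close>
vanish, and this range makes it a polynomial of degree \<open>k\<close> in \<open>j (j + 1)\<close>.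
\<close>

definition racah :: "nat \<Rightarrow> nat \<Rightarrow> nat \<Rightarrow> nat \<Rightarrow> 'a::field_char_0" where
  "racah N n k j = (\<Sum>r\<le>k. racah_coeff N n k r * racah_basis r j)"

lemma pochhammer_neg_nat_nonzero: "s \<le> a \<Longrightarrow> pochhammer (- of_nat a :: 'a::field_char_0) s \<noteq> 0"
  by (simp add: pochhammer_of_nat_eq_0_iff)

lemma pochhammer_neg_nat_zero: "a < s \<Longrightarrow> pochhammer (- of_nat a :: 'a::field_char_0) s = 0"
  by (simp add: pochhammer_of_nat_eq_0_iff)

lemma racah_basis_zero: "j < r \<Longrightarrow> racah_basis r j = 0"
  by (simp add: racah_basis_def pochhammer_neg_nat_zero)

lemma racah_basis_Suc:
  "racah_basis (Suc r) j = (of_nat r * (of_nat r + 1) - of_nat j * (of_nat j + 1)) * (racah_basis r j :: 'a::field_char_0)"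
  unfolding racah_basis_def pochhammer_Suc by (simp add: algebra_simps)

lemma racah_basis_shift:
  "racah_basis r j * (of_nat j + 1 + of_nat r) = racah_basis r (Suc j) * (of_nat j + 1 - of_nat r :: 'a::field_char_0)"
proof -
  have "pochhammer (- of_nat (Suc j)) (Suc r) = - of_nat (Suc j) * pochhammer (- of_nat j :: 'a) r"
    by (simp add: pochhammer_rec)
  then have 1: "- (of_nat j + 1) * pochhammer (- of_nat j) r = pochhammer (- of_nat (Suc j)) r * (of_nat r - of_nat j - 1 :: 'a)"
    by (simp add: pochhammer_Suc algebra_simps)
  have "pochhammer (of_nat j + 1) (Suc r) = (of_nat j + 1) * pochhammer (of_nat (Suc j) + 1 :: 'a) r"
    by (simp add: pochhammer_rec add_ac)
  then have 2: "pochhammer (of_nat j + 1) r * (of_nat j + 1 + of_nat r) = (of_nat j + 1) * pochhammer (of_nat (Suc j) + 1 :: 'a) r"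
    by (simp add: pochhammer_Suc)
  have "racah_basis r j * (of_nat j + 1 + of_nat r) = pochhammer (- of_nat j) r * ((of_nat j + 1) * pochhammer (of_nat (Suc j) + 1 :: 'a) r)"
    unfolding racah_basis_def 2[symmetric] by (simp only: mult.assoc)
  also have "\<dots> = - (- (of_nat j + 1) * pochhammer (- of_nat j) r) * pochhammer (of_nat (Suc j) + 1 :: 'a) r"
    by (simp add: algebra_simps)
  also have "\<dots> = racah_basis r (Suc j) * (of_nat j + 1 - of_nat r)"
    unfolding 1 racah_basis_def by (simp add: algebra_simps)
  finally show ?thesis .
qed

text \<open>
The case \<open>s = n + k\<close>, possible only for \<open>n = 0\<close> and \<open>s = k\<close>, has a zero denominator. It is
harmless because the numerator vanishes as well.
\<close>

lemma racah_coeff_raise: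
  fixes n :: nat
  assumes "s \<le> k" "s < N" "k \<le> N"
  defines "A \<equiv> of_nat n + of_nat k :: 'a::field_char_0"
  shows "(of_nat N - of_nat k + of_nat n + 1) *
      (((A + 1) * (A + 2) - (of_nat s + 1) * (of_nat s + 2)) * racah_coeff N n k (Suc s) + racah_coeff N n k s) =
    (A + 1) * ((of_nat n + 1) * (of_nat N + of_nat n + 2) * racah_coeff N (Suc n) k (Suc s)
      + (of_nat k + 1) * (of_nat N - of_nat k) * (racah_coeff N n (Suc k) (Suc s) :: 'a))"
proof -
  define K M n' S :: 'a where "K = of_nat k" and "M = of_nat N" and "n' = of_nat n" and "S = of_nat s"
  define X Y Z V where "X = pochhammer (- K) s" and "Y = pochhammer (- M - n' - 1) s"
    and "Z = pochhammer (- n' - K) s" and "V = pochhammer (- M) s"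
  have A: "A = n' + K" by (simp add: A_def n'_def K_def)
  have SN: "S - M \<noteq> 0" using assms by (simp add: S_def M_def)
  have S1: "S + 1 \<noteq> 0" using of_nat_neq_0[of s, where ?'a = 'a] by (simp add: S_def add_ac)
  have A1: "n' + K + 1 \<noteq> 0" using of_nat_neq_0[of "n + k", where ?'a = 'a] by (simp add: n'_def K_def add_ac)
  have F: "fact (Suc s) = (S + 1) * fact s" by (simp add: S_def add.commute)
  have p: "pochhammer (- K) (Suc s) = X * (S - K)" "pochhammer (- M - n' - 1) (Suc s) = Y * (S - M - n' - 1)"
    "pochhammer (- n' - K) (Suc s) = Z * (S - n' - K)" "pochhammer (- M) (Suc s) = V * (S - M)"
    by (simp_all add: X_def Y_def Z_def V_def S_def pochhammer_Suc add_ac)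
  have q1: "pochhammer (- (K + 1)) (Suc s) = - (K + 1) * X"
    unfolding pochhammer_rec by (simp add: X_def)
  have q2: "pochhammer (- M - (n' + 1) - 1) (Suc s) = - (M + n' + 2) * Y"
  proof -
    have a: "- M - (n' + 1) - 1 + 1 = - M - n' - 1" and b: "- M - (n' + 1) - 1 = - (M + n' + 2)" by simp_all
    show ?thesis unfolding pochhammer_rec a unfolding b Y_def ..
  qed
  have q3: "pochhammer (- (n' + 1) - K) (Suc s) = - (n' + K + 1) * Z" "pochhammer (- n' - (K + 1)) (Suc s) = - (n' + K + 1) * Z"
  proof -
    have a: "- (n' + 1) - K + 1 = - n' - K" "- n' - (K + 1) + 1 = - n' - K"
      and b: "- (n' + 1) - K = - (n' + K + 1)" "- n' - (K + 1) = - (n' + K + 1)" by simp_all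
    show "pochhammer (- (n' + 1) - K) (Suc s) = - (n' + K + 1) * Z"
      unfolding pochhammer_rec a unfolding b Z_def ..
    show "pochhammer (- n' - (K + 1)) (Suc s) = - (n' + K + 1) * Z"
      unfolding pochhammer_rec a unfolding b Z_def ..
  qed
  define B where "B = X * Y / ((S + 1) ^ 2 * fact s ^ 2 * Z * V * (S - M))"
  have c0: "racah_coeff N n k s = (S + 1) ^ 2 * (S - M) * B"
    unfolding racah_coeff_def K_def[symmetric] M_def[symmetric] n'_def[symmetric] X_def[symmetric] Y_def[symmetric] Z_def[symmetric] V_def[symmetric] B_def
    using S1 SN by simp
  have c1: "(A - S) * racah_coeff N n k (Suc s) = - (S - K) * (S - M - n' - 1) * B"
  proof (cases "S - n' - K = 0")
    case True
    then have "of_nat s = (of_nat (n + k) :: 'a)" unfolding S_def n'_def K_def by (simp add: algebra_simps)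
    then have "s = n + k" unfolding of_nat_eq_iff .
    then have "S - K = 0" using assms by (simp add: S_def K_def)
    then show ?thesis unfolding racah_coeff_def K_def[symmetric] M_def[symmetric] n'_def[symmetric] p by simp
  next
    case False
    have e: "A - S = - (S - n' - K)" by (simp add: A)
    have "(- g) * ((X * a) * (Y * b) / ((s1 * f) ^ 2 * (Z * g) * (V * h))) = - a * b * (X * Y / (s1 ^ 2 * f ^ 2 * Z * V * h))"
      if "g \<noteq> 0" for g a b s1 f h :: 'a
      using that by (simp add: power_mult_distrib mult_ac)
    from this[OF False] show ?thesis
      unfolding e racah_coeff_def K_def[symmetric] M_def[symmetric] n'_def[symmetric] p F B_def .
  qed
  have c2: "(A + 1) * racah_coeff N (Suc n) k (Suc s) = (S - K) * (M + n' + 2) * B"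
  proof -
    have e: "A + 1 = n' + K + 1" by (simp add: A)
    have "g * ((X * a) * (- b * Y) / ((s1 * f) ^ 2 * (- g * Z) * (V * h))) = a * b * (X * Y / (s1 ^ 2 * f ^ 2 * Z * V * h))"
      if "g \<noteq> 0" for g a b s1 f h :: 'a
      using that by (simp add: power_mult_distrib mult_ac)
    moreover have "of_nat (Suc n) = n' + 1" by (simp add: n'_def)
    ultimately show ?thesis using A1
      unfolding e racah_coeff_def K_def[symmetric] M_def[symmetric] by (simp only: p q2 q3 F B_def)
  qed
  have c3: "(A + 1) * racah_coeff N n (Suc k) (Suc s) = (K + 1) * (S - M - n' - 1) * B"
  proof -
    have e: "A + 1 = n' + K + 1" by (simp add: A)
    have "g * ((- a * X) * (Y * b) / ((s1 * f) ^ 2 * (- g * Z) * (V * h))) = a * b * (X * Y / (s1 ^ 2 * f ^ 2 * Z * V * h))"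
      if "g \<noteq> 0" for g a b s1 f h :: 'a
      using that by (simp add: power_mult_distrib mult_ac)
    moreover have "of_nat (Suc k) = K + 1" by (simp add: K_def)
    ultimately show ?thesis using A1
      unfolding e racah_coeff_def n'_def[symmetric] M_def[symmetric] by (simp only: p q1 q3 F B_def)
  qed
  have fac: "(A + 1) * (A + 2) - (S + 1) * (S + 2) = (A + S + 3) * (A - S)" by (simp add: algebra_simps)
  have "(M - K + n' + 1) * (((A + 1) * (A + 2) - (S + 1) * (S + 2)) * racah_coeff N n k (Suc s) + racah_coeff N n k s) =
     (M - K + n' + 1) * (- (A + S + 3) * (S - K) * (S - M - n' - 1) + (S + 1) ^ 2 * (S - M)) * B"
    unfolding fac mult.assoc[of "A + S + 3"] c1 c0 by (simp add: algebra_simps)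
  also have "(M - K + n' + 1) * (- (A + S + 3) * (S - K) * (S - M - n' - 1) + (S + 1) ^ 2 * (S - M)) =
     (n' + 1) * (M + n' + 2) ^ 2 * (S - K) + (K + 1) ^ 2 * (M - K) * (S - M - n' - 1)"
    unfolding A by (simp add: algebra_simps power2_eq_square)
  also have "\<dots> * B = (n' + 1) * (M + n' + 2) * ((A + 1) * racah_coeff N (Suc n) k (Suc s))
      + (K + 1) * (M - K) * ((A + 1) * racah_coeff N n (Suc k) (Suc s))"
    unfolding c2 c3 by (simp add: algebra_simps power2_eq_square)
  also have "\<dots> = (A + 1) * ((n' + 1) * (M + n' + 2) * racah_coeff N (Suc n) k (Suc s)
      + (K + 1) * (M - K) * racah_coeff N n (Suc k) (Suc s))"
    by (simp only: distrib_left mult_ac)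
  finally show ?thesis unfolding K_def M_def n'_def S_def .
qed

lemma racah_coeff_zero: "k < r \<Longrightarrow> racah_coeff N n k r = 0"
  by (simp add: racah_coeff_def pochhammer_neg_nat_zero)

lemma racah_eq_sum: "k \<le> K \<Longrightarrow> racah N n k j = (\<Sum>r\<le>K. racah_coeff N n k r * racah_basis r j)"
  unfolding racah_def by (intro sum.mono_neutral_left) (auto simp: racah_coeff_zero)

text \<open>
Multiplication by \<open>(A + 1)(A + 2) - j (j + 1)\<close> raises \<open>A\<close>. By \<open>racah_basis_Suc\<close> it acts on the
basis with two terms, so the identity can be compared coefficientwise. For \<open>k = N\<close> the top coefficient
does not match, but its basis element vanishes at all \<open>j \<le> N\<close>.
\<close>

lemma racah_raise:
  fixes n :: nat
  assumes "k \<le> N" "j \<le> N"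
  defines "A \<equiv> of_nat n + of_nat k :: 'a::field_char_0"
  shows "(of_nat N - of_nat k + of_nat n + 1) * (((A + 1) * (A + 2) - of_nat j * (of_nat j + 1)) * racah N n k j) =
    (A + 1) * ((of_nat n + 1) * (of_nat N + of_nat n + 2) * racah N (Suc n) k j
      + (of_nat k + 1) * (of_nat N - of_nat k) * (racah N n (Suc k) j :: 'a))"
proof -
  let ?c = "\<lambda>r. racah_coeff N n k r :: 'a" and ?b = "\<lambda>r. racah_basis r j :: 'a"
  define D :: 'a where "D = of_nat N - of_nat k + of_nat n + 1"
  define a b :: 'a where "a = (of_nat n + 1) * (of_nat N + of_nat n + 2)" and "b = (of_nat k + 1) * (of_nat N - of_nat k)"
  define lam :: 'a where "lam = of_nat j * (of_nat j + 1)"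
  have l: "lam * ?b r = of_nat r * (of_nat r + 1) * ?b r - ?b (Suc r)" for r
    unfolding racah_basis_Suc lam_def by (simp add: algebra_simps)
  have "((A + 1) * (A + 2) - lam) * racah N n k j = (\<Sum>r\<le>k. ?c r * (((A + 1) * (A + 2)) * ?b r - lam * ?b r))"
    unfolding racah_def sum_distrib_left by (intro sum.cong refl) (simp add: algebra_simps)
  also have "\<dots> = (\<Sum>r\<le>k. ((A + 1) * (A + 2) - of_nat r * (of_nat r + 1)) * ?c r * ?b r) + (\<Sum>r\<le>k. ?c r * ?b (Suc r))"
    unfolding l sum.distrib[symmetric] by (intro sum.cong refl) (simp add: algebra_simps)
  also have "(\<Sum>r\<le>k. ((A + 1) * (A + 2) - of_nat r * (of_nat r + 1)) * ?c r * ?b r) =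
      (\<Sum>r\<le>Suc k. ((A + 1) * (A + 2) - of_nat r * (of_nat r + 1)) * ?c r * ?b r)"
    by (simp add: racah_coeff_zero)
  also have "\<dots> = (A + 1) * (A + 2) + (\<Sum>s\<le>k. ((A + 1) * (A + 2) - (of_nat s + 1) * (of_nat s + 2)) * ?c (Suc s) * ?b (Suc s))"
    by (subst sum.atMost_Suc_shift) (simp add: racah_coeff_def racah_basis_def add_ac)
  finally have L: "((A + 1) * (A + 2) - lam) * racah N n k j = (A + 1) * (A + 2) +
     (\<Sum>s\<le>k. (((A + 1) * (A + 2) - (of_nat s + 1) * (of_nat s + 2)) * ?c (Suc s) + ?c s) * ?b (Suc s))"
    by (simp add: sum.distrib distrib_right)
  have R1: "racah N (Suc n) k j = 1 + (\<Sum>s\<le>k. racah_coeff N (Suc n) k (Suc s) * ?b (Suc s))"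
    unfolding racah_eq_sum[of k "Suc k", OF le_SucI[OF order_refl]]
    by (subst sum.atMost_Suc_shift) (simp add: racah_coeff_def racah_basis_def)
  have R2: "racah N n (Suc k) j = 1 + (\<Sum>s\<le>k. racah_coeff N n (Suc k) (Suc s) * ?b (Suc s))"
    unfolding racah_def
    by (subst sum.atMost_Suc_shift) (simp add: racah_coeff_def racah_basis_def)
  have "D * (((A + 1) * (A + 2) - (of_nat s + 1) * (of_nat s + 2)) * ?c (Suc s) + ?c s) * ?b (Suc s) =
     (A + 1) * (a * racah_coeff N (Suc n) k (Suc s) + b * racah_coeff N n (Suc k) (Suc s)) * ?b (Suc s)" if "s \<le> k" for s
  proof (cases "s < N")
    case True
    show ?thesis using racah_coeff_raise[OF that True assms(1), of n, where ?'a = 'a]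
      unfolding D_def a_def b_def A_def by simp
  next
    case False
    then have "j < Suc s" using assms that by simp
    then show ?thesis by (simp add: racah_basis_zero)
  qed
  then have "D * (\<Sum>s\<le>k. (((A + 1) * (A + 2) - (of_nat s + 1) * (of_nat s + 2)) * ?c (Suc s) + ?c s) * ?b (Suc s)) =
     (\<Sum>s\<le>k. (A + 1) * (a * racah_coeff N (Suc n) k (Suc s) + b * racah_coeff N n (Suc k) (Suc s)) * ?b (Suc s))"
    unfolding sum_distrib_left by (intro sum.cong refl) (simp only: mult.assoc atMost_iff)
  also have "\<dots> = (A + 1) * (a * (\<Sum>s\<le>k. racah_coeff N (Suc n) k (Suc s) * ?b (Suc s))
      + b * (\<Sum>s\<le>k. racah_coeff N n (Suc k) (Suc s) * ?b (Suc s)))"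
    unfolding sum_distrib_left sum.distrib[symmetric] by (intro sum.cong refl) (simp only: distrib_left distrib_right mult.assoc)
  finally have M: "D * (\<Sum>s\<le>k. (((A + 1) * (A + 2) - (of_nat s + 1) * (of_nat s + 2)) * ?c (Suc s) + ?c s) * ?b (Suc s)) = \<dots>" .
  have C: "D * (A + 2) = a + b"
    unfolding D_def a_def b_def A_def by (simp add: algebra_simps)
  have "D * (((A + 1) * (A + 2) - lam) * racah N n k j) = (A + 1) * (D * (A + 2)) +
     (A + 1) * (a * (\<Sum>s\<le>k. racah_coeff N (Suc n) k (Suc s) * ?b (Suc s))
      + b * (\<Sum>s\<le>k. racah_coeff N n (Suc k) (Suc s) * ?b (Suc s)))"
    unfolding L distrib_left[of D "(A + 1) * (A + 2)"] M by (simp add: mult.left_commute)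
  also have "\<dots> = (A + 1) * (a * racah N (Suc n) k j + b * racah N n (Suc k) j)"
    unfolding C R1 R2 by (simp add: algebra_simps)
  finally show ?thesis unfolding D_def a_def b_def lam_def .
qed

lemma racah_coeff_lower:
  assumes "s < k" "Suc s < n + k" "k \<le> N"
  shows "(of_nat n + of_nat k) * (of_nat N - of_nat k + of_nat n + 1) * racah_coeff N n k (Suc s) =
    of_nat k * (of_nat N - of_nat k + 1) * racah_coeff N n (k - 1) (Suc s)
    + of_nat n * (of_nat N + of_nat n + 1) * (racah_coeff N (n - 1) k (Suc s) :: 'a::field_char_0)"
proof -
  define K M n' S :: 'a where "K = of_nat k" and "M = of_nat N" and "n' = of_nat n" and "S = of_nat s"
  define X Y Z V where "X = pochhammer (1 - K) s" and "Y = pochhammer (- M - n') s"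
    and "Z = pochhammer (1 - n' - K) s" and "V = pochhammer (- M) (Suc s)"
  have A0: "n' + K \<noteq> 0" using assms unfolding n'_def K_def of_nat_add[symmetric] of_nat_eq_0_iff by simp
  have SA: "S + 1 - n' - K \<noteq> 0"
  proof
    assume "S + 1 - n' - K = 0"
    then have "of_nat (Suc s) = (of_nat (n + k) :: 'a)" unfolding S_def n'_def K_def by (simp add: algebra_simps)
    then show False using assms unfolding of_nat_eq_iff by simp
  qed
  have p: "pochhammer (- K) (Suc s) = - K * X" "pochhammer (- M - n' - 1) (Suc s) = - (M + n' + 1) * Y"
    "pochhammer (- n' - K) (Suc s) = - (n' + K) * Z"
    unfolding pochhammer_rec by (simp_all add: X_def Y_def Z_def algebra_simps)
  have q: "pochhammer (1 - K) (Suc s) = X * (S + 1 - K)" "pochhammer (- M - n') (Suc s) = Y * (S - M - n')"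
    "pochhammer (1 - n' - K) (Suc s) = Z * (S + 1 - n' - K)"
    by (simp_all add: X_def Y_def Z_def S_def pochhammer_Suc algebra_simps)
  define B where "B = X * Y / (fact (Suc s) ^ 2 * Z * V * (S + 1 - n' - K))"
  have c0: "(n' + K) * racah_coeff N n k (Suc s) = - K * (M + n' + 1) * (S + 1 - n' - K) * B"
  proof -
    have "a * ((- c * X) * (- d * Y) / (f * (- a * Z) * V)) = - c * d * g * (X * Y / (f * Z * V * g))"
      if "a \<noteq> 0" "g \<noteq> 0" for a c d f g :: 'a
      using that by (simp add: mult_ac)
    from this[OF A0 SA] show ?thesis
      unfolding racah_coeff_def K_def[symmetric] M_def[symmetric] n'_def[symmetric] p V_def[symmetric] B_def .
  qed
  have c1: "racah_coeff N n (k - 1) (Suc s) = - (S + 1 - K) * (M + n' + 1) * B"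
  proof -
    have "of_nat (k - 1) = K - 1" using assms by (simp add: K_def of_nat_diff)
    moreover have "- (K - 1) = 1 - K" "- n' - (K - 1) = 1 - n' - K" by simp_all
    moreover have "(X * c) * (- d * Y) / (f * (Z * g) * V) = - c * d * (X * Y / (f * Z * V * g))"
      for c d f g :: 'a by (simp add: mult_ac)
    ultimately show ?thesis
      unfolding racah_coeff_def M_def[symmetric] n'_def[symmetric] by (simp only: p(2) q V_def[symmetric] B_def)
  qed
  have c2: "n' * racah_coeff N (n - 1) k (Suc s) = n' * (- K * (S - M - n') * B)"
  proof (cases n)
    case 0
    then show ?thesis by (simp add: n'_def)
  next
    case (Suc l)
    then have "of_nat (n - 1) = n' - 1" by (simp add: n'_def)
    moreover have "- M - (n' - 1) - 1 = - M - n'" "- (n' - 1) - K = 1 - n' - K" by simp_all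
    moreover have "(- c * X) * (Y * d) / (f * (Z * g) * V) = - c * d * (X * Y / (f * Z * V * g))"
      for c d f g :: 'a by (simp add: mult_ac)
    ultimately have "racah_coeff N (n - 1) k (Suc s) = - K * (S - M - n') * B"
      unfolding racah_coeff_def M_def[symmetric] K_def[symmetric] by (simp only: p(1) q(2,3) V_def[symmetric] B_def)
    then show ?thesis by simp
  qed
  have "(n' + K) * (M - K + n' + 1) * racah_coeff N n k (Suc s) = (M - K + n' + 1) * ((n' + K) * racah_coeff N n k (Suc s))"
    by simp
  also have "\<dots> = (M - K + n' + 1) * (- K * (M + n' + 1) * (S + 1 - n' - K)) * B" unfolding c0 by simp
  also have "(M - K + n' + 1) * (- K * (M + n' + 1) * (S + 1 - n' - K)) =
     K * (M - K + 1) * (- (S + 1 - K) * (M + n' + 1)) + n' * (M + n' + 1) * (- K * (S - M - n'))"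
    by (simp add: algebra_simps)
  also have "\<dots> * B = K * (M - K + 1) * racah_coeff N n (k - 1) (Suc s) + (M + n' + 1) * (n' * racah_coeff N (n - 1) k (Suc s))"
    unfolding c1 c2 by (simp add: algebra_simps)
  finally show ?thesis unfolding K_def M_def n'_def by (simp add: mult_ac)
qed

text \<open>
The companion relation, again coefficientwise. At the coefficient \<open>r = n + k\<close> it fails, but there
the basis element vanishes since \<open>j < n + k\<close>.
\<close>

lemma racah_lower:
  assumes "k \<le> N" "j < n + k"
  shows "(of_nat n + of_nat k) * (of_nat N - of_nat k + of_nat n + 1) * racah N n k j =
    of_nat k * (of_nat N - of_nat k + 1) * racah N n (k - 1) j
    + of_nat n * (of_nat N + of_nat n + 1) * (racah N (n - 1) k j :: 'a::field_char_0)"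
proof -
  let ?b = "\<lambda>r. racah_basis r j :: 'a"
  have t: "(of_nat n + of_nat k) * (of_nat N - of_nat k + of_nat n + 1) * (racah_coeff N n k r * ?b r) =
    of_nat k * (of_nat N - of_nat k + 1) * (racah_coeff N n (k - 1) r * ?b r)
    + of_nat n * (of_nat N + of_nat n + 1) * (racah_coeff N (n - 1) k r * ?b r)" if "r \<le> k" for r
  proof (cases r)
    case 0
    have "racah_coeff N n k 0 = (1::'a)" "racah_coeff N n (k - 1) 0 = (1::'a)" "racah_coeff N (n - 1) k 0 = (1::'a)"
      by (simp_all add: racah_coeff_def)
    then show ?thesis unfolding 0 by (simp add: algebra_simps)
  next
    case (Suc s)
    show ?thesis
    proof (cases "r < n + k")
      case True
      then show ?thesis using racah_coeff_lower[of s k n N, where ?'a = 'a] assms that unfolding Suc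
        by (simp only: mult.assoc[symmetric] distrib_right[symmetric] Suc_le_eq)
    next
      case False
      then show ?thesis using assms by (simp add: racah_basis_zero)
    qed
  qed
  have "racah N n (k - 1) j = (\<Sum>r\<le>k. racah_coeff N n (k - 1) r * ?b r)"
    by (rule racah_eq_sum) simp
  then show ?thesis unfolding racah_def[of N n k] racah_def[of N "n - 1" k]
    by (simp only: sum_distrib_left sum.distrib[symmetric]) (intro sum.cong refl, use t in simp)
qed

text \<open>
The partial sums have a closed product form; for a positive integer \<open>a \<le> m\<close> the product is zero.
\<close>

lemma sum_pochhammer_telescope:
  "(\<Sum>r\<le>m. pochhammer (- a) r * pochhammer a r / fact r ^ 2) =
     pochhammer (1 - a) m * pochhammer (1 + a) m / (fact m ^ 2 :: 'a::field_char_0)"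
proof (induction m)
  case (Suc m)
  have "pochhammer (- a) (Suc m) = - a * pochhammer (1 - a) m" "pochhammer a (Suc m) = a * pochhammer (1 + a) m"
    by (simp_all add: pochhammer_rec add.commute)
  moreover have "fact (Suc m) = (of_nat m + 1) * (fact m :: 'a)" by (simp add: add.commute)
  moreover have "of_nat m + 1 \<noteq> (0::'a)" using of_nat_neq_0[of m, where ?'a = 'a] by (simp add: add_ac)
  moreover have "P * Q / f ^ 2 + (- a * P) * (a * Q) / (m1 * f) ^ 2 = (P * (m1 - a)) * (Q * (m1 + a)) / (m1 * f) ^ 2"
    if "m1 \<noteq> 0" "f \<noteq> 0" for P Q f m1 :: 'a
    using that by (simp add: divide_simps power2_eq_square) (simp add: algebra_simps)
  moreover have "pochhammer (1 - a) (Suc m) = pochhammer (1 - a) m * (of_nat m + 1 - a)"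
     "pochhammer (1 + a) (Suc m) = pochhammer (1 + a) m * (of_nat m + 1 + a)"
    by (simp_all add: pochhammer_Suc algebra_simps)
  ultimately show ?case unfolding sum.atMost_Suc Suc.IH
    by (simp only: fact_nonzero not_False_eq_True)
qed simp

text \<open>
A special Saalschuetz sum, by induction on \<open>j\<close>. In the combination of two consecutive sums that has
to vanish, the denominator \<open>N + 1 - r\<close> cancels and \<open>sum_pochhammer_telescope\<close> applies.
\<close>

lemma racah_saalschuetz:
  assumes "j \<le> N"
  shows "pochhammer (- of_nat N) j * (\<Sum>r\<le>N. (of_nat N + 1) / (of_nat N + 1 - of_nat r) * racah_basis r j / fact r ^ 2) =
    pochhammer (of_nat N + 2 :: 'a::field_char_0) j"
  using assms
proof (induction j)
  case 0
  have "(\<Sum>r\<le>N. (of_nat N + 1) / (of_nat N + 1 - of_nat r) * racah_basis r 0 / fact r ^ 2) =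
    (\<Sum>r\<in>{0}. (of_nat N + 1) / (of_nat N + 1 - of_nat r) * racah_basis r 0 / (fact r ^ 2 :: 'a))"
    by (intro sum.mono_neutral_right) (auto simp: racah_basis_zero)
  also have "\<dots> = 1" using of_nat_neq_0[of N, where ?'a = 'a] by (simp add: racah_basis_def add_ac)
  finally show ?case by simp
next
  case (Suc j)
  define M J :: 'a where "M = of_nat N" and "J = of_nat j"
  let ?S = "\<lambda>j. \<Sum>r\<le>N. (M + 1) / (M + 1 - of_nat r) * racah_basis r j / (fact r ^ 2 :: 'a)"
  have "(M - J) * ?S (Suc j) + (M + 2 + J) * ?S j =
     (\<Sum>r\<le>N. 2 * (M + 1) * (pochhammer (- (J + 1)) r * pochhammer (J + 1) r / fact r ^ 2))"
    unfolding sum_distrib_left sum.distrib[symmetric]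
  proof (intro sum.cong refl)
    fix r assume "r \<in> {..N}"
    then have r: "M + 1 - of_nat r \<noteq> 0"
      unfolding M_def using of_nat_neq_0[of "N - r", where ?'a = 'a] by (simp add: of_nat_diff algebra_simps)
    have J1: "J + 1 \<noteq> 0" using of_nat_neq_0[of j, where ?'a = 'a] by (simp add: J_def add_ac)
    define \<sigma> where "\<sigma> = pochhammer (- (J + 1)) r * pochhammer (J + 1) r"
    have 1: "(J + 1) * racah_basis r (Suc j) = \<sigma> * (J + 1 + of_nat r)"
    proof -
      have "(J + 1) * pochhammer (J + 2) r = pochhammer (J + 1) (Suc r)" by (simp add: pochhammer_rec add_ac)
      then have "(J + 1) * pochhammer (J + 2) r = pochhammer (J + 1) r * (J + 1 + of_nat r)" by (simp add: pochhammer_Suc)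
      moreover have "racah_basis r (Suc j) = pochhammer (- (J + 1)) r * pochhammer (J + 2) r"
        by (simp add: racah_basis_def J_def add_ac)
      moreover have "x * (p * q) = (p * q0) * y" if "x * q = q0 * y" for x p q q0 y :: 'a
        using that by (simp add: mult_ac)
      ultimately show ?thesis unfolding \<sigma>_def by simp
    qed
    have 2: "(J + 1) * racah_basis r j = \<sigma> * (J + 1 - of_nat r)"
    proof -
      have "- (J + 1) * pochhammer (- J) r = pochhammer (- (J + 1)) (Suc r)" by (simp add: pochhammer_rec)
      then have "- (J + 1) * pochhammer (- J) r = pochhammer (- (J + 1)) r * (- (J + 1) + of_nat r)" by (simp only: pochhammer_Suc)
      then have "(J + 1) * pochhammer (- J) r = pochhammer (- (J + 1)) r * (J + 1 - of_nat r)" by (simp add: algebra_simps)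
      moreover have "racah_basis r j = pochhammer (- J) r * pochhammer (J + 1) r"
        by (simp add: racah_basis_def J_def)
      moreover have "x * (p * q) = (p0 * q) * y" if "x * p = p0 * y" for x p q p0 y :: 'a
        using that by (simp add: mult.assoc[symmetric])
      ultimately show ?thesis unfolding \<sigma>_def by simp
    qed
    have "(J + 1) * ((M - J) * racah_basis r (Suc j) + (M + 2 + J) * racah_basis r j) =
       (M - J) * ((J + 1) * racah_basis r (Suc j)) + (M + 2 + J) * ((J + 1) * racah_basis r j)"
      by (simp add: algebra_simps)
    also have "\<dots> = (J + 1) * (2 * (M + 1 - of_nat r) * \<sigma>)" unfolding 1 2 by (simp add: algebra_simps)
    finally have step: "(M - J) * racah_basis r (Suc j) + (M + 2 + J) * racah_basis r j = 2 * (M + 1 - of_nat r) * \<sigma>"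
      using J1 by simp
    have comb: "u * (m / d * x / f) + v * (m / d * y / f) = m / d * (u * x + v * y) / f" for u v m d x y f :: 'a
      by (simp add: add_divide_distrib distrib_left mult_ac)
    have cancel: "m / d * (2 * d * s) / f = 2 * m * (s / f)" if "d \<noteq> 0" for m d s f :: 'a
      using that by simp
    show "(M - J) * ((M + 1) / (M + 1 - of_nat r) * racah_basis r (Suc j) / fact r ^ 2) +
       (M + 2 + J) * ((M + 1) / (M + 1 - of_nat r) * racah_basis r j / fact r ^ 2) =
       2 * (M + 1) * (pochhammer (- (J + 1)) r * pochhammer (J + 1) r / fact r ^ 2)"
      unfolding \<sigma>_def[symmetric] comb step by (rule cancel[OF r])
  qed
  also have "\<dots> = 2 * (M + 1) * (pochhammer (1 - (J + 1)) N * pochhammer (1 + (J + 1)) N / fact N ^ 2)"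
    unfolding sum_distrib_left[symmetric] sum_pochhammer_telescope ..
  also have "pochhammer (1 - (J + 1)) N = 0"
    using Suc.prems pochhammer_neg_nat_zero[of j N, where ?'a = 'a] by (simp add: J_def)
  finally have e: "(J - M) * ?S (Suc j) = (M + 2 + J) * ?S j" by (simp add: algebra_simps)
  have "pochhammer (- M) (Suc j) * ?S (Suc j) = pochhammer (- M) j * ((J - M) * ?S (Suc j))"
    by (simp add: pochhammer_Suc J_def mult_ac add.commute)
  also have "\<dots> = (pochhammer (- M) j * ?S j) * (M + 2 + J)" unfolding e by (simp only: mult_ac)
  also have "pochhammer (- M) j * ?S j = pochhammer (M + 2) j" using Suc by (simp add: M_def)
  also have "\<dots> * (M + 2 + J) = pochhammer (M + 2) (Suc j)" by (simp add: pochhammer_Suc J_def)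
  finally show ?case unfolding M_def .
qed

lemma racah_0:
  assumes "j \<le> k" "k \<le> N"
  shows "pochhammer (- of_nat N) j * racah N 0 k j = pochhammer (of_nat N + 2 :: 'a::field_char_0) j"
proof -
  have "racah N 0 k j = (\<Sum>r\<le>k. (of_nat N + 1) / (of_nat N + 1 - of_nat r) * racah_basis r j / (fact r ^ 2 :: 'a))"
    unfolding racah_def
  proof (intro sum.cong refl)
    fix r assume r: "r \<in> {..k}"
    have "pochhammer (- of_nat N - 1) (Suc r) = - (of_nat N + 1) * pochhammer (- of_nat N :: 'a) r"
      by (simp add: pochhammer_rec)
    then have "- (of_nat N + 1 - of_nat r) * pochhammer (- of_nat N - 1) r = - (of_nat N + 1) * pochhammer (- of_nat N :: 'a) r"
      by (simp add: pochhammer_Suc algebra_simps)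
    moreover have d: "of_nat N + 1 - of_nat r \<noteq> (0::'a)"
      using of_nat_neq_0[of "N - r", where ?'a = 'a] r assms by (simp add: of_nat_diff algebra_simps)
    moreover have "pochhammer (- of_nat N :: 'a) r \<noteq> 0" "pochhammer (- of_nat k :: 'a) r \<noteq> 0"
      using r assms by (auto intro!: pochhammer_neg_nat_nonzero)
    moreover have "x * y / (f * x * z) * b = m / d * b / f" if "- d * y = - m * z" "d \<noteq> 0" "z \<noteq> 0" "x \<noteq> 0"
      for x y f z b m d :: 'a
    proof -
      have "y / z = m / d" using that by (simp add: frac_eq_eq mult.commute)
      then show ?thesis using that by (simp add: divide_simps)
    qed
    ultimately have "pochhammer (- of_nat k) r * pochhammer (- of_nat N - 1) r / (fact r ^ 2 * pochhammer (- of_nat k) r * pochhammer (- of_nat N) r) * racah_basis r j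
      = (of_nat N + 1) / (of_nat N + 1 - of_nat r) * racah_basis r j / (fact r ^ 2 :: 'a)"
      by blast
    then show "racah_coeff N 0 k r * racah_basis r j = (of_nat N + 1) / (of_nat N + 1 - of_nat r) * racah_basis r j / (fact r ^ 2 :: 'a)"
      by (simp add: racah_coeff_def)
  qed
  also have "\<dots> = (\<Sum>r\<le>N. (of_nat N + 1) / (of_nat N + 1 - of_nat r) * racah_basis r j / (fact r ^ 2 :: 'a))"
    using assms by (intro sum.mono_neutral_left) (auto simp: racah_basis_zero)
  finally show ?thesis using racah_saalschuetz[of j N, where ?'a = 'a] assms by simp
qed

text \<open>
The partial sums up to \<open>m\<close> are explicit multiples of \<open>(-A)\<^sub>m\<^sub>+\<^sub>1\<close>, which is zero for \<open>m = A\<close>.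
\<close>

lemma racah_moment_zero:
  assumes "r < A"
  shows "(\<Sum>j\<le>A. (2 * of_nat j + 1) * pochhammer (- of_nat A) j / pochhammer (of_nat A + 2) j * racah_basis r j) = (0 :: 'a::field_char_0)"
proof -
  have ne: "pochhammer (of_nat A + 2 :: 'a) m \<noteq> 0" for m
  proof
    assume "pochhammer (of_nat A + 2 :: 'a) m = 0"
    then obtain i where "of_nat A + 2 = - (of_nat i :: 'a)" by (auto simp: pochhammer_eq_0_iff)
    moreover have "(of_nat (A + 2 + i) :: 'a) = (of_nat A + 2) + of_nat i" by simp
    ultimately have "(of_nat (A + 2 + i) :: 'a) = 0" by simp
    then show False unfolding of_nat_eq_0_iff by simp
  qed
  have "(of_nat A - of_nat r) * (\<Sum>j\<le>m. (2 * of_nat j + 1) * pochhammer (- of_nat A) j / pochhammer (of_nat A + 2) j * racah_basis r j) =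
     - (pochhammer (- of_nat A) (Suc m) / pochhammer (of_nat A + 2) m * racah_basis r m * (of_nat m + 1 + of_nat r :: 'a))" for m
  proof (induction m)
    case 0
    show ?case by (cases r) (simp_all add: racah_basis_def pochhammer_0_left)
  next
    case (Suc m)
    define P Q b0 b1 R a m' :: 'a where "P = pochhammer (- of_nat A) (Suc m)" and "Q = pochhammer (of_nat A + 2) m"
      and "b0 = racah_basis r m" and "b1 = racah_basis r (Suc m)" and "R = of_nat r" and "a = of_nat A" and "m' = of_nat m"
    have b: "b0 * (m' + 1 + R) = b1 * (m' + 1 - R)"
      unfolding b0_def b1_def R_def m'_def by (rule racah_basis_shift)
    have QS: "pochhammer (of_nat A + 2) (Suc m) = Q * (a + 2 + m')" by (simp add: Q_def pochhammer_Suc a_def m'_def)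
    have PS: "pochhammer (- of_nat A) (Suc (Suc m)) = P * (m' + 1 - a)" by (simp add: P_def pochhammer_Suc[of _ "Suc m"] a_def m'_def algebra_simps)
    have Q0: "Q \<noteq> 0" "a + 2 + m' \<noteq> 0" using ne[of m] ne[of "Suc m"] unfolding QS by (auto simp: Q_def)
    have "(a - R) * ((\<Sum>j\<le>m. (2 * of_nat j + 1) * pochhammer (- of_nat A) j / pochhammer (of_nat A + 2) j * racah_basis r j)
       + (2 * (m' + 1) + 1) * P / (Q * (a + 2 + m')) * b1)
      = - (P / Q * (b0 * (m' + 1 + R))) + (a - R) * ((2 * (m' + 1) + 1) * P / (Q * (a + 2 + m')) * b1)"
      unfolding distrib_left[of "a - R"] using Suc.IH
      by (simp only: P_def Q_def b0_def R_def a_def m'_def mult.assoc)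
    also have "\<dots> = P * b1 / (Q * (a + 2 + m')) * (- ((m' + 1 - R) * (a + 2 + m')) + (a - R) * (2 * (m' + 1) + 1))"
      unfolding b using Q0 by (simp add: divide_simps) (simp add: algebra_simps)
    also have "- ((m' + 1 - R) * (a + 2 + m')) + (a - R) * (2 * (m' + 1) + 1) = - ((m' + 1 - a) * (m' + 2 + R))"
      by (simp add: algebra_simps)
    also have "P * b1 / (Q * (a + 2 + m')) * - ((m' + 1 - a) * (m' + 2 + R)) =
       - (P * (m' + 1 - a) / (Q * (a + 2 + m')) * b1 * (m' + 2 + R))" by (simp add: mult_ac)
    finally show ?case
      unfolding sum.atMost_Suc QS PS unfolding P_def[symmetric] unfolding b1_def[symmetric] R_def[symmetric] a_def[symmetric]
      by (simp add: m'_def add_ac)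
  qed
  from this[of A] have "(of_nat A - of_nat r) * (\<Sum>j\<le>A. (2 * of_nat j + 1) * pochhammer (- of_nat A) j / pochhammer (of_nat A + 2) j * racah_basis r j) = (0::'a)"
    using pochhammer_neg_nat_zero[of A "Suc A", where ?'a = 'a] by simp
  then show ?thesis using assms by simp
qed

section \<open>The three-term recurrence\<close>

text \<open>
The constant \<open>c\<^sub>k\<^sub>0(n)\<close> in the scaling of the variable \<open>x\<close>, that is, multiplied by \<open>(-2)\<^sup>n\<close>.
\<close>

definition racah_norm :: "nat \<Rightarrow> nat \<Rightarrow> nat \<Rightarrow> 'a::field_char_0" where
  "racah_norm N n k = fact n * pochhammer (of_nat N + 2) n /
     (2 ^ n * pochhammer (of_nat k + 1) n * pochhammer (of_nat N - of_nat k + 1) n)"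

definition col_factor :: "nat \<Rightarrow> nat \<Rightarrow> 'a::field_char_0" where
  "col_factor N j = (- 1) ^ j * pochhammer (- of_nat N) j / (fact j * pochhammer (of_nat N + 2) j)"

definition row_coeff :: "nat \<Rightarrow> nat \<Rightarrow> nat \<Rightarrow> nat \<Rightarrow> 'a::field_char_0" where
  "row_coeff N n k j = racah_norm N n k * (col_factor N j * pochhammer (- of_nat n - of_nat k) j) * racah N n k j"

text \<open>
The entries of the claimed value of \<open>P\<^sub>n L\<close>. For \<open>j > n + k\<close> the coefficient is zero because of the
factor \<open>(-n-k)\<^sub>j\<close>.
\<close>

definition row_poly :: "nat \<Rightarrow> nat \<Rightarrow> nat \<Rightarrow> nat \<Rightarrow> 'a::field_char_0 poly" where
  "row_poly N n k j = smult (row_coeff N n k j) (geg (n + k) j)"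

text \<open>
The scalars of the three-term recurrence. \<open>rec_up\<close> is zero for \<open>k = N\<close>, \<open>rec_down\<close> for \<open>k = 0\<close> and
\<open>rec_prev\<close> for \<open>n = 0\<close>, in each case even if the denominator is zero, since division by zero
yields zero. So no index outside the matrix ever contributes.
\<close>

definition rec_up :: "nat \<Rightarrow> nat \<Rightarrow> nat \<Rightarrow> 'a::field_char_0" where
  "rec_up N n k = (of_nat N - of_nat k) ^ 2 /
     (2 * (of_nat N - of_nat k + of_nat n + 1) * (of_nat N - of_nat k + of_nat n))"

definition rec_down :: "nat \<Rightarrow> nat \<Rightarrow> 'a::field_char_0" where
  "rec_down n k = of_nat k ^ 2 / (2 * (of_nat n + of_nat k) * (of_nat n + of_nat k + 1))"

definition rec_prev :: "nat \<Rightarrow> nat \<Rightarrow> nat \<Rightarrow> 'a::field_char_0" where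
  "rec_prev N n k = of_nat n ^ 2 * (of_nat N + of_nat n + 1) ^ 2 /
     (4 * (of_nat n + of_nat k) * (of_nat n + of_nat k + 1) *
       ((of_nat N - of_nat k + of_nat n) * (of_nat N - of_nat k + of_nat n + 1)))"

lemma pochhammer_of_nat_add_nonzero: "a > 0 \<Longrightarrow> pochhammer (of_nat a :: 'a::field_char_0) n \<noteq> 0"
proof
  assume "a > 0" "pochhammer (of_nat a :: 'a) n = 0"
  then obtain i where "of_nat a = - (of_nat i :: 'a)" by (auto simp: pochhammer_eq_0_iff)
  then have "(of_nat (a + i) :: 'a) = 0" by simp
  then show False using \<open>a > 0\<close> unfolding of_nat_eq_0_iff by simp
qed

lemma racah_norm_Suc:
  assumes "k \<le> N"
  shows "racah_norm N (Suc n) k * (2 * (of_nat n + of_nat k + 1) * (of_nat N - of_nat k + of_nat n + 1)) =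
    racah_norm N n k * ((of_nat n + 1) * (of_nat N + of_nat n + 2) :: 'a::field_char_0)"
proof -
  have n: "of_nat n + of_nat k + 1 \<noteq> (0::'a)" "of_nat N - of_nat k + of_nat n + 1 \<noteq> (0::'a)"
    using of_nat_neq_0[of "n + k", where ?'a = 'a] of_nat_neq_0[of "N - k + n", where ?'a = 'a] assms
    by (auto simp: of_nat_diff algebra_simps)
  have p: "pochhammer (of_nat N + 2) (Suc n) = pochhammer (of_nat N + 2 :: 'a) n * (of_nat N + of_nat n + 2)"
    "pochhammer (of_nat k + 1) (Suc n) = pochhammer (of_nat k + 1 :: 'a) n * (of_nat n + of_nat k + 1)"
    "pochhammer (of_nat N - of_nat k + 1) (Suc n) = pochhammer (of_nat N - of_nat k + 1 :: 'a) n * (of_nat N - of_nat k + of_nat n + 1)"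
    "fact (Suc n) = (of_nat n + 1) * (fact n :: 'a)"
    by (simp_all add: pochhammer_Suc add_ac)
  have "(a * f) * (p * b) / (2 * w * (q * c) * (r * d)) * (2 * c * d) = f * p / (w * q * r) * (a * b)"
    if "c \<noteq> 0" "d \<noteq> 0" for a f p b w q c r d :: 'a
    using that by (simp add: mult_ac)
  from this[OF n] show ?thesis unfolding racah_norm_def p power_Suc .
qed

lemma racah_norm_Suc_row:
  assumes "Suc k \<le> N"
  shows "racah_norm N n (Suc k) * ((of_nat n + of_nat k + 1) * (of_nat N - of_nat k)) =
    racah_norm N n k * ((of_nat k + 1) * (of_nat N - of_nat k + of_nat n) :: 'a::field_char_0)"
proof -
  have n: "of_nat k + 1 \<noteq> (0::'a)" "of_nat N - of_nat k \<noteq> (0::'a)"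
    "of_nat n + of_nat k + 1 \<noteq> (0::'a)" "of_nat N - of_nat k + of_nat n \<noteq> (0::'a)"
    using of_nat_neq_0[of k, where ?'a = 'a] of_nat_neq_0[of "n + k", where ?'a = 'a]
      of_nat_neq_0[of "N - Suc k + n", where ?'a = 'a] assms
    by (auto simp: of_nat_diff algebra_simps)
  have "pochhammer (of_nat k + 1) (Suc n) = (of_nat k + 1) * pochhammer (of_nat (Suc k) + 1 :: 'a) n"
    by (simp add: pochhammer_rec add_ac)
  then have 1: "(of_nat k + 1) * pochhammer (of_nat (Suc k) + 1) n = pochhammer (of_nat k + 1) n * (of_nat n + of_nat k + 1 :: 'a)"
    by (simp add: pochhammer_Suc add_ac)
  have "pochhammer (of_nat N - of_nat k) (Suc n) = (of_nat N - of_nat k) * pochhammer (of_nat N - of_nat k + 1 :: 'a) n"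
    by (simp add: pochhammer_rec)
  then have 2: "pochhammer (of_nat N - of_nat (Suc k) + 1) n * (of_nat N - of_nat k + of_nat n) = (of_nat N - of_nat k) * pochhammer (of_nat N - of_nat k + 1 :: 'a) n"
    by (simp add: pochhammer_Suc)
  have 3: "pochhammer (of_nat (Suc k) + 1 :: 'a) n = pochhammer (of_nat k + 1) n * (of_nat n + of_nat k + 1 :: 'a) / (of_nat k + 1)"
    unfolding 1[symmetric] using n by simp
  have 4: "pochhammer (of_nat N - of_nat (Suc k) + 1 :: 'a) n = (of_nat N - of_nat k) * pochhammer (of_nat N - of_nat k + 1 :: 'a) n / (of_nat N - of_nat k + of_nat n)"
    unfolding 2[symmetric] using n by simp
  have "f / (w * (p * c / a) * (d * q / b)) * (c * d) = f / (w * p * q) * (a * b)"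
    if "c \<noteq> 0" "d \<noteq> 0" for f w p c a d q b :: 'a
    using that by (simp add: mult_ac)
  from this[OF n(3,2)] show ?thesis unfolding racah_norm_def 3 4 .
qed

text \<open>
The part of \<open>row_poly_recurrence\<close> at degree \<open>A + 1\<close>: the identity
\<open>(A + 1) (-A)\<^sub>j = (A + 1 - j) (-A-1)\<^sub>j\<close> supplies the factor that \<open>racah_raise\<close> asks for.
\<close>

lemma row_coeff_raise:
  assumes "k \<le> N" "j \<le> N"
  shows "(of_nat n + of_nat k + of_nat j + 2) / (2 * of_nat n + 2 * of_nat k + 2) * row_coeff N n k j =
    row_coeff N (Suc n) k j + rec_up N n k * (row_coeff N n (Suc k) j :: 'a::field_char_0)"
proof -
  define A J D c :: 'a where "A = of_nat n + of_nat k" and "J = of_nat j" and "D = of_nat N - of_nat k + of_nat n + 1"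
    and "c = racah_norm N n k"
  define a b :: 'a where "a = (of_nat n + 1) * (of_nat N + of_nat n + 2)" and "b = (of_nat k + 1) * (of_nat N - of_nat k)"
  define P P1 :: 'a where "P = pochhammer (- A) j" and "P1 = pochhammer (- A - 1) j"
  define G :: 'a where "G = col_factor N j"
  have A1: "A + 1 \<noteq> 0" and D: "D \<noteq> 0"
    using of_nat_neq_0[of "n + k", where ?'a = 'a] of_nat_neq_0[of "N - k + n", where ?'a = 'a] assms
    by (auto simp: of_nat_diff algebra_simps A_def D_def)
  have "pochhammer (- A - 1) (Suc j) = (- A - 1) * P" by (simp add: pochhammer_rec P_def)
  then have PP: "(A + 1) * P = (A + 1 - J) * P1" by (simp add: pochhammer_Suc P1_def J_def algebra_simps)
  have r0: "row_coeff N n k j = c * (G * P) * racah N n k j"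
    by (simp add: row_coeff_def c_def G_def P_def A_def)
  have e: "- of_nat (Suc n) - of_nat k = - A - 1" "- of_nat n - of_nat (Suc k) = - A - 1" by (simp_all add: A_def)
  have r1: "row_coeff N (Suc n) k j = racah_norm N (Suc n) k * (G * P1) * racah N (Suc n) k j"
    "row_coeff N n (Suc k) j = racah_norm N n (Suc k) * (G * P1) * racah N n (Suc k) j"
    unfolding row_coeff_def e P1_def G_def by simp_all
  have c1: "racah_norm N (Suc n) k * (2 * (A + 1) * D) = c * a"
    unfolding c_def a_def A_def D_def by (rule racah_norm_Suc[OF assms(1)])
  have c2: "rec_up N n k * racah_norm N n (Suc k) * (2 * (A + 1) * D) = c * b"
  proof (cases "k = N")
    case True
    then show ?thesis by (simp add: rec_up_def b_def)
  next
    case False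
    then have k: "Suc k \<le> N" using assms by simp
    have ne: "of_nat N - of_nat k \<noteq> (0::'a)" "of_nat N - of_nat k + of_nat n \<noteq> (0::'a)"
      using of_nat_neq_0[of "N - Suc k + n", where ?'a = 'a] k by (auto simp: of_nat_diff algebra_simps)
    have "m ^ 2 / (2 * D * s) * x * (2 * (A + 1) * D) = c * (k1 * m)"
      if "x * ((A + 1) * m) = c * (k1 * s)" "s \<noteq> 0" for m s x k1 :: 'a
    proof -
      have "m ^ 2 / (2 * D * s) * x * (2 * a1 * D) = m * (x * (a1 * m)) / s" for a1
        using D by (simp add: power2_eq_square mult_ac)
      then have "m ^ 2 / (2 * D * s) * x * (2 * (A + 1) * D) = m * (x * ((A + 1) * m)) / s" .
      then show ?thesis unfolding that(1) using that(2) by (simp add: mult_ac)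
    qed
    from this[OF racah_norm_Suc_row[OF k, of n, where ?'a = 'a, folded A_def c_def] ne(2)]
    show ?thesis unfolding rec_up_def b_def D_def .
  qed
  have R: "D * (((A + 1) * (A + 2) - J * (J + 1)) * racah N n k j) = (A + 1) * (a * racah N (Suc n) k j + b * racah N n (Suc k) j)"
    unfolding D_def A_def J_def a_def b_def by (rule racah_raise[OF assms])
  have K0: "2 * (A + 1) ^ 2 * D \<noteq> 0" using A1 D by simp
  have f: "2 * of_nat n + 2 * of_nat k + 2 = 2 * (A + 1)" by (simp add: A_def algebra_simps)
  have "(A + J + 2) / (2 * (A + 1)) * row_coeff N n k j * (2 * (A + 1) ^ 2 * D) = c * G * (A + J + 2) * D * ((A + 1) * P) * racah N n k j"
  proof -
    have "q / (2 * a1) * (c * (G * P) * R) * (2 * a1 ^ 2 * D) = c * G * q * D * (a1 * P) * R" if "a1 \<noteq> 0" for q a1 R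
      using that by (simp add: power2_eq_square mult_ac)
    from this[OF A1] show ?thesis unfolding r0 .
  qed
  also have "\<dots> = c * G * P1 * (D * (((A + 1) * (A + 2) - J * (J + 1)) * racah N n k j))"
    unfolding PP by (simp add: algebra_simps)
  also have "\<dots> = (A + 1) * G * P1 * ((c * a) * racah N (Suc n) k j + (c * b) * racah N n (Suc k) j)"
    unfolding R by (simp add: algebra_simps)
  also have "\<dots> = (row_coeff N (Suc n) k j + rec_up N n k * row_coeff N n (Suc k) j) * (2 * (A + 1) ^ 2 * D)"
    unfolding r1 c1[symmetric] c2[symmetric] by (simp add: power2_eq_square algebra_simps)
  finally have "(A + J + 2) / (2 * (A + 1)) * row_coeff N n k j =
      row_coeff N (Suc n) k j + rec_up N n k * row_coeff N n (Suc k) j"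
    unfolding mult_right_cancel[OF K0] .
  then show ?thesis unfolding f unfolding A_def J_def .
qed

text \<open>
The part of \<open>row_poly_recurrence\<close> at degree \<open>A - 1\<close>, where \<open>(A - j) (-A)\<^sub>j = A (1-A)\<^sub>j\<close> absorbs
the dependence on \<open>j\<close> into the prefactor.
\<close>

lemma row_coeff_lower:
  assumes "k \<le> N"
  shows "(of_nat n + of_nat k - of_nat j) / (2 * of_nat n + 2 * of_nat k + 2) * row_coeff N n k j =
    rec_down n k * row_coeff N n (k - 1) j + rec_prev N n k * (row_coeff N (n - 1) k j :: 'a::field_char_0)"
proof (cases "n + k = 0")
  case True
  then show ?thesis by (cases j) (simp_all add: rec_down_def rec_prev_def row_coeff_def pochhammer_0_left)
next
  case False
  define A J D c :: 'a where "A = of_nat n + of_nat k" and "J = of_nat j" and "D = of_nat N - of_nat k + of_nat n + 1"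
    and "c = racah_norm N n k"
  define a b :: 'a where "a = of_nat k * (of_nat N - of_nat k + 1)" and "b = of_nat n * (of_nat N + of_nat n + 1)"
  define P P1 :: 'a where "P = pochhammer (- A) j" and "P1 = pochhammer (1 - A) j"
  define G :: 'a where "G = col_factor N j"
  have A0: "A \<noteq> 0" using False unfolding A_def of_nat_add[symmetric] of_nat_eq_0_iff by simp
  have A1: "A + 1 \<noteq> 0" and D: "D \<noteq> 0"
    using of_nat_neq_0[of "n + k", where ?'a = 'a] of_nat_neq_0[of "N - k + n", where ?'a = 'a] assms
    by (auto simp: of_nat_diff algebra_simps A_def D_def)
  have "pochhammer (- A) (Suc j) = - A * P1" by (simp add: pochhammer_rec P1_def)
  then have PP: "(A - J) * P = A * P1" by (simp add: pochhammer_Suc P_def J_def algebra_simps)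
  have r0: "row_coeff N n k j = c * (G * P) * racah N n k j"
    by (simp add: row_coeff_def c_def G_def P_def A_def)
  have r1: "rec_down n k * row_coeff N n (k - 1) j * (2 * (A + 1) * D) = c * a * (G * P1) * racah N n (k - 1) j"
  proof (cases k)
    case 0
    then show ?thesis by (simp add: rec_down_def a_def)
  next
    case (Suc l)
    have e: "- of_nat n - of_nat (k - 1) = 1 - A" using Suc by (simp add: A_def)
    have c2: "racah_norm N n (k - 1) * (of_nat k * D) = c * (A * (of_nat N - of_nat k + 1))"
      using racah_norm_Suc_row[of l N n, where ?'a = 'a] assms Suc
      by (simp add: c_def A_def D_def algebra_simps)
    have "K ^ 2 / (2 * A * (A + 1)) * (x * y * z) * (2 * (A + 1) * D) = c * (K * m) * y * z"
      if "x * (K * D) = c * (A * m)" for K x y z m :: 'a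
    proof -
      have "K ^ 2 / (2 * A * a1) * (x * y * z) * (2 * a1 * D) = K * (x * (K * D)) * y * z / A" if "a1 \<noteq> 0" for a1
        using that by (simp add: power2_eq_square mult_ac)
      from this[OF A1] show ?thesis unfolding that using A0 by (simp add: mult_ac)
    qed
    from this[OF c2] show ?thesis
      unfolding rec_down_def row_coeff_def e P1_def[symmetric] G_def[symmetric] a_def A_def[symmetric] .
  qed
  have r2: "rec_prev N n k * row_coeff N (n - 1) k j * (2 * (A + 1) * D) = c * b * (G * P1) * racah N (n - 1) k j"
  proof (cases n)
    case 0
    then show ?thesis by (simp add: rec_prev_def b_def)
  next
    case (Suc l)
    have e: "- of_nat (n - 1) - of_nat k = 1 - A" using Suc by (simp add: A_def)
    define E :: 'a where "E = of_nat N - of_nat k + of_nat n"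
    have E: "E \<noteq> 0" using of_nat_neq_0[of "N - k + l", where ?'a = 'a] assms Suc
      by (auto simp: E_def of_nat_diff algebra_simps)
    have c2: "racah_norm N (n - 1) k * b = c * (2 * A * E)"
      using racah_norm_Suc[OF assms, of l, where ?'a = 'a] Suc
      by (simp add: c_def A_def E_def b_def algebra_simps)
    have DE: "D = E + 1" by (simp add: D_def E_def)
    have "n0 ^ 2 * m ^ 2 / (4 * A * (A + 1) * (E * D)) * (x * y * z) * (2 * (A + 1) * D) = c * (n0 * m) * y * z"
      if "x * (n0 * m) = c * (2 * A * E)" for n0 m x y z :: 'a
    proof -
      have "n0 ^ 2 * m ^ 2 / (4 * A * a1 * (E * D)) * (x * y * z) * (2 * a1 * D) = n0 * m * (x * (n0 * m)) * y * z / (2 * A * E)" if "a1 \<noteq> 0" for a1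
        using that D by (simp add: power2_eq_square divide_simps)
      from this[OF A1] show ?thesis unfolding that using A0 E by (simp add: mult_ac)
    qed
    from this[OF c2[unfolded b_def]] show ?thesis
      unfolding rec_prev_def row_coeff_def e P1_def[symmetric] G_def[symmetric] b_def A_def[symmetric] E_def[symmetric] DE .
  qed
  have R: "A * D * (P1 * racah N n k j) = P1 * (a * racah N n (k - 1) j + b * racah N (n - 1) k j)"
  proof (cases "j < n + k")
    case True
    have "A * D * racah N n k j = a * racah N n (k - 1) j + b * racah N (n - 1) k j"
      unfolding A_def D_def a_def b_def by (rule racah_lower[OF assms True])
    then show ?thesis by (simp add: mult.left_commute)
  next
    case j: False
    obtain m where m: "n + k = Suc m" using False by (cases "n + k") auto
    then have "A = of_nat (Suc m)" unfolding A_def of_nat_add[symmetric] by simp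
    then have "1 - A = - of_nat (n + k - 1)" unfolding m by simp
    then have "P1 = 0" unfolding P1_def using j False by (simp only: pochhammer_neg_nat_zero)
    then show ?thesis by simp
  qed
  have K0: "2 * (A + 1) * D \<noteq> 0" unfolding mult_eq_0_iff using A1 D by simp
  have f: "2 * of_nat n + 2 * of_nat k + 2 = 2 * (A + 1)" by (simp add: A_def algebra_simps)
  have "(A - J) / (2 * (A + 1)) * row_coeff N n k j * (2 * (A + 1) * D) = c * G * D * ((A - J) * P) * racah N n k j"
  proof -
    have "q / (2 * a1) * (c * (G * P) * R) * (2 * a1 * D) = c * G * D * (q * P) * R" if "a1 \<noteq> 0" for q a1 R
      using that by (simp add: mult_ac)
    from this[OF A1] show ?thesis unfolding r0 .
  qed
  also have "\<dots> = c * G * (A * D * (P1 * racah N n k j))"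
    unfolding PP by (simp add: mult_ac)
  also have "\<dots> = c * a * (G * P1) * racah N n (k - 1) j + c * b * (G * P1) * racah N (n - 1) k j"
    unfolding R by (simp add: algebra_simps)
  also have "\<dots> = (rec_down n k * row_coeff N n (k - 1) j + rec_prev N n k * row_coeff N (n - 1) k j) * (2 * (A + 1) * D)"
    unfolding r1[symmetric] r2[symmetric] by (simp only: distrib_right)
  finally have "(A - J) / (2 * (A + 1)) * row_coeff N n k j =
      rec_down n k * row_coeff N n (k - 1) j + rec_prev N n k * row_coeff N (n - 1) k j"
    unfolding mult_right_cancel[OF K0] .
  then show ?thesis unfolding f unfolding A_def J_def .
qed

lemma row_poly_recurrence:
  assumes "k \<le> N" "j \<le> N"
  shows "xpoly * row_poly N n k j = row_poly N (Suc n) k j + smult (rec_up N n k) (row_poly N n (Suc k) j)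
    + smult (rec_down n k) (row_poly N n (k - 1) j) + smult (rec_prev N n k) (row_poly N (n - 1) k j :: 'a::field_char_0 poly)"
proof -
  define v :: 'a where "v = row_coeff N n k j"
  define a b d :: 'a where "a = of_nat n + of_nat k + of_nat j + 2" and "b = of_nat n + of_nat k - of_nat j"
    and "d = 2 * of_nat n + 2 * of_nat k + 2"
  have d: "d \<noteq> 0"
  proof -
    have "d = 2 * of_nat (Suc (n + k))" by (simp add: d_def algebra_simps)
    then show ?thesis using of_nat_neq_0[of "n + k", where ?'a = 'a] by (simp del: of_nat_Suc)
  qed
  have "xpoly * row_poly N n k j = smult (a / d * v) (geg (Suc (n + k)) j) + smult (b / d * v) (geg (n + k - 1) j)"
  proof (cases "j \<le> n + k")
    case True
    have "smult d (xpoly * geg (n + k) j) = smult a (geg (Suc (n + k)) j) + smult b (geg (n + k - 1) j :: 'a poly)"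
      using geg_recurrence[OF True, where ?'a = 'a] by (simp add: a_def b_def d_def algebra_simps)
    then have "smult (v / d) (smult d (xpoly * geg (n + k) j)) = smult (v / d) (smult a (geg (Suc (n + k)) j) + smult b (geg (n + k - 1) j :: 'a poly))"
      by (rule arg_cong)
    then show ?thesis using d unfolding row_poly_def v_def[symmetric]
      by (simp add: smult_add_right mult.commute)
  next
    case False
    then have "v = 0"
      using pochhammer_neg_nat_zero[of "n + k" j, where ?'a = 'a] by (simp add: v_def row_coeff_def)
    then show ?thesis by (simp add: row_poly_def v_def)
  qed
  also have "smult (a / d * v) (geg (Suc (n + k)) j) = row_poly N (Suc n) k j + smult (rec_up N n k) (row_poly N n (Suc k) j)"
    unfolding v_def a_def d_def row_coeff_raise[OF assms] by (simp add: row_poly_def smult_add_left)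
  also have "smult (b / d * v) (geg (n + k - 1) j) = smult (rec_down n k) (row_poly N n (k - 1) j) + smult (rec_prev N n k) (row_poly N (n - 1) k j)"
  proof -
    have 1: "smult (rec_down n k) (row_poly N n (k - 1) j) = smult (rec_down n k * row_coeff N n (k - 1) j) (geg (n + k - 1) j)"
      by (cases k) (simp_all add: row_poly_def rec_down_def)
    have 2: "smult (rec_prev N n k) (row_poly N (n - 1) k j) = smult (rec_prev N n k * row_coeff N (n - 1) k j) (geg (n + k - 1) j)"
      by (cases n) (simp_all add: row_poly_def rec_prev_def)
    show ?thesis unfolding v_def b_def d_def row_coeff_lower[OF assms(1)] 1 2 by (simp add: smult_add_left)
  qed
  finally show ?thesis by (simp add: add.assoc)
qed

text \<open>
The polynomials that satisfy the recurrence of \<open>row_poly\<close> and start from the identity matrix. The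
monic normalisation is built in.
\<close>

fun recpoly :: "nat \<Rightarrow> nat \<Rightarrow> nat \<Rightarrow> nat \<Rightarrow> 'a::field_char_0 poly" where
  "recpoly N 0 k i = (if k = i then 1 else 0)"
| "recpoly N (Suc n) k i = xpoly * recpoly N n k i - smult (rec_up N n k) (recpoly N n (Suc k) i)
     - smult (rec_down n k) (recpoly N n (k - 1) i) - smult (rec_prev N n k) (recpoly N (n - 1) k i)"

lemma recpoly_coeff_above: "n < m \<Longrightarrow> coeff (recpoly N n k i) m = 0"
proof (induction n arbitrary: k m rule: less_induct)
  case (less n)
  show ?case
  proof (cases n)
    case 0
    then show ?thesis using less.prems by (simp add: coeff_eq_0)
  next
    case (Suc l)
    obtain m' where m: "m = Suc m'" using less.prems by (cases m) auto
    show ?thesis unfolding Suc m using less Suc m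
      by (simp add: coeff_pCons)
  qed
qed

lemma recpoly_monic: "coeff (recpoly N n k i) n = (if k = i then 1 else 0 :: 'a::field_char_0)"
proof (induction n)
  case (Suc n)
  have "coeff (recpoly N (n - 1) k i) (Suc n) = (0 :: 'a)"
    by (rule recpoly_coeff_above) simp
  then show ?case using Suc by (simp add: recpoly_coeff_above)
qed simp

lemma row_poly_0:
  assumes "k \<le> N" "j \<le> N"
  shows "row_poly N 0 k j = (Lpoly k j :: 'a::field_char_0 poly)"
proof (cases "j \<le> k")
  case True
  have "col_factor N j * racah N 0 k j = ((- 1) ^ j / fact j :: 'a)"
  proof -
    have "pochhammer (of_nat N + 2 :: 'a) j \<noteq> 0"
      using pochhammer_of_nat_add_nonzero[of "N + 2" j, where ?'a = 'a] by (simp add: add.commute)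
    moreover have "col_factor N j * racah N 0 k j = (- 1) ^ j * (pochhammer (- of_nat N) j * racah N 0 k j) / (fact j * pochhammer (of_nat N + 2 :: 'a) j)"
      by (simp add: col_factor_def)
    ultimately show ?thesis unfolding racah_0[OF True assms(1)] by simp
  qed
  moreover have "row_coeff N 0 k j = (col_factor N j * racah N 0 k j) * (pochhammer (- of_nat k) j :: 'a)"
    by (simp add: row_coeff_def racah_norm_def)
  moreover have "of_nat (k choose j) = ((- 1) ^ j / fact j * pochhammer (- of_nat k) j :: 'a)"
    by (simp add: binomial_gbinomial gbinomial_pochhammer)
  ultimately have "row_coeff N 0 k j = (of_nat (k choose j) :: 'a)" by simp
  then show ?thesis by (simp add: row_poly_def Lpoly_def)
next
  case False
  then show ?thesis
    using pochhammer_neg_nat_zero[of k j, where ?'a = 'a] by (simp add: row_poly_def row_coeff_def Lpoly_def)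
qed

theorem recpoly_times_L:
  assumes "k \<le> N" "j \<le> N"
  shows "(\<Sum>i\<le>N. recpoly N n k i * Lpoly i j) = (row_poly N n k j :: 'a::field_char_0 poly)"
  using assms(1)
proof (induction n arbitrary: k rule: less_induct)
  case (less n)
  show ?case
  proof (cases n)
    case 0
    have "(\<Sum>i\<le>N. recpoly N 0 k i * Lpoly i j) = (\<Sum>i\<le>N. if i = k then Lpoly k j else 0 :: 'a poly)"
      by (intro sum.cong refl) auto
    then show ?thesis unfolding 0 using less.prems row_poly_0[OF less.prems assms(2), where ?'a = 'a] by simp
  next
    case (Suc l)
    let ?S = "\<lambda>n k. \<Sum>i\<le>N. recpoly N n k i * Lpoly i j :: 'a poly"
    have "?S (Suc l) k = xpoly * ?S l k - smult (rec_up N l k) (?S l (Suc k)) - smult (rec_down l k) (?S l (k - 1))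
      - smult (rec_prev N l k) (?S (l - 1) k)"
      unfolding recpoly.simps
      by (simp only: sum_distrib_left smult_sum2 sum_subtractf[symmetric] left_diff_distrib mult_smult_left mult.assoc)
    moreover have "?S l k = row_poly N l k j" using less Suc by simp
    moreover have "smult (rec_up N l k) (?S l (Suc k)) = smult (rec_up N l k) (row_poly N l (Suc k) j)"
      by (cases "k = N") (use less Suc in \<open>simp_all add: rec_up_def\<close>)
    moreover have "smult (rec_down l k) (?S l (k - 1)) = smult (rec_down l k) (row_poly N l (k - 1) j)"
      using less Suc by simp
    moreover have "smult (rec_prev N l k) (?S (l - 1) k) = smult (rec_prev N l k) (row_poly N (l - 1) k j)"
      using less Suc by simp
    ultimately show ?thesis unfolding Suc
      by (simp only: row_poly_recurrence[OF less.prems assms(2)]) (simp add: algebra_simps del: mult_pCons_left)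
  qed
qed

section \<open>Integration against the semicircle weight\<close>

definition semicircle_int :: "complex poly \<Rightarrow> complex" where
  "semicircle_int p = integral {-1..1} (\<lambda>x::real. poly p (of_real x) * of_real (sqrt (1 - x\<^sup>2)))"

lemma semicircle_int_integrable: "(\<lambda>x::real. poly p (of_real x) * of_real (sqrt (1 - x\<^sup>2)) :: complex) integrable_on {-1..1}"
  by (intro integrable_continuous_real continuous_intros)

lemma semicircle_int_add: "semicircle_int (p + q) = semicircle_int p + semicircle_int q"
  unfolding semicircle_int_def poly_add distrib_right
  by (rule Henstock_Kurzweil_Integration.integral_add[OF semicircle_int_integrable semicircle_int_integrable])

lemma semicircle_int_smult: "semicircle_int (smult c p) = c * semicircle_int p"
  unfolding semicircle_int_def poly_smult mult.assoc
  by (rule Henstock_Kurzweil_Integration.integral_mult_right)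

lemma semicircle_int_0 [simp]: "semicircle_int 0 = 0"
  by (simp add: semicircle_int_def)

lemma semicircle_int_diff: "semicircle_int (p - q) = semicircle_int p - semicircle_int q"
proof -
  have "p - q = p + smult (- 1) q" by simp
  then show ?thesis by (simp only: semicircle_int_add semicircle_int_smult) simp
qed

lemma semicircle_int_sum: "semicircle_int (\<Sum>a\<in>S. f a) = (\<Sum>a\<in>S. semicircle_int (f a))"
  by (induction S rule: infinite_finite_induct) (simp_all add: semicircle_int_add)

text \<open>
The integrand is the derivative of \<open>(1 - x\<^sup>2)\<^sup>3\<^sup>/\<^sup>2 p(x)\<close>, which vanishes at both ends. The
orthogonality relations follow from this relation and linearity alone.
\<close>

lemma semicircle_int_derivative: "semicircle_int (one_minus_sq * pderiv p - smult 3 (xpoly * p)) = 0"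
proof -
  define F :: "real \<Rightarrow> complex" where "F x = poly p (of_real x) * of_real ((1 - x\<^sup>2) * sqrt (1 - x\<^sup>2))" for x
  have "((\<lambda>x::real. poly (one_minus_sq * pderiv p - smult 3 (xpoly * p)) (of_real x) * of_real (sqrt (1 - x\<^sup>2)))
    has_integral F 1 - F (- 1)) {-1..1}"
  proof (rule fundamental_theorem_of_calculus_interior)
    show "continuous_on {- 1..1} F" unfolding F_def by (intro continuous_intros)
    fix x :: real assume x: "x \<in> {- 1 <..< 1}"
    then have pos: "1 - x\<^sup>2 > 0" by (simp add: abs_square_less_1 abs_less_iff)
    have "((\<lambda>x. (1 - x\<^sup>2) * sqrt (1 - x\<^sup>2)) has_real_derivative - 3 * x * sqrt (1 - x\<^sup>2)) (at x)"
    proof -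
      have "sqrt (1 - x\<^sup>2) * sqrt (1 - x\<^sup>2) = 1 - x\<^sup>2" using pos by simp
      then have "(1 - x\<^sup>2) * x / sqrt (1 - x\<^sup>2) = x * sqrt (1 - x\<^sup>2)" using pos
        by (simp add: divide_simps)
      then show ?thesis using pos
        by (auto intro!: derivative_eq_intros simp: field_simps)
    qed
    then have "((\<lambda>x. complex_of_real ((1 - x\<^sup>2) * sqrt (1 - x\<^sup>2))) has_vector_derivative of_real (- 3 * x * sqrt (1 - x\<^sup>2))) (at x)"
      by (intro has_vector_derivative_of_real) (simp add: has_real_derivative_iff_has_vector_derivative)
    moreover have "((\<lambda>x. poly p (of_real x)) has_vector_derivative poly (pderiv p) (of_real x)) (at x)"
      by (intro has_vector_derivative_real_field poly_DERIV)
    ultimately have "(F has_vector_derivative (poly p (of_real x) * of_real (- 3 * x * sqrt (1 - x\<^sup>2)) +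
        poly (pderiv p) (of_real x) * of_real ((1 - x\<^sup>2) * sqrt (1 - x\<^sup>2)))) (at x)"
      unfolding F_def by (intro has_vector_derivative_mult)
    then show "(F has_vector_derivative poly (one_minus_sq * pderiv p - smult 3 (xpoly * p)) (of_real x) * of_real (sqrt (1 - x\<^sup>2))) (at x)"
      by (simp add: algebra_simps power2_eq_square)
  qed simp
  then show ?thesis unfolding semicircle_int_def by (simp add: integral_unique F_def)
qed

section \<open>Scalar orthogonality\<close>

definition geg_pairing :: "nat \<Rightarrow> nat \<Rightarrow> nat \<Rightarrow> complex" where
  "geg_pairing j a b = semicircle_int (one_minus_sq ^ j * geg a j * geg b j)"

lemma geg_pairing_commute: "geg_pairing j a b = geg_pairing j b a"
  by (simp add: geg_pairing_def mult_ac)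

text \<open>
Integration by parts: the derivative moves from \<open>geg b j\<close> to the other factor by \<open>geg_lowering\<close>.
\<close>

lemma geg_pairing_Suc:
  assumes "j < a" "j \<le> b"
  shows "(of_nat b - of_nat j) * (of_nat b + of_nat j + 2) * geg_pairing (Suc j) a b =
    (2 * of_nat j + 3) ^ 2 * geg_pairing j a b"
proof -
  define h g p :: "complex poly" where "h = geg a (Suc j)" and "g = geg b j" and "p = one_minus_sq ^ j"
  define s :: complex where "s = 2 * of_nat j + 3"
  define k :: complex where "k = (of_nat b - of_nat j) * (of_nat b + of_nat j + 2) / s"
  have s: "s \<noteq> 0" using of_nat_neq_0[of "2 * j + 2", where ?'a = complex] by (simp add: s_def algebra_simps)
  have low: "one_minus_sq * pderiv h - smult s (xpoly * h) = smult (- s) (geg a j)"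
    unfolding h_def s_def using assms by (intro geg_lowering) simp
  have der: "pderiv g = smult k (geg b (Suc j))"
    unfolding g_def k_def s_def using assms by (intro pderiv_geg) simp
  have dp: "one_minus_sq * pderiv p = smult (- 2 * of_nat j) (xpoly * p)"
  proof (cases j)
    case (Suc i)
    have "pderiv one_minus_sq = smult (- 2) (xpoly :: complex poly)" by (simp add: pderiv_pCons)
    then have "pderiv p = smult (of_nat (Suc i)) (one_minus_sq ^ i) * smult (- 2) xpoly"
      unfolding p_def Suc by (simp only: pderiv_power_Suc)
    moreover have "y * (smult c q * smult d x) = smult (d * c) (x * (y * q))" for y q x :: "complex poly" and c d
      by (simp add: mult_ac)
    ultimately show ?thesis unfolding p_def Suc power_Suc by (simp only:)
  qed (simp add: p_def)
  have "one_minus_sq * pderiv (p * h * g) - smult 3 (xpoly * (p * h * g)) =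
     p * (one_minus_sq * pderiv h - smult s (xpoly * h)) * g + one_minus_sq * p * h * pderiv g"
  proof -
    have c: "smult 3 (xpoly * (p * h * g)) + smult (2 * of_nat j) (xpoly * p) * (h * g) = p * smult s (xpoly * h) * g"
    proof -
      have "s = 3 + 2 * of_nat j" by (simp add: s_def)
      then show ?thesis by (simp only: smult_add_left mult_smult_left mult_smult_right distrib_left distrib_right mult_ac)
    qed
    have "one_minus_sq * pderiv (p * h * g) = one_minus_sq * pderiv p * (h * g) + p * (one_minus_sq * pderiv h) * g + one_minus_sq * p * h * pderiv g"
      unfolding pderiv_mult by (simp only: distrib_left distrib_right mult_ac add_ac)
    also have "one_minus_sq * pderiv p * (h * g) = - (smult (2 * of_nat j) (xpoly * p) * (h * g))"
      unfolding dp by simp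
    finally show ?thesis unfolding right_diff_distrib left_diff_distrib c[symmetric] by simp
  qed
  also have "\<dots> = smult k (one_minus_sq ^ Suc j * geg a (Suc j) * geg b (Suc j)) - smult s (one_minus_sq ^ j * geg a j * geg b j)"
    unfolding low der unfolding h_def g_def p_def power_Suc
    by (simp only: mult_smult_left mult_smult_right smult_minus_left mult_minus_left mult_minus_right) simp
  finally have "semicircle_int (smult k (one_minus_sq ^ Suc j * geg a (Suc j) * geg b (Suc j)) - smult s (one_minus_sq ^ j * geg a j * geg b j)) = 0"
    using semicircle_int_derivative[of "p * h * g"] by simp
  then have "k * geg_pairing (Suc j) a b = s * geg_pairing j a b"
    unfolding geg_pairing_def by (simp only: semicircle_int_diff semicircle_int_smult right_minus_eq)
  then have "s * (k * geg_pairing (Suc j) a b) = s * (s * geg_pairing j a b)" by simp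
  then show ?thesis using s unfolding k_def s_def[symmetric] by (simp add: power2_eq_square mult.assoc)
qed

text \<open>
By \<open>geg_pairing_Suc\<close> and the symmetry of the pairing, the pairing at level \<open>j + 1\<close> has the same
product with \<open>(a - j)(a + j + 2)\<close> and with \<open>(b - j)(b + j + 2)\<close>. These two numbers differ, so it is zero.
\<close>

lemma geg_pairing_orthogonal:
  assumes "a \<noteq> b" "j \<le> a" "j \<le> b"
  shows "geg_pairing j a b = 0"
proof -
  have odd: "(2 * of_nat j + 3 :: complex) ^ 2 \<noteq> 0"
    using of_nat_neq_0[of "2 * j + 2", where ?'a = complex] by (simp add: algebra_simps)
  have edge: "geg_pairing j a j = 0" if "j < a" for a
    using geg_pairing_Suc[OF that, of j] odd by simp
  consider "b = j" "j < a" | "a = j" "j < b" | "j < a" "j < b" using assms by linarith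
  then show ?thesis
  proof cases
    case 3
    let ?I = "geg_pairing (Suc j) a b"
    have 1: "(of_nat b - of_nat j) * (of_nat b + of_nat j + 2) * ?I = (2 * of_nat j + 3) ^ 2 * geg_pairing j a b"
      by (rule geg_pairing_Suc) (use 3 in auto)
    have 2: "(of_nat a - of_nat j) * (of_nat a + of_nat j + 2) * ?I = (2 * of_nat j + 3) ^ 2 * geg_pairing j a b"
      using geg_pairing_Suc[of j b a] 3 by (simp add: geg_pairing_commute)
    have "(of_nat b - of_nat a) * (of_nat b + of_nat a + 2) * ?I =
      (of_nat b - of_nat j) * (of_nat b + of_nat j + 2) * ?I - (of_nat a - of_nat j) * (of_nat a + of_nat j + 2) * ?I"
      by (simp add: algebra_simps)
    also have "\<dots> = 0" unfolding 1 2 by simp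
    finally have "(of_nat b - of_nat a) * (of_nat b + of_nat a + 2) * ?I = 0" .
    moreover have "of_nat b - of_nat a \<noteq> (0 :: complex)" using assms by simp
    moreover have "of_nat b + of_nat a + 2 \<noteq> (0 :: complex)"
      using of_nat_neq_0[of "b + a + 1", where ?'a = complex] by (simp add: algebra_simps)
    ultimately have "?I = 0" by simp
    then show ?thesis using 1 odd by simp
  qed (use edge geg_pairing_commute in auto)
qed

section \<open>Orthogonality of the recurrence polynomials\<close>

text \<open>
The constants of the diagonal factor, of the prefactor, of \<open>L\<close> and of the Gegenbauer norms nearly
cancel: the quotient of consecutive values is \<open>(2j + 3) / (2j + 1)\<close>.
\<close>

lemma pairing_weight_closed_form:
  assumes "A \<le> N" "j \<le> A"
  shows "Tcoeff N j * col_factor N j * of_nat (A choose j) * geg_pairing j A A * pochhammer (of_nat A + 2) j =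
    Tcoeff N 0 * geg_pairing 0 A A * (2 * of_nat j + 1)"
  using assms(2)
proof (induction j)
  case 0
  show ?case by (simp add: col_factor_def)
next
  case (Suc j)
  define s t a :: complex where "s = of_nat j" and "t = of_nat N" and "a = of_nat A"
  have j: "j < A" "j < N" using Suc.prems assms(1) by auto
  have ne: "s + 1 \<noteq> 0" "2 * s + 1 \<noteq> 0" "2 * s + 3 \<noteq> 0" "t - s \<noteq> 0" "t + s + 2 \<noteq> 0" "a - s \<noteq> 0" "a + s + 2 \<noteq> 0"
    using of_nat_neq_0[of j, where ?'a = complex] of_nat_neq_0[of "2 * j", where ?'a = complex]
      of_nat_neq_0[of "2 * j + 2", where ?'a = complex] of_nat_neq_0[of "N + j + 1", where ?'a = complex]
      of_nat_neq_0[of "A + j + 1", where ?'a = complex] j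
    by (auto simp: s_def t_def a_def algebra_simps)
  have T: "Tcoeff N (Suc j) = Tcoeff N j * ((t + s + 2) * (s + 1) ^ 2) / ((t - s) * ((2 * s + 1) * (2 * s + 3)))"
    using Tcoeff_Suc[OF j(2), where ?'a = complex] ne unfolding s_def[symmetric] t_def[symmetric]
    by (simp only: eq_divide_eq) simp
  have c: "col_factor N (Suc j) = col_factor N j * (t - s) / ((s + 1) * (t + s + 2))"
  proof -
    have "fact (Suc j) = (s + 1) * (fact j :: complex)" by (simp add: s_def algebra_simps)
    moreover have "pochhammer (- of_nat N) (Suc j) = pochhammer (- t) j * (s - t)"
      by (simp add: pochhammer_Suc s_def t_def)
    moreover have "pochhammer (of_nat N + 2) (Suc j) = pochhammer (t + 2) j * (t + s + 2)"
      by (simp add: pochhammer_Suc s_def t_def add_ac)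
    moreover have "- 1 * e * (P * (s - t)) / ((s + 1) * F * (Q * (t + s + 2))) = e * P / (F * Q) * (t - s) / ((s + 1) * (t + s + 2))"
      for e P F Q
    proof -
      have "- 1 * e * (P * (s - t)) = e * P * (t - s)" by (simp add: algebra_simps)
      then show ?thesis by (simp add: mult_ac)
    qed
    ultimately show ?thesis unfolding col_factor_def t_def[symmetric] power_Suc by (simp only:)
  qed
  have b: "of_nat (A choose Suc j) = of_nat (A choose j) * (a - s) / (s + 1)"
  proof -
    have "Suc j * (A choose Suc j) = (A - j) * (A choose j)"
      by (metis binomial_absorption binomial_absorb_comp mult.commute)
    then have "(of_nat (Suc j * (A choose Suc j)) :: complex) = of_nat ((A - j) * (A choose j))" by (rule arg_cong)
    then have "(s + 1) * of_nat (A choose Suc j) = (a - s) * (of_nat (A choose j) :: complex)"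
      unfolding of_nat_mult of_nat_Suc s_def a_def using j by (simp only: of_nat_diff add.commute less_imp_le)
    then show ?thesis using ne by (simp add: eq_divide_eq mult.commute)
  qed
  have g: "geg_pairing (Suc j) A A = geg_pairing j A A * (2 * s + 3) ^ 2 / ((a - s) * (a + s + 2))"
    using geg_pairing_Suc[of j A A] j ne unfolding s_def[symmetric] a_def[symmetric]
    by (simp add: eq_divide_eq mult.commute)
  have p: "pochhammer (of_nat A + 2) (Suc j) = pochhammer (of_nat A + 2) j * (a + s + 2)"
    by (simp add: pochhammer_Suc a_def s_def add_ac)
  have s': "2 * of_nat (Suc j) + 1 = 2 * s + 3" by (simp add: s_def)
  have "T0 * (u2 * s1 ^ 2) / (v * (o1 * o3)) * (C0 * v / (s1 * u2)) * (B0 * w / s1) * (I0 * o3 ^ 2 / (w * z)) * (P0 * z) =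
     (T0 * C0 * B0 * I0 * P0) * o3 / o1"
    if "s1 \<noteq> 0" "o1 \<noteq> 0" "o3 \<noteq> 0" "v \<noteq> 0" "u2 \<noteq> 0" "w \<noteq> 0" "z \<noteq> 0"
    for T0 u2 s1 v o1 o3 C0 B0 w I0 z P0 :: complex
    using that by (simp add: power2_eq_square)
  from this[OF ne] have "Tcoeff N (Suc j) * col_factor N (Suc j) * of_nat (A choose Suc j) * geg_pairing (Suc j) A A * pochhammer (of_nat A + 2) (Suc j)
    = (Tcoeff N j * col_factor N j * of_nat (A choose j) * geg_pairing j A A * pochhammer (of_nat A + 2) j) * (2 * s + 3) / (2 * s + 1)"
    unfolding T c b g p .
  also have "\<dots> = (Tcoeff N 0 * geg_pairing 0 A A * (2 * s + 1)) * (2 * s + 3) / (2 * s + 1)"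
    using Suc.IH Suc.prems by (simp add: s_def)
  also have "\<dots> = Tcoeff N 0 * geg_pairing 0 A A * (2 * s + 3)" using ne by simp
  finally show ?case unfolding s' .
qed

text \<open>
The matrix \<open>Q\<^sub>n W\<close> without the square root.
\<close>

definition rec_weight :: "nat \<Rightarrow> nat \<Rightarrow> nat \<Rightarrow> nat \<Rightarrow> complex poly" where
  "rec_weight N n k b = (\<Sum>a\<le>N. recpoly N n k a * wpoly N a b)"

text \<open>
After \<open>Q\<^sub>n L = F\<^sub>n\<close> the entry is \<open>\<Sum>\<^sub>j F\<^sub>k\<^sub>j T\<^sub>j\<^sub>j L\<^sub>b\<^sub>j\<close>. Scalar orthogonality kills every term
unless \<open>b = n + k\<close>, and then the sum over \<open>j\<close> is a combination of the moments
\<open>racah_moment_zero\<close> with \<open>r \<le> k < A\<close>; this is where \<open>n > 0\<close> enters.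
\<close>

lemma rec_weight_mean_zero:
  assumes "n > 0" "k \<le> N" "b \<le> N"
  shows "semicircle_int (rec_weight N n k b) = 0"
proof -
  have "rec_weight N n k b = (\<Sum>a\<le>N. \<Sum>j\<le>N. smult (Tcoeff N j) (one_minus_sq ^ j * (recpoly N n k a * Lpoly a j) * Lpoly b j))"
    unfolding rec_weight_def wpoly_def sum_distrib_left by (simp add: mult_ac)
  also have "\<dots> = (\<Sum>j\<le>N. \<Sum>a\<le>N. smult (Tcoeff N j) (one_minus_sq ^ j * (recpoly N n k a * Lpoly a j) * Lpoly b j))"
    by (rule sum.swap)
  also have "\<dots> = (\<Sum>j\<le>N. smult (Tcoeff N j) (one_minus_sq ^ j * (\<Sum>a\<le>N. recpoly N n k a * Lpoly a j) * Lpoly b j))"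
    by (simp only: smult_sum2 sum_distrib_left sum_distrib_right)
  also have "\<dots> = (\<Sum>j\<le>N. smult (Tcoeff N j) (one_minus_sq ^ j * row_poly N n k j * Lpoly b j))"
    using assms(2) by (intro sum.cong refl) (simp add: recpoly_times_L)
  also have "\<dots> = (\<Sum>j\<le>N. smult (Tcoeff N j * row_coeff N n k j * of_nat (b choose j)) (one_minus_sq ^ j * geg (n + k) j * geg b j))"
    unfolding row_poly_def Lpoly_def by (simp add: mult_ac)
  finally have S: "semicircle_int (rec_weight N n k b) =
     (\<Sum>j\<le>N. Tcoeff N j * row_coeff N n k j * of_nat (b choose j) * geg_pairing j (n + k) b)"
    by (simp only: semicircle_int_sum semicircle_int_smult geg_pairing_def)
  define A where "A = n + k"
  have v0: "row_coeff N n k j = (0 :: complex)" if "A < j" for j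
    using pochhammer_neg_nat_zero[OF that, where ?'a = complex] by (simp add: row_coeff_def A_def)
  show ?thesis
  proof (cases "b = A")
    case False
    show ?thesis unfolding S A_def[symmetric]
    proof (intro sum.neutral ballI)
      fix j
      show "Tcoeff N j * row_coeff N n k j * of_nat (b choose j) * geg_pairing j A b = 0"
        using geg_pairing_orthogonal[of A b j] False v0[of j] by (cases "j \<le> A"; cases "j \<le> b") auto
    qed
  next
    case True
    then have AN: "A \<le> N" using assms by simp
    define K :: complex where "K = racah_norm N n k * (Tcoeff N 0 * geg_pairing 0 A A)"
    have P0: "pochhammer (of_nat A + 2 :: complex) j \<noteq> 0" for j
      using pochhammer_of_nat_add_nonzero[of "A + 2" j, where ?'a = complex] by (simp add: add.commute)
    have "semicircle_int (rec_weight N n k b) = (\<Sum>j\<le>A. Tcoeff N j * row_coeff N n k j * of_nat (A choose j) * geg_pairing j A A)"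
      unfolding True S[unfolded True] A_def[symmetric] using AN
      by (intro sum.mono_neutral_right) (auto simp: v0)
    also have "\<dots> = (\<Sum>j\<le>A. K * (\<Sum>r\<le>k. racah_coeff N n k r * ((2 * of_nat j + 1) * pochhammer (- of_nat A) j / pochhammer (of_nat A + 2) j * racah_basis r j)))"
    proof (intro sum.cong refl)
      fix j assume "j \<in> {..A}"
      then have "j \<le> A" by simp
      note w = pairing_weight_closed_form[OF AN this]
      have "x * (n0 * (c * p) * R) * y * z = n0 * w0 * o1 * p / q * R"
        if "x * c * y * z * q = w0 * o1" "q \<noteq> 0" for x n0 c p R y z w0 o1 q :: complex
      proof -
        have "x * (n0 * (c * p) * R) * y * z = (x * c * y * z * q) * n0 * p * R / q"
          using that(2) by simp
        then show ?thesis unfolding that(1) by (simp add: mult_ac)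
      qed
      from this[OF w P0] have "Tcoeff N j * row_coeff N n k j * of_nat (A choose j) * geg_pairing j A A =
        racah_norm N n k * (Tcoeff N 0 * geg_pairing 0 A A) * (2 * of_nat j + 1) * pochhammer (- of_nat n - of_nat k) j / pochhammer (of_nat A + 2) j * racah N n k j"
        unfolding row_coeff_def .
      moreover have "- of_nat n - of_nat k = (- of_nat A :: complex)" by (simp add: A_def)
      ultimately have "Tcoeff N j * row_coeff N n k j * of_nat (A choose j) * geg_pairing j A A =
        K * (2 * of_nat j + 1) * pochhammer (- of_nat A) j / pochhammer (of_nat A + 2) j * racah N n k j"
        unfolding K_def by (simp only:)
      also have "\<dots> = K * (\<Sum>r\<le>k. racah_coeff N n k r * ((2 * of_nat j + 1) * pochhammer (- of_nat A) j / pochhammer (of_nat A + 2) j * racah_basis r j))"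
        unfolding racah_def sum_distrib_left by (intro sum.cong refl) (simp add: mult_ac)
      finally show "Tcoeff N j * row_coeff N n k j * of_nat (A choose j) * geg_pairing j A A = \<dots>" .
    qed
    also have "\<dots> = K * (\<Sum>r\<le>k. racah_coeff N n k r * (\<Sum>j\<le>A. (2 * of_nat j + 1) * pochhammer (- of_nat A) j / pochhammer (of_nat A + 2) j * racah_basis r j))"
      unfolding sum_distrib_left[symmetric] by (subst sum.swap) (simp only: sum_distrib_left)
    also have "\<dots> = 0"
      using racah_moment_zero[of _ A, where ?'a = complex] assms(1) by (simp add: A_def)
    finally show ?thesis .
  qed
qed

lemma rec_weight_Suc:
  "rec_weight N (Suc n) k b = xpoly * rec_weight N n k b - smult (rec_up N n k) (rec_weight N n (Suc k) b)
     - smult (rec_down n k) (rec_weight N n (k - 1) b) - smult (rec_prev N n k) (rec_weight N (n - 1) k b)"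
  unfolding rec_weight_def recpoly.simps
  by (simp only: sum_distrib_left smult_sum2 sum_subtractf[symmetric] left_diff_distrib mult_smult_left mult.assoc)

text \<open>
Each factor \<open>x\<close> is traded by the recurrence for row polynomials of index at least \<open>n - 1\<close>.
\<close>

lemma rec_weight_monomial:
  assumes "m < n" "k \<le> N" "b \<le> N"
  shows "semicircle_int (xpoly ^ m * rec_weight N n k b) = 0"
  using assms(1,2)
proof (induction m arbitrary: n k)
  case 0
  then show ?case using rec_weight_mean_zero assms(3) by simp
next
  case (Suc m)
  have "xpoly * rec_weight N n k b = rec_weight N (Suc n) k b + smult (rec_up N n k) (rec_weight N n (Suc k) b)
     + smult (rec_down n k) (rec_weight N n (k - 1) b) + smult (rec_prev N n k) (rec_weight N (n - 1) k b)"
  proof -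
    have "X = X - a - b - c + a + b + c" for X a b c :: "complex poly" by simp
    then show ?thesis unfolding rec_weight_Suc .
  qed
  then have e: "xpoly ^ Suc m * rec_weight N n k b = xpoly ^ m * rec_weight N (Suc n) k b
     + smult (rec_up N n k) (xpoly ^ m * rec_weight N n (Suc k) b)
     + smult (rec_down n k) (xpoly ^ m * rec_weight N n (k - 1) b) + smult (rec_prev N n k) (xpoly ^ m * rec_weight N (n - 1) k b)"
    by (simp only: power_Suc2 mult.assoc distrib_left mult_smult_right)
  have up: "rec_up N n k * semicircle_int (xpoly ^ m * rec_weight N n (Suc k) b) = 0"
    using Suc by (cases "k = N") (simp_all add: rec_up_def)
  have "semicircle_int (xpoly ^ m * rec_weight N (Suc n) k b) = 0" "semicircle_int (xpoly ^ m * rec_weight N n (k - 1) b) = 0"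
    "semicircle_int (xpoly ^ m * rec_weight N (n - 1) k b) = 0"
    using Suc by simp_all
  then show ?case unfolding e semicircle_int_add semicircle_int_smult up by simp
qed

lemma rec_weight_orthogonal:
  assumes "\<And>i. n \<le> i \<Longrightarrow> coeff q i = 0" "k \<le> N" "b \<le> N"
  shows "semicircle_int (rec_weight N n k b * q) = 0"
proof -
  have "q = (\<Sum>m<n. smult (coeff q m) (xpoly ^ m))"
  proof (rule poly_eqI)
    fix i
    have "coeff (\<Sum>m<n. smult (coeff q m) (xpoly ^ m)) i = (\<Sum>m<n. if i = m then coeff q m else 0)"
      unfolding coeff_sum by (intro sum.cong refl) (simp add: monom_altdef[of 1, simplified, symmetric])
    then show "coeff q i = coeff (\<Sum>m<n. smult (coeff q m) (xpoly ^ m)) i"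
      using assms(1)[of i] by (simp add: sum.delta)
  qed
  then have "rec_weight N n k b * q = rec_weight N n k b * (\<Sum>m<n. smult (coeff q m) (xpoly ^ m))"
    by (rule arg_cong)
  also have "\<dots> = (\<Sum>m<n. smult (coeff q m) (xpoly ^ m * rec_weight N n k b))"
    unfolding sum_distrib_left by (intro sum.cong refl) (simp only: mult_smult_right mult.commute)
  finally show ?thesis
    using rec_weight_monomial[OF _ assms(2,3)] by (simp only: semicircle_int_sum semicircle_int_smult) simp
qed

section \<open>Positivity and uniqueness\<close>

definition row_pairing :: "nat \<Rightarrow> (nat \<Rightarrow> complex poly) \<Rightarrow> (nat \<Rightarrow> complex poly) \<Rightarrow> complex" where
  "row_pairing N p q = semicircle_int (\<Sum>b\<le>N. (\<Sum>a\<le>N. p a * wpoly N a b) * map_poly cnj (q b))"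

lemma map_poly_cnj_add: "map_poly cnj (p + q) = map_poly cnj p + map_poly cnj q"
  by (rule poly_eqI) (simp add: coeff_map_poly)

lemma map_poly_cnj_smult: "map_poly cnj (smult c p) = smult (cnj c) (map_poly cnj p)"
  by (rule poly_eqI) (simp add: coeff_map_poly)

lemma row_pairing_add_right: "row_pairing N p (\<lambda>b. q b + r b) = row_pairing N p q + row_pairing N p r"
  unfolding row_pairing_def map_poly_cnj_add semicircle_int_add[symmetric] by (simp add: distrib_left sum.distrib)

lemma row_pairing_smult_right: "row_pairing N p (\<lambda>b. smult c (q b)) = cnj c * row_pairing N p q"
  unfolding row_pairing_def map_poly_cnj_smult semicircle_int_smult[symmetric] by (simp add: smult_sum2)

lemma row_pairing_sum_right: "finite S \<Longrightarrow> row_pairing N p (\<lambda>b. \<Sum>l\<in>S. q l b) = (\<Sum>l\<in>S. row_pairing N p (q l))"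
proof (induction S rule: finite_induct)
  case empty
  then show ?case by (simp add: row_pairing_def)
next
  case (insert l S)
  then show ?case by (simp add: row_pairing_add_right)
qed

lemma row_pairing_diff_left: "row_pairing N (\<lambda>a. p a - q a) r = row_pairing N p r - row_pairing N q r"
  unfolding row_pairing_def semicircle_int_diff[symmetric]
  by (simp only: left_diff_distrib sum_subtractf)

lemma poly_geg_of_real: "poly (geg a j) (of_real x :: complex) = of_real (poly (geg a j) x)"
  by (simp add: geg_def poly_pcompose geg_u_def poly_sum poly_monom geg_coeff_def pochhammer_of_real[symmetric])

lemma poly_wpoly_of_real: "poly (wpoly N a b) (of_real x :: complex) = of_real (poly (wpoly N a b) x)"
  by (simp add: wpoly_def poly_sum Lpoly_def poly_geg_of_real Tcoeff_def)

lemma Tcoeff_pos: "Tcoeff N j > (0 :: real)"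
  unfolding Tcoeff_def by (intro divide_pos_pos mult_pos_pos zero_less_power) simp_all

text \<open>
Positive definiteness. With \<open>f = d L\<close> the integrand is \<open>\<Sum>\<^sub>j Tcoeff N j (1 - x\<^sup>2)\<^sup>j\<^sup>+\<^sup>1\<^sup>/\<^sup>2 \<bar>f\<^sub>j\<bar>\<^sup>2\<close>, a
continuous nonnegative function, so each \<open>f\<^sub>j\<close> has infinitely many zeros. Since \<open>L\<close> is unipotent
triangular, \<open>d = 0\<close>.
\<close>

lemma row_pairing_self_zero:
  assumes "row_pairing N d d = 0" "a \<le> N"
  shows "d a = 0"
proof -
  define f where "f j = (\<Sum>a\<le>N. d a * Lpoly a j)" for j
  define s :: "real \<Rightarrow> real" where "s x = (\<Sum>j\<le>N. Tcoeff N j * (1 - x\<^sup>2) ^ j * (cmod (poly (f j) (of_real x)))\<^sup>2) * sqrt (1 - x\<^sup>2)" for x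
  have int: "poly (\<Sum>b\<le>N. (\<Sum>a\<le>N. d a * wpoly N a b) * map_poly cnj (d b)) (of_real x) * of_real (sqrt (1 - x\<^sup>2)) = of_real (s x)" for x
  proof -
    let ?D = "\<lambda>a. poly (d a) (of_real x)"
    let ?l = "\<lambda>a j. poly (Lpoly a j) (of_real x) :: complex"
    define t where "t j = (of_real (Tcoeff N j * (1 - x\<^sup>2) ^ j) :: complex)" for j
    have w: "poly (wpoly N a b) (of_real x) = (\<Sum>j\<le>N. t j * ?l a j * ?l b j)" for a b
      by (simp add: wpoly_def poly_sum t_def Tcoeff_def power2_eq_square mult_ac)
    have cl: "cnj (?l b j) = ?l b j" for b j
      by (simp add: Lpoly_def poly_geg_of_real)
    have fj: "poly (f j) (of_real x) = (\<Sum>a\<le>N. ?D a * ?l a j)" for j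
      by (simp add: f_def poly_sum)
    have "poly (\<Sum>b\<le>N. (\<Sum>a\<le>N. d a * wpoly N a b) * map_poly cnj (d b)) (of_real x) =
      (\<Sum>b\<le>N. (\<Sum>a\<le>N. ?D a * (\<Sum>j\<le>N. t j * ?l a j * ?l b j)) * cnj (?D b))"
      by (simp add: poly_sum w)
    also have "\<dots> = (\<Sum>b\<le>N. \<Sum>a\<le>N. \<Sum>j\<le>N. t j * (?D a * ?l a j) * (cnj (?D b) * ?l b j))"
      by (simp add: sum_distrib_left sum_distrib_right mult_ac)
    also have "\<dots> = (\<Sum>b\<le>N. \<Sum>j\<le>N. \<Sum>a\<le>N. t j * (?D a * ?l a j) * (cnj (?D b) * ?l b j))"
      by (intro sum.cong refl sum.swap)
    also have "\<dots> = (\<Sum>j\<le>N. \<Sum>b\<le>N. \<Sum>a\<le>N. t j * (?D a * ?l a j) * (cnj (?D b) * ?l b j))"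
      by (rule sum.swap)
    also have "\<dots> = (\<Sum>j\<le>N. t j * (\<Sum>a\<le>N. ?D a * ?l a j) * (\<Sum>b\<le>N. cnj (?D b) * ?l b j))"
      by (simp only: sum_distrib_left sum_distrib_right)
    also have "\<dots> = (\<Sum>j\<le>N. t j * (poly (f j) (of_real x) * cnj (poly (f j) (of_real x))))"
      unfolding fj by (simp add: cl mult.assoc)
    also have "\<dots> = of_real (\<Sum>j\<le>N. Tcoeff N j * (1 - x\<^sup>2) ^ j * (cmod (poly (f j) (of_real x)))\<^sup>2)"
      unfolding complex_norm_square[symmetric] t_def by simp
    finally show ?thesis unfolding s_def by simp
  qed
  have cont: "continuous_on {-1..1} s" unfolding s_def by (intro continuous_intros)
  have sq: "x\<^sup>2 \<le> 1" if "x \<in> {-1..1}" for x :: real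
    using that by (simp add: abs_square_le_1 abs_le_iff)
  have nn: "s x \<ge> 0" if "x \<in> {-1..1}" for x
    unfolding s_def using sq[OF that] Tcoeff_pos[of N]
    by (intro mult_nonneg_nonneg sum_nonneg) (auto simp: less_imp_le)
  have "row_pairing N d d = of_real (integral {-1..1} s)"
  proof -
    have "(s has_integral integral {-1..1} s) {-1..1}"
      using integrable_continuous_real[OF cont] by (rule integrable_integral)
    then have "((\<lambda>x. complex_of_real (s x)) has_integral of_real (integral {-1..1} s)) {-1..1}"
      by (rule has_integral_of_real)
    then show ?thesis unfolding row_pairing_def semicircle_int_def int by (rule integral_unique)
  qed
  then have "integral {-1..1} s = 0" using assms by simp
  then have s0: "s x = 0" if "x \<in> {-1..1}" for x
    using integral_eq_0_iff[OF cont _ nn] that by simp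
  have f0: "f j = 0" if "j \<le> N" for j
  proof -
    have z: "poly (f j) (of_real x) = 0" if x: "x \<in> {-1<..<1}" for x :: real
    proof -
      have pos: "1 - x\<^sup>2 > 0" using x by (simp add: abs_square_less_1 abs_less_iff)
      have "(\<Sum>j\<le>N. Tcoeff N j * (1 - x\<^sup>2) ^ j * (cmod (poly (f j) (of_real x)))\<^sup>2) = 0"
        using s0[of x] x pos by (simp add: s_def)
      then have "Tcoeff N j * (1 - x\<^sup>2) ^ j * (cmod (poly (f j) (of_real x)))\<^sup>2 = 0"
        using pos Tcoeff_pos[of N] \<open>j \<le> N\<close> by (subst (asm) sum_nonneg_eq_0_iff) (auto simp: less_imp_le)
      then show ?thesis using pos Tcoeff_pos[of N j] by simp
    qed
    show ?thesis
    proof (rule ccontr)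
      assume "f j \<noteq> 0"
      then have "finite {z. poly (f j) z = 0}" by (rule poly_roots_finite)
      moreover have "complex_of_real ` {-1<..<1} \<subseteq> {z. poly (f j) z = 0}" using z by auto
      ultimately have "finite (complex_of_real ` {-1<..<1})" by (rule finite_subset[rotated])
      then have "finite {-1<..<(1::real)}" by (rule finite_imageD) (auto simp: inj_on_def)
      then show False by (simp add: infinite_Ioo)
    qed
  qed
  have "a \<le> N \<longrightarrow> d a = 0" for a
  proof (induction "N - a" arbitrary: a rule: less_induct)
    case less
    show ?case
    proof
      assume a: "a \<le> N"
      have "f a = (\<Sum>i\<in>{a}. d i * Lpoly i a)"
        unfolding f_def
      proof (intro sum.mono_neutral_right ballI)
        fix i assume i: "i \<in> {..N} - {a}"
        show "d i * Lpoly i a = 0"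
        proof (cases "i < a")
          case True
          then show ?thesis by (simp add: Lpoly_eq_0)
        next
          case False
          then have "N - i < N - a" "i \<le> N" using i a by auto
          then show ?thesis using less by simp
        qed
      qed (use a in auto)
      then show "d a = 0" using f0[OF a] by simp
    qed
  qed
  then show ?thesis using assms(2) by blast
qed

lemma row_pairing_recpoly:
  assumes "\<And>b i. b \<le> N \<Longrightarrow> n \<le> i \<Longrightarrow> coeff (q b) i = 0" "k \<le> N"
  shows "row_pairing N (recpoly N n k) q = 0"
  unfolding row_pairing_def rec_weight_def[symmetric] semicircle_int_sum
  by (intro sum.neutral ballI rec_weight_orthogonal) (use assms in \<open>auto simp: coeff_map_poly\<close>)

lemma weight_entry:
  assumes "a \<le> N" "b \<le> N"
  shows "weight N x $$ (a, b) = poly (wpoly N a b) (of_real x) * of_real (sqrt (1 - x\<^sup>2))"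
proof -
  have l: "weight_lower N x n m = sqrt (1 - x\<^sup>2) * poly (wpoly N n m) x" if "m \<le> n" "n \<le> N" for n m
    using wpoly_eq_cheb_sum[OF that, of x] by (simp add: weight_lower_def cheb_sum_def wpoly_commute)
  have "weight N x $$ (a, b) = of_real (if b \<le> a then weight_lower N x a b else weight_lower N x b a)"
    using assms by (simp add: weight_def)
  also have "\<dots> = of_real (sqrt (1 - x\<^sup>2) * poly (wpoly N a b) x)"
    using assms l[of b a] l[of a b] by (simp add: wpoly_commute[of N b a])
  finally show ?thesis by (simp add: poly_wpoly_of_real)
qed

lemma weight_pairing_entry:
  assumes "P \<in> carrier_mat (N + 1) (N + 1)" "Q \<in> carrier_mat (N + 1) (N + 1)" "i \<le> N" "l \<le> N"
  shows "weight_pairing N P Q $$ (i, l) = row_pairing N (\<lambda>a. P $$ (i, a)) (\<lambda>b. Q $$ (l, b))"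
proof -
  have "(eval_mat P (of_real x) * weight N x * mat_adjoint (eval_mat Q (of_real x))) $$ (i, l) =
     poly (\<Sum>b\<le>N. (\<Sum>a\<le>N. P $$ (i, a) * wpoly N a b) * map_poly cnj (Q $$ (l, b))) (of_real x) * of_real (sqrt (1 - x\<^sup>2))" for x :: real
  proof -
    have set: "{0..<N + 1} = {..N}" by auto
    have adj: "mat_adjoint (eval_mat Q (of_real x)) $$ (b, l) = cnj (poly (Q $$ (l, b)) (of_real x))" if "b \<le> N" for b
      using assms that by (simp add: mat_adjoint_def eval_mat_def mat_of_rows_def)
    have d: "dim_row (mat_adjoint (eval_mat Q (of_real x))) = N + 1" "dim_col (mat_adjoint (eval_mat Q (of_real x))) = N + 1"
      using assms by (simp_all add: mat_adjoint_def eval_mat_def)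
    have PW: "(eval_mat P (of_real x) * weight N x) $$ (i, b) = (\<Sum>a\<le>N. poly (P $$ (i, a)) (of_real x) * (poly (wpoly N a b) (of_real x) * of_real (sqrt (1 - x\<^sup>2))))" if "b \<le> N" for b
    proof -
      have "(eval_mat P (of_real x) * weight N x) $$ (i, b) = (\<Sum>a\<in>{0..<N + 1}. poly (P $$ (i, a)) (of_real x) * weight N x $$ (a, b))"
        using assms that by (simp add: scalar_prod_def eval_mat_def weight_def)
      also have "\<dots> = (\<Sum>a\<le>N. poly (P $$ (i, a)) (of_real x) * (poly (wpoly N a b) (of_real x) * of_real (sqrt (1 - x\<^sup>2))))"
        unfolding set using that by (intro sum.cong refl) (simp add: weight_entry)
      finally show ?thesis .
    qed
    have "(eval_mat P (of_real x) * weight N x * mat_adjoint (eval_mat Q (of_real x))) $$ (i, l) =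
      (\<Sum>b\<in>{0..<N + 1}. (eval_mat P (of_real x) * weight N x) $$ (i, b) * mat_adjoint (eval_mat Q (of_real x)) $$ (b, l))"
      using assms d by (simp add: scalar_prod_def eval_mat_def weight_def)
    also have "\<dots> = (\<Sum>b\<le>N. (\<Sum>a\<le>N. poly (P $$ (i, a)) (of_real x) * (poly (wpoly N a b) (of_real x) * of_real (sqrt (1 - x\<^sup>2)))) * cnj (poly (Q $$ (l, b)) (of_real x)))"
      unfolding set by (intro sum.cong refl) (simp add: PW adj)
    also have "\<dots> = (\<Sum>b\<le>N. (\<Sum>a\<le>N. poly (P $$ (i, a)) (of_real x) * poly (wpoly N a b) (of_real x)) * cnj (poly (Q $$ (l, b)) (of_real x))) * of_real (sqrt (1 - x\<^sup>2))"
      unfolding sum_distrib_right by (intro sum.cong refl) (simp add: mult_ac)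
    also have "\<dots> = poly (\<Sum>b\<le>N. (\<Sum>a\<le>N. P $$ (i, a) * wpoly N a b) * map_poly cnj (Q $$ (l, b))) (of_real x) * of_real (sqrt (1 - x\<^sup>2))"
      by (simp add: poly_sum)
    finally show ?thesis .
  qed
  then show ?thesis using assms
    by (simp add: weight_pairing_def row_pairing_def semicircle_int_def)
qed

text \<open>
The difference \<open>d\<close> of the two rows has degree below \<open>n\<close>. The row of \<open>P\<^sub>n\<close> is orthogonal to \<open>d\<close>
because rows of low degree are spanned by the \<open>P\<^sub>m\<close> with \<open>m < n\<close>, which are monic.
\<close>

theorem monic_orthogonal_eq_recpoly:
  assumes "monic_orthogonal N P" "k \<le> N" "b \<le> N"
  shows "P n $$ (k, b) = recpoly N n k b"
proof -
  have carrier: "P m \<in> carrier_mat (N + 1) (N + 1)" for m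
    using assms(1) by (simp add: monic_orthogonal_def monic_mat_poly_def)
  have deg: "coeff (P m $$ (l, a)) i = 0" if "l \<le> N" "a \<le> N" "m < i" for m l a i
    using assms(1) that by (auto simp: monic_orthogonal_def monic_mat_poly_def intro!: coeff_eq_0 le_less_trans[OF _ that(3)])
  have lead: "coeff (P m $$ (l, a)) m = (if l = a then 1 else 0)" if "l \<le> N" "a \<le> N" for m l a
  proof -
    have "map_mat (\<lambda>p. coeff p m) (P m) $$ (l, a) = 1\<^sub>m (N + 1) $$ (l, a)"
      using assms(1) by (simp add: monic_orthogonal_def monic_mat_poly_def)
    then show ?thesis using that carrier[of m] by simp
  qed
  have orth: "row_pairing N (\<lambda>a. P n $$ (k, a)) (\<lambda>b. P m $$ (l, b)) = 0" if "m < n" "l \<le> N" for m l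
  proof -
    have "weight_pairing N (P n) (P m) = 0\<^sub>m (N + 1) (N + 1)"
      using assms(1) that by (simp add: monic_orthogonal_def)
    then show ?thesis using weight_pairing_entry[OF carrier carrier assms(2) that(2), of n m] assms that by simp
  qed
  have lower: "row_pairing N (\<lambda>a. P n $$ (k, a)) q = 0" if "m \<le> n" "\<And>b i. b \<le> N \<Longrightarrow> m \<le> i \<Longrightarrow> coeff (q b) i = 0" for m q
    using that
  proof (induction m arbitrary: q)
    case 0
    have "map_poly cnj (q b) = 0" if "b \<le> N" for b
      using 0 that by (intro poly_eqI) (simp add: coeff_map_poly)
    then show ?case by (simp add: row_pairing_def)
  next
    case (Suc m)
    (* subtracting r removes the coefficients of degree m, since P m is monic *)
    define r where "r b = (\<Sum>l\<le>N. smult (coeff (q l) m) (P m $$ (l, b)))" for b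
    have r: "coeff (r b) i = (if i = m then coeff (q b) m else 0)" if "b \<le> N" "m \<le> i" for b i
    proof (cases "i = m")
      case True
      have "coeff (r b) m = (\<Sum>l\<le>N. if l = b then coeff (q l) m else 0)"
        unfolding r_def coeff_sum using that by (intro sum.cong refl) (simp add: lead)
      then show ?thesis using True that by simp
    next
      case False
      then show ?thesis unfolding r_def coeff_sum using that by (simp add: deg)
    qed
    have "row_pairing N (\<lambda>a. P n $$ (k, a)) r = 0"
      unfolding r_def using Suc.prems by (simp add: row_pairing_sum_right row_pairing_smult_right orth)
    moreover have "row_pairing N (\<lambda>a. P n $$ (k, a)) (\<lambda>b. q b - r b) = 0"
    proof (rule Suc.IH)
      fix b i assume bi: "b \<le> N" "m \<le> i"
      show "coeff (q b - r b) i = 0"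
        using Suc.prems(2)[of b i] bi by (cases "i = m") (simp_all add: r)
    qed (use Suc.prems in simp)
    moreover have "q = (\<lambda>b. (q b - r b) + r b)" by simp
    ultimately show ?case using row_pairing_add_right[of N "\<lambda>a. P n $$ (k, a)" "\<lambda>b. q b - r b" r] by simp
  qed
  define d where "d a = P n $$ (k, a) - recpoly N n k a" for a
  have d: "coeff (d a) i = 0" if "a \<le> N" "n \<le> i" for a i
  proof (cases "i = n")
    case True
    then show ?thesis using that assms by (simp add: d_def lead recpoly_monic)
  next
    case False
    then show ?thesis using that assms by (simp add: d_def deg recpoly_coeff_above)
  qed
  have "row_pairing N d d = 0"
    using lower[of n d] row_pairing_recpoly[of N n d k] d assms(2)
    unfolding d_def[abs_def] row_pairing_diff_left by simp
  then have "d b = 0" using assms(3) by (rule row_pairing_self_zero)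
  then show ?thesis by (simp add: d_def)
qed

section \<open>The entries as hypergeometric series\<close>

lemma row_coeff_hypergeometric:
  "(- 1) ^ n / 2 ^ n * row_coeff N n k j =
    c_coeff N n k * (- 1) ^ j *
       (pochhammer (- of_nat N) j * pochhammer (- of_nat k - of_nat n) j /
         (fact j * pochhammer (of_nat N + 2) j)) *
       hypergeo_sum j
         [- of_nat j, of_nat j + 1, - of_nat k, - of_nat N - of_nat n - 1]
         [1, - of_nat k - of_nat n, - of_nat N] 1"
proof -
  have e: "- of_nat k - of_nat n = (- of_nat n - of_nat k :: complex)" by simp
  have "hypergeo_sum j [- of_nat j, of_nat j + 1, - of_nat k, - of_nat N - of_nat n - 1]
         [1, - of_nat k - of_nat n, - of_nat N] 1 = (\<Sum>r\<le>j. racah_coeff N n k r * racah_basis r j :: complex)"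
    unfolding hypergeo_sum_def e
    by (intro sum.cong refl) (simp add: racah_coeff_def racah_basis_def pochhammer_fact[symmetric] power2_eq_square mult_ac)
  also have "\<dots> = (\<Sum>r\<le>max j k. racah_coeff N n k r * racah_basis r j)"
    by (intro sum.mono_neutral_left) (auto simp: racah_basis_zero)
  also have "\<dots> = racah N n k j" by (rule racah_eq_sum[symmetric]) simp
  finally have h: "hypergeo_sum j [- of_nat j, of_nat j + 1, - of_nat k, - of_nat N - of_nat n - 1]
         [1, - of_nat k - of_nat n, - of_nat N] 1 = (racah N n k j :: complex)" .
  have c: "(- 1) ^ n / 2 ^ n * racah_norm N n k = c_coeff N n k"
  proof -
    have "(4 :: complex) ^ n = 2 ^ n * 2 ^ n" by (simp add: power_mult_distrib[symmetric])
    then show ?thesis by (simp add: racah_norm_def c_coeff_def)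
  qed
  show ?thesis unfolding e h[unfolded e] row_coeff_def col_factor_def c[symmetric] by simp
qed

theorem theorem6p2:
  fixes N n k j :: nat and P :: "nat \<Rightarrow> complex poly mat" and u :: complex
  assumes "monic_orthogonal N P"
    and "k \<le> N" and "j \<le> N"
  shows "calR_mat N P n u $$ (k, j) =
    (if j \<le> k + n then
       c_coeff N n k * (- 1) ^ j *
       (pochhammer (- of_nat N) j * pochhammer (- of_nat k - of_nat n) j /
         (fact j * pochhammer (of_nat N + 2) j)) *
       hypergeo_sum j
         [- of_nat j, of_nat j + 1, - of_nat k, - of_nat N - of_nat n - 1]
         [1, - of_nat k - of_nat n, - of_nat N] 1 *
       hypergeo_sum (k + n - j)
         [of_nat j - of_nat k - of_nat n, of_nat n + of_nat k + of_nat j + 2]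
         [of_nat j + 3 / 2] u
     else 0)"
proof -
  have carrier: "P n \<in> carrier_mat (N + 1) (N + 1)"
    using assms(1) by (simp add: monic_orthogonal_def monic_mat_poly_def)
  have set: "{0..<N + 1} = {..N}" by auto
  have L: "L_mat N z $$ (b, j) = poly (Lpoly b j) z" if "b \<le> N" for b z
    using that assms(3) gegenbauer_eq_geg[of j b z]
    by (cases "j \<le> b") (simp_all add: L_mat_def Lpoly_def)
  have "calR_mat N P n u $$ (k, j) =
    (\<Sum>b\<in>{0..<N + 1}. (- 1) ^ n / 2 ^ n * poly (P n $$ (k, b)) (1 - 2 * u) * L_mat N (1 - 2 * u) $$ (b, j))"
    using assms carrier
    by (simp add: calR_mat_def R_mat_def M_mat_def eval_mat_def scalar_prod_def L_mat_def)
  also have "\<dots> = (- 1) ^ n / 2 ^ n * poly (\<Sum>b\<le>N. recpoly N n k b * Lpoly b j) (1 - 2 * u)"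
    unfolding set poly_sum sum_distrib_left
    by (intro sum.cong refl) (simp add: L monic_orthogonal_eq_recpoly[OF assms(1,2)])
  also have "\<dots> = ((- 1) ^ n / 2 ^ n * row_coeff N n k j) * poly (geg (n + k) j) (1 - 2 * u)"
    unfolding recpoly_times_L[OF assms(2,3)] row_poly_def by simp
  finally have R: "calR_mat N P n u $$ (k, j) = \<dots>" .
  show ?thesis
  proof (cases "j \<le> k + n")
    case True
    then have "poly (geg (n + k) j) (1 - 2 * u) =
      hypergeo_sum (k + n - j) [of_nat j - of_nat k - of_nat n, of_nat n + of_nat k + of_nat j + 2] [of_nat j + 3 / 2] u"
      using poly_geg[of j "n + k" u] by (simp add: add.commute diff_diff_add)
    then show ?thesis unfolding R row_coeff_hypergeometric using True by simp
  next
    case False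
    then have "row_coeff N n k j = (0 :: complex)"
      using pochhammer_neg_nat_zero[of "n + k" j, where ?'a = complex] by (simp add: row_coeff_def)
    then show ?thesis unfolding R using False by simp
  qed
qed

end
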